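(* Let $d\geq 1$, $0<s<1$ and $1\le q\le p<\infty$. Assume that $\alpha,\beta\in\mathbb{R}$ satisfy $$\alpha<sq-\Big(1-\tfrac{q}{p}\Big)d,\qquad \beta<sp,\qquad \alpha>-d,\qquad \beta>-d,\qquad \alpha+\tfrac{q\beta}{p}>-d,$$ and that $sq-\alpha-\tfrac{q\beta}{p}\neq d$. Let $u\in C_c^1(\mathbb{R}^d)$ if $sq-\alpha-\tfrac{q\beta}{p}<d$, and $u\in C_c^1(\mathbb{R}^d\setminus\{0\})$ if $sq-\alpha-\tfrac{q\beta}{p}>d$. Then $$\int_{\mathbb{R}^d}\left(\int_{\mathbb{R}^d}\frac{|u(x)-u(y)|^p}{|x-y|^{d+sp}}|y|^{\beta}\,dy\right)^{\frac{q}{p}}|x|^{\alpha}\,dx\geq \mathcal{C}^{p,q}_{d,s,\alpha,\beta}\int_{\mathbb{R}^d}\frac{|u(x)|^q}{|x|^{sq-\alpha-\frac{q\beta}{p}}}\,dx,$$ where $$\mathcal{C}^{p,q}_{d,s,\alpha,\beta}=\left(\int_{0}^{1}t^{sp-1}\left(t^{-\left(\frac{p}{q}-1\right)d-\frac{p\alpha}{q}}+t^{-\beta}\right)\left|1-t^{\left(d+\alpha+\frac{q\beta}{p}-sq\right)/q}\right|^p\Phi_{d,s,p}(t)\,dt\right)^{\frac{q}{p}}.$$ Moreover, the constant $\mathcal{C}^{p,q}_{d,s,\alpha,\beta}$ is finite and sharp, i.e. it is the largest constant for which the inequality holds for all admissible $u$.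
   Context: For $d\ge 2$, $\omega_{d-2}=|\mathbb{S}^{d-2}|=\frac{2\pi^{(d-1)/2}}{\Gamma((d-1)/2)}$ denotes the surface measure of the unit sphere in $\mathbb{R}^{d-1}$. For $0\le t<1$ the function $\Phi_{d,s,p}$ is defined by $$\Phi_{d,s,p}(t)=\omega_{d-2}\int_{-1}^{1}\frac{(1-r^{2})^{\frac{d-3}{2}}}{(1-2tr+t^2)^{\frac{d+sp}{2}}}\,dr\quad (d\ge 2),\qquad \Phi_{1,s,p}(t)=(1-t)^{-1-sp}+(1+t)^{-1-sp}.$$ Equivalently, $\Phi_{d,s,p}(t)=\int_{\mathbb{S}^{d-1}}|\omega-t\sigma|^{-d-sp}\,d\sigma$ for any $\omega\in\mathbb{S}^{d-1}$ (with counting measure on $\mathbb{S}^0=\{\pm1\}$ when $d=1$). $C_c^1(U)$ denotes continuously differentiable functions with compact support in $U$. *)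

theory Defs
  imports "HOL-Analysis.Analysis"
begin

text \<open>Power of an extended nonnegative real with a positive real exponent
  (used only with exponent q/p > 0): infinity stays infinity.\<close>
definition epowr :: "ennreal \<Rightarrow> real \<Rightarrow> ennreal" where
  "epowr x a = (if x = \<infinity> then \<infinity> else ennreal (enn2real x powr a))"

text \<open>omega_{d-2} = |S^{d-2}| for d >= 2.\<close>
definition omega_sphere :: "nat \<Rightarrow> real" where
  "omega_sphere d = 2 * pi powr ((real d - 1) / 2) / Gamma ((real d - 1) / 2)"

definition Phi :: "nat \<Rightarrow> real \<Rightarrow> real \<Rightarrow> real \<Rightarrow> real" where
  "Phi d s p t =
     (if d = 1 then (1 - t) powr (-1 - s*p) + (1 + t) powr (-1 - s*p)
      else omega_sphere d *
        (LBINT r:{-1<..<1}. (1 - r^2) powr ((real d - 3) / 2)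
                             / (1 - 2*t*r + t^2) powr ((real d + s*p) / 2)))"

text \<open>C^1_c(U): continuously differentiable on the open set U, with compact
  support contained in U (u is extended by zero outside U).\<close>
definition C1c :: "('a::euclidean_space) set \<Rightarrow> ('a \<Rightarrow> real) \<Rightarrow> bool" where
  "C1c U u \<longleftrightarrow>
     (\<exists>u'. (\<forall>x\<in>U. (u has_derivative blinfun_apply (u' x)) (at x)) \<and> continuous_on U u') \<and>
     compact (closure {x. u x \<noteq> 0}) \<and> closure {x. u x \<noteq> 0} \<subseteq> U"

definition Cconst :: "nat \<Rightarrow> real \<Rightarrow> real \<Rightarrow> real \<Rightarrow> real \<Rightarrow> real \<Rightarrow> ennreal" where
  "Cconst d s p q \<alpha> \<beta> =
     epowr (\<integral>\<^sup>+ t\<in>{0<..<1}.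
        ennreal (t powr (s*p - 1)
          * (t powr (-(p/q - 1) * real d - p*\<alpha>/q) + t powr (-\<beta>))
          * \<bar>1 - t powr ((real d + \<alpha> + q*\<beta>/p - s*q) / q)\<bar> powr p
          * Phi d s p t) \<partial>lborel) (q/p)"

definition LHS :: "real \<Rightarrow> real \<Rightarrow> real \<Rightarrow> real \<Rightarrow> real \<Rightarrow> ('a::euclidean_space \<Rightarrow> real) \<Rightarrow> ennreal" where
  "LHS s p q \<alpha> \<beta> u =
     (\<integral>\<^sup>+ x. epowr (\<integral>\<^sup>+ y. ennreal (\<bar>u x - u y\<bar> powr p / norm (x - y) powr (real DIM('a) + s*p)
                                  * norm y powr \<beta>) \<partial>lborel) (q/p)
            * ennreal (norm x powr \<alpha>) \<partial>lborel)"

definition RHS :: "real \<Rightarrow> real \<Rightarrow> real \<Rightarrow> real \<Rightarrow> real \<Rightarrow> ('a::euclidean_space \<Rightarrow> real) \<Rightarrow> ennreal" where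
  "RHS s p q \<alpha> \<beta> u =
     (\<integral>\<^sup>+ x. ennreal (\<bar>u x\<bar> powr q / norm x powr (s*q - \<alpha> - q*\<beta>/p)) \<partial>lborel)"

end

theory Submission
  imports Defs
begin

text \<open>
  Put \<open>w x = |x| powr (- \<gamma>)\<close>, where \<open>\<gamma> = (d + \<alpha> + q \<beta> / p - s q) / q\<close>. Formally \<open>w\<close> gives equality at every \<open>x\<close>.

  Hoelder's inequality in \<open>y\<close>, with \<open>|w x - w y|\<close> as second function, bounds the inner integral to
  the power \<open>q / p\<close> from below by an integral of \<open>|u x - u y| powr q\<close> against a kernel that is again homogeneous
  and rotation invariant. For exponent \<open>q\<close> one applies a Picone inequality: if \<open>w y < w x\<close> and
  \<open>\<theta> = w y / w x\<close>, then
  \<open>|u x - u y| powr q \<ge> (1 - \<theta>) powr (q - 1) * (|u x| powr q - \<theta> powr (1 - q) * |u y| powr q)\<close>. After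
  integration both terms on the right are multiples of the Hardy integral by scaling, and the inversion
  \<open>t \<mapsto> 1 / t\<close> of the ratio \<open>t = |y| / |x|\<close> shows that the multiples add up to the constant.

  For sharpness take \<open>u x = w x * \<eta> (ln |x| / N)\<close> with a bump function \<open>\<eta>\<close>. Then
  \<open>u x - u y = \<eta> (ln |x| / N) * (w x - w y) + w y * (\<eta> (ln |x| / N) - \<eta> (ln |y| / N))\<close>. The first term
  contributes the constant times the Hardy integral, which grows like \<open>N\<close>, and the second one is of order \<open>N powr (1 - q)\<close>.
\<close>

section \<open>Polar coordinates\<close>

text \<open>Hoelder's inequality is an equality when \<open>|u x - u y|\<close> is proportional to
  the second function, so the formal extremal \<open>w\<close> dictates that function. Its power
  \<open>p - q\<close> later meets the power \<open>q - 1\<close> of the Picone inequality, and the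
  missing factor \<open>|1 - \<theta>|\<close> comes from the difference of the two Picone
  multiples; this is how the \<open>p\<close>-th power in the constant arises.

  Every kernel that occurs is homogeneous and rotation invariant. The \<open>y\<close>-integral at
  \<open>x\<close> is therefore a power of \<open>|x|\<close> times a one-dimensional integral in
  \<open>t = |y| / |x|\<close>, and the polar coordinates below serve only this reduction.

  The two bounds on \<open>\<alpha>\<close> are equivalent to
  \<open>- d < \<beta> - \<gamma> p < s p\<close>. Together with the bounds on
  \<open>\<beta>\<close> they give integrability at \<open>t = 0\<close> and
  \<open>t = \<infinity>\<close>, while \<open>s < 1\<close> controls the singularity at
  \<open>t = 1\<close>.

  The function \<open>w\<close> is not admissible: \<open>w powr q\<close> times the Hardy weight is
  \<open>|x| powr (- d)\<close>, whose integral diverges logarithmically both at 0 and at infinity.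
  Hence the cutoff in the logarithmic variable.\<close>

lemma nn_integral_lborel_substitution:
  fixes \<phi> \<phi>' \<psi> :: "real \<Rightarrow> real" and g :: "real \<Rightarrow> ennreal"
  assumes I: "I \<in> sets borel"
    and interval: "\<And>x y. x \<in> I \<Longrightarrow> y \<in> I \<Longrightarrow> {x..y} \<subseteq> I"
    and deriv: "\<And>x. x \<in> I \<Longrightarrow> (\<phi> has_real_derivative \<phi>' x) (at x)"
    and nonneg: "\<And>x. x \<in> I \<Longrightarrow> 0 \<le> \<phi>' x"
    and \<phi>_measurable [measurable]: "\<phi> \<in> borel_measurable borel"
    and \<phi>'_measurable [measurable]: "\<phi>' \<in> borel_measurable borel"
    and \<psi>: "\<And>y. \<psi> y \<in> I" "\<And>y. \<phi> (\<psi> y) = y"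
    and less_iff: "\<And>x y. x \<in> I \<Longrightarrow> y < \<phi> x \<longleftrightarrow> \<psi> y < x" "\<And>x y. x \<in> I \<Longrightarrow> \<phi> x < y \<longleftrightarrow> x < \<psi> y"
    and g [measurable]: "g \<in> borel_measurable borel"
  shows "(\<integral>\<^sup>+ y. g y \<partial>lborel) = (\<integral>\<^sup>+ x\<in>I. g (\<phi> x) * ennreal (\<phi>' x) \<partial>lborel)"
proof -
  note [measurable] = I
  let ?D = "density lborel (\<lambda>x. ennreal (\<phi>' x) * indicator I x)"
  \<comment> \<open>Lebesgue measure is determined by the lengths of open intervals, and the
    preimage of \<open>(l, u)\<close> in \<open>I\<close> is the interval from
    \<open>\<psi> l\<close> to \<open>\<psi> u\<close>.\<close>
  have "lborel = distr ?D borel \<phi>"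
  proof (rule lborel_eqI)
    fix l u :: real
    assume "\<And>b. b \<in> Basis \<Longrightarrow> l \<bullet> b \<le> u \<bullet> b"
    then have lu: "l \<le> u" by simp
    have le: "\<psi> l \<le> \<psi> u"
      using less_iff(2)[OF \<psi>(1)[of u], of l] less_iff(2)[OF \<psi>(1)[of l], of u] lu \<psi>(2)
      by (smt (verit))
    have sub: "{\<psi> l..\<psi> u} \<subseteq> I"
      by (intro interval \<psi>)
    have mem: "x \<in> I" if "\<psi> l < x" "x < \<psi> u" for x
      using sub that by force
    have "emeasure (distr ?D borel \<phi>) (box l u) = emeasure ?D (\<phi> -` {l<..<u})"
      by (simp add: emeasure_distr box_real)
    also have "\<dots> = (\<integral>\<^sup>+x. ennreal (\<phi>' x) * indicator I x * indicator (\<phi> -` {l<..<u}) x \<partial>lborel)"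
      by (subst emeasure_density) (use measurable_sets_borel[OF \<phi>_measurable, of "{l<..<u}"] in auto)
    also have "\<dots> = (\<integral>\<^sup>+x. ennreal (\<phi>' x) * indicator {\<psi> l<..<\<psi> u} x \<partial>lborel)"
      by (intro nn_integral_cong) (auto simp: indicator_def less_iff mem)
    \<comment> \<open>The endpoints are added because the fundamental theorem is applied on a closed
      interval.\<close>
    also have "\<dots> = (\<integral>\<^sup>+x. ennreal (\<phi>' x) * indicator {\<psi> l..\<psi> u} x \<partial>lborel)"
    proof (intro nn_integral_cong_AE)
      have "AE x in lborel. x \<notin> {\<psi> l, \<psi> u}"
        by (intro AE_not_in countable_imp_null_set_lborel) auto
      then show "AE x in lborel. ennreal (\<phi>' x) * indicator {\<psi> l<..<\<psi> u} x
          = ennreal (\<phi>' x) * indicator {\<psi> l..\<psi> u} x"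
        by eventually_elim (auto simp: indicator_def)
    qed
    also have "\<dots> = ennreal (\<phi> (\<psi> u) - \<phi> (\<psi> l))"
      using sub le deriv nonneg by (intro nn_integral_FTC_Icc)
        (auto intro: has_vector_derivative_at_within
          simp: has_real_derivative_iff_has_vector_derivative[symmetric] intro: DERIV_subset)
    finally show "emeasure (distr ?D borel \<phi>) (box l u) = (\<Prod>b\<in>Basis. (u - l) \<bullet> b)"
      by (simp add: \<psi>)
  qed simp
  then have "(\<integral>\<^sup>+ y. g y \<partial>lborel) = (\<integral>\<^sup>+ y. g y \<partial>distr ?D borel \<phi>)"
    by simp
  also have "\<dots> = (\<integral>\<^sup>+ x\<in>I. g (\<phi> x) * ennreal (\<phi>' x) \<partial>lborel)"
    by (subst nn_integral_distr) (auto simp: nn_integral_density mult_ac)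
  finally show ?thesis .
qed

text \<open>The substitution rule is used with \<open>\<phi> = ln\<close>, on the right-hand
  integral: its density \<open>1 / x\<close> cancels the factor \<open>exp (ln x)\<close>.\<close>

lemma nn_integral_exp_substitution:
  fixes g :: "real \<Rightarrow> ennreal"
  assumes [measurable]: "g \<in> borel_measurable borel"
  shows "(\<integral>\<^sup>+ t\<in>{0<..}. g t \<partial>lborel) = (\<integral>\<^sup>+ y. g (exp y) * ennreal (exp y) \<partial>lborel)"
proof -
  have *: "y < ln x \<longleftrightarrow> exp y < x" "ln x < y \<longleftrightarrow> x < exp y" if "x > 0" for x y :: real
    using that by (metis exp_ln exp_less_cancel_iff)+
  have "(\<integral>\<^sup>+ y. g (exp y) * ennreal (exp y) \<partial>lborel)
      = (\<integral>\<^sup>+ x\<in>{0<..}. g (exp (ln x)) * ennreal (exp (ln x)) * ennreal (1 / x) \<partial>lborel)"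
    by (rule nn_integral_lborel_substitution[where \<psi> = exp])
       (auto intro!: derivative_eq_intros simp: *)
  also have "\<dots> = (\<integral>\<^sup>+ t\<in>{0<..}. g t \<partial>lborel)"
    by (intro nn_integral_cong) (auto simp: indicator_def mult.assoc ennreal_mult'[symmetric])
  finally show ?thesis by simp
qed

lemma nn_integral_scale_pos:
  fixes g :: "real \<Rightarrow> ennreal"
  assumes [measurable]: "g \<in> borel_measurable borel" and c: "c > 0"
  shows "(\<integral>\<^sup>+ t\<in>{0<..}. g t \<partial>lborel) = (\<integral>\<^sup>+ t\<in>{0<..}. g (c * t) * ennreal c \<partial>lborel)"
proof -
  have "(\<integral>\<^sup>+ t\<in>{0<..}. g t \<partial>lborel) = ennreal c * (\<integral>\<^sup>+ t. g (c * t) * indicator {0<..} (c * t) \<partial>lborel)"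
    using c by (subst nn_integral_real_affine[where c = c and t = 0]) auto
  also have "\<dots> = (\<integral>\<^sup>+ t. ennreal c * (g (c * t) * indicator {0<..} (c * t)) \<partial>lborel)"
    by (simp add: nn_integral_cmult)
  also have "\<dots> = (\<integral>\<^sup>+ t\<in>{0<..}. g (c * t) * ennreal c \<partial>lborel)"
    using c by (intro nn_integral_cong) (auto simp: indicator_def zero_less_mult_iff mult.commute)
  finally show ?thesis .
qed

text \<open>Ball volumes are the distribution function of the radius, so they determine its image
  measure. The index set is arbitrary because the formula is needed for the whole basis and for the
  basis without one vector.\<close>

lemma nn_integral_radial_PiM:
  fixes h :: "real \<Rightarrow> ennreal"
  assumes A: "finite A" "A \<noteq> {}" and h [measurable]: "h \<in> borel_measurable borel"
  shows "(\<integral>\<^sup>+ f. h (sqrt (\<Sum>i\<in>A. (f i)\<^sup>2)) \<partial>Pi\<^sub>M A (\<lambda>_. lborel))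
    = (\<integral>\<^sup>+ t\<in>{0<..}. h t * ennreal (card A * unit_ball_vol (card A) * t ^ (card A - 1)) \<partial>lborel)"
proof -
  let ?n = "card A" and ?P = "Pi\<^sub>M A (\<lambda>_. lborel :: real measure)"
  let ?D = "density lborel (\<lambda>t. ennreal (?n * unit_ball_vol ?n * t ^ (?n - 1)) * indicator {0<..} t)"
  let ?R = "\<lambda>f :: _ \<Rightarrow> real. sqrt (\<Sum>i\<in>A. (f i)\<^sup>2)"
  have n: "?n > 0" using A by (simp add: card_gt_0_iff)
  have R [measurable]: "?R \<in> borel_measurable ?P" by measurable
  have D: "emeasure ?D {..r} = ennreal (unit_ball_vol ?n * r ^ ?n)" if "r \<ge> 0" for r
  proof -
    have "emeasure ?D {..r}
        = (\<integral>\<^sup>+t. ennreal (?n * unit_ball_vol ?n * t ^ (?n - 1)) * indicator {0<..} t * indicator {..r} t \<partial>lborel)"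
      by (subst emeasure_density) auto
    also have "\<dots> = (\<integral>\<^sup>+t. ennreal (?n * unit_ball_vol ?n * t ^ (?n - 1)) * indicator {0..r} t \<partial>lborel)"
    proof (intro nn_integral_cong_AE)
      have "AE x in lborel. x \<notin> {0 :: real}"
        by (intro AE_not_in countable_imp_null_set_lborel) auto
      then show "AE t in lborel. ennreal (?n * unit_ball_vol ?n * t ^ (?n - 1)) * indicator {0<..} t * indicator {..r} t
          = ennreal (?n * unit_ball_vol ?n * t ^ (?n - 1)) * indicator {0..r} t"
        by eventually_elim (auto simp: indicator_def)
    qed
    also have "\<dots> = ennreal (unit_ball_vol ?n * r ^ ?n - unit_ball_vol ?n * 0 ^ ?n)"
      using that n by (intro nn_integral_FTC_Icc)
        (auto intro!: derivative_eq_intros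
          simp: has_real_derivative_iff_has_vector_derivative[symmetric] intro: DERIV_subset)
    finally show ?thesis using n by (simp add: zero_power)
  qed
  have "distr ?P borel ?R = ?D"
  proof (rule measure_eqI_generator_eq)
    let ?E = "range (\<lambda>a::real. {..a})"
    show "Int_stable ?E" by (auto simp: Int_stable_def)
    show "?E \<subseteq> Pow UNIV" "sets (distr ?P borel ?R) = sigma_sets UNIV ?E" "sets ?D = sigma_sets UNIV ?E"
      by (simp_all add: borel_eq_atMost)
    show "range (\<lambda>n::nat. {..real n}) \<subseteq> ?E" by auto
    show "(\<Union>n::nat. {..real n}) = UNIV" by (auto simp: real_arch_simple)
    fix X assume "X \<in> ?E"
    then obtain r where X: "X = {..r}" by auto
    have nonneg: "(\<Sum>i\<in>A. (f i)\<^sup>2) \<ge> 0" for f :: "_ \<Rightarrow> real" by (simp add: sum_nonneg)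
    have e: "emeasure (distr ?P borel ?R) {..r} = emeasure ?P ({f. ?R f \<le> r} \<inter> space ?P)"
      by (subst emeasure_distr) (auto intro!: arg_cong2[where f = emeasure])
    show "emeasure (distr ?P borel ?R) X = emeasure ?D X"
    proof (cases "r > 0")
      case True
      then show ?thesis
        unfolding X e using emeasure_cball_aux[OF A(1) True] D[of r] by simp
    next
      case False
      have DX: "emeasure ?D X = 0"
      proof -
        have "emeasure ?D X \<le> emeasure ?D {..0}"
          unfolding X using False by (intro emeasure_mono) auto
        also have "\<dots> = 0" using D[of 0] n by simp
        finally show ?thesis by simp
      qed
      \<comment> \<open>The volume formula is available for positive radii only; for
        \<open>r \<le> 0\<close> the set lies in every small ball, hence is null.\<close>
      have "emeasure ?P ({f. ?R f \<le> r} \<inter> space ?P) \<le> ennreal (unit_ball_vol ?n * \<epsilon> ^ ?n)" if "\<epsilon> > 0" for \<epsilon>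
      proof -
        have "emeasure ?P ({f. ?R f \<le> r} \<inter> space ?P) \<le> emeasure ?P ({f. ?R f \<le> \<epsilon>} \<inter> space ?P)"
          using False that by (intro emeasure_mono) auto
        then show ?thesis using emeasure_cball_aux[OF A(1) that] by simp
      qed
      then have "emeasure ?P ({f. ?R f \<le> r} \<inter> space ?P) \<le> 0"
      proof (intro tendsto_lowerbound[where F = "at_right 0"])
        have "((\<lambda>\<epsilon>. ennreal (unit_ball_vol ?n * \<epsilon> ^ ?n)) \<longlongrightarrow> ennreal (unit_ball_vol ?n * 0 ^ ?n)) (at_right 0)"
          by (intro tendsto_intros) 
        then show "((\<lambda>\<epsilon>. ennreal (unit_ball_vol ?n * \<epsilon> ^ ?n)) \<longlongrightarrow> 0) (at_right 0)"
          using n by (simp add: zero_power)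
      qed (auto simp: eventually_at_filter)
      then show ?thesis using DX e X by simp
    qed
  next
    fix n :: nat
    show "emeasure (distr ?P borel ?R) {..real n} \<noteq> \<infinity>"
    proof -
      have "emeasure (distr ?P borel ?R) {..real n} \<le> emeasure (distr ?P borel ?R) {..real n + 1}"
        by (intro emeasure_mono) auto
      also have "\<dots> = emeasure ?P ({f. ?R f \<le> real n + 1} \<inter> space ?P)"
        by (subst emeasure_distr) (auto intro!: arg_cong2[where f = emeasure])
      also have "\<dots> < \<infinity>" using emeasure_cball_aux[OF A(1), of "real n + 1"] by simp
      finally show ?thesis by simp
    qed
  qed
  have "(\<integral>\<^sup>+ f. h (?R f) \<partial>?P) = (\<integral>\<^sup>+ t. h t \<partial>distr ?P borel ?R)"
    by (subst nn_integral_distr) auto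
  also have "\<dots> = (\<integral>\<^sup>+ t. h t \<partial>?D)"
    unfolding \<open>distr ?P borel ?R = ?D\<close> ..
  also have "\<dots> = (\<integral>\<^sup>+ t\<in>{0<..}. h t * ennreal (card A * unit_ball_vol (card A) * t ^ (card A - 1)) \<partial>lborel)"
    by (subst nn_integral_density) (auto simp: mult_ac)
  finally show ?thesis .
qed

lemma nn_integral_lborel_PiM:
  fixes F :: "'a::euclidean_space \<Rightarrow> ennreal"
  assumes [measurable]: "F \<in> borel_measurable borel"
  shows "(\<integral>\<^sup>+ z. F z \<partial>lborel) = (\<integral>\<^sup>+ f. F (\<Sum>b\<in>Basis. f b *\<^sub>R b) \<partial>Pi\<^sub>M Basis (\<lambda>_. lborel))"
  by (subst lborel_eq, subst nn_integral_distr) auto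

lemma nn_integral_radial:
  fixes h :: "real \<Rightarrow> ennreal"
  assumes h [measurable]: "h \<in> borel_measurable borel"
  shows "(\<integral>\<^sup>+ (z::'a::euclidean_space). h (norm z) \<partial>lborel)
    = (\<integral>\<^sup>+ t\<in>{0<..}. h t * ennreal (DIM('a) * unit_ball_vol (DIM('a)) * t ^ (DIM('a) - 1)) \<partial>lborel)"
proof -
  have "(\<integral>\<^sup>+ (z::'a). h (norm z) \<partial>lborel)
      = (\<integral>\<^sup>+ f. h (norm (\<Sum>b\<in>Basis. f b *\<^sub>R b :: 'a)) \<partial>Pi\<^sub>M Basis (\<lambda>_. lborel))"
    by (rule nn_integral_lborel_PiM) simp
  also have "\<dots> = (\<integral>\<^sup>+ f. h (sqrt (\<Sum>b\<in>(Basis::'a set). (f b)\<^sup>2)) \<partial>Pi\<^sub>M Basis (\<lambda>_. lborel))"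
    using euclidean_dist_l2[of _ "0 :: 'a"] by (simp add: L2_set_def)
  finally show ?thesis
    by (simp add: nn_integral_radial_PiM)
qed

text \<open>In polar coordinates \<open>v\<close> is the cotangent of the angle and \<open>r\<close>
  its cosine.\<close>

lemma nn_integral_planar_substitution:
  fixes g :: "real \<Rightarrow> ennreal"
  assumes [measurable]: "g \<in> borel_measurable borel"
  shows "(\<integral>\<^sup>+ v. g v \<partial>lborel)
    = (\<integral>\<^sup>+ r\<in>{-1<..<1}. g (r / sqrt (1 - r\<^sup>2)) * ennreal ((1 - r\<^sup>2) powr (-3/2)) \<partial>lborel)"
proof (rule nn_integral_lborel_substitution[where \<psi> = "\<lambda>v. v / sqrt (1 + v\<^sup>2)"])
  have pos: "1 - r\<^sup>2 > 0" if "r \<in> {-1<..<1}" for r :: real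
    using that by (auto simp: abs_square_less_1)
  have s: "1 + v\<^sup>2 > 0" for v :: real
    by (simp add: add_pos_nonneg)
  show mem: "v / sqrt (1 + v\<^sup>2) \<in> {-1<..<1}" for v :: real
  proof -
    have "\<bar>v\<bar> < sqrt (1 + v\<^sup>2)"
      by (simp add: real_less_rsqrt)
    then show ?thesis
      using s[of v] by (auto simp: field_simps abs_less_iff)
  qed
  have one: "1 - (v / sqrt (1 + v\<^sup>2))\<^sup>2 = 1 / (1 + v\<^sup>2)" for v :: real
    using s[of v] by (simp add: power_divide field_simps)
  show inv: "(v / sqrt (1 + v\<^sup>2)) / sqrt (1 - (v / sqrt (1 + v\<^sup>2))\<^sup>2) = v" for v :: real
    unfolding one using s[of v] by (simp add: real_sqrt_divide)
  show deriv: "((\<lambda>r. r / sqrt (1 - r\<^sup>2)) has_real_derivative (1 - r\<^sup>2) powr (-3/2)) (at r)"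
    if "r \<in> {-1<..<1}" for r :: real
  proof -
    let ?q = "1 - r\<^sup>2"
    have q: "?q > 0" using pos[OF that] .
    have e: "?q powr (-3/2) = 1 / (?q * sqrt ?q)"
    proof -
      have "?q powr (3/2) = ?q * sqrt ?q"
        using q powr_add[of ?q 1 "1/2"] by (simp add: powr_half_sqrt)
      then show ?thesis using powr_minus_divide[of ?q "3/2"] by simp
    qed
    have "((\<lambda>r. r / sqrt (1 - r\<^sup>2)) has_real_derivative
        (1 * sqrt ?q - r * (inverse (sqrt ?q) / 2 * (- 2 * r))) / (sqrt ?q * sqrt ?q)) (at r)"
      using q by (auto intro!: derivative_eq_intros simp: power2_eq_square)
    also have "(1 * sqrt ?q - r * (inverse (sqrt ?q) / 2 * (- 2 * r))) / (sqrt ?q * sqrt ?q)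
        = ?q powr (-3/2)"
    proof -
      have "sqrt ?q * sqrt ?q = ?q" using q by simp
      then have "1 * sqrt ?q - r * (inverse (sqrt ?q) / 2 * (- 2 * r)) = 1 / sqrt ?q"
        using q by (simp add: field_simps power2_eq_square)
      then show ?thesis
        using q e by (simp add: field_simps)
    qed
    finally show ?thesis .
  qed
  have mono: "x / sqrt (1 - x\<^sup>2) < y / sqrt (1 - y\<^sup>2)" if "x \<in> {-1<..<1}" "y \<in> {-1<..<1}" "x < y" for x y :: real
  proof (rule DERIV_pos_imp_increasing[OF \<open>x < y\<close>])
    fix z assume "x \<le> z" "z \<le> y"
    then have z: "z \<in> {-1<..<1}" using that by auto
    then show "\<exists>l. ((\<lambda>r. r / sqrt (1 - r\<^sup>2)) has_real_derivative l) (at z) \<and> 0 < l"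
      using deriv[OF z] pos[OF z] by auto
  qed
  show "y < x / sqrt (1 - x\<^sup>2) \<longleftrightarrow> y / sqrt (1 + y\<^sup>2) < x"
    "x / sqrt (1 - x\<^sup>2) < y \<longleftrightarrow> x < y / sqrt (1 + y\<^sup>2)" if "x \<in> {-1<..<1}" for x y :: real
    using mono[OF that mem[of y]] mono[OF mem[of y] that] inv[of y]
    by (metis less_asym linorder_neqE_linordered_idom)+
qed auto

text \<open>Polar coordinates \<open>y = t r\<close>, \<open>\<tau> = t sqrt (1 - r^2)\<close> in
  the upper half-plane, obtained from one-dimensional substitutions and Fubini:
  \<open>y = \<tau> v\<close> for fixed \<open>\<tau>\<close>,
  \<open>\<tau> = t / sqrt (1 + v^2)\<close> for fixed \<open>v\<close>, and
  \<open>v = r / sqrt (1 - r^2)\<close>.\<close>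

lemma nn_integral_polar:
  fixes F :: "real \<Rightarrow> real \<Rightarrow> ennreal"
  assumes [measurable]: "case_prod F \<in> borel_measurable (borel \<Otimes>\<^sub>M borel)"
  shows "(\<integral>\<^sup>+ y. (\<integral>\<^sup>+ \<tau>\<in>{0<..}. F y \<tau> * ennreal (\<tau> ^ n) \<partial>lborel) \<partial>lborel)
    = (\<integral>\<^sup>+ t\<in>{0<..}. (\<integral>\<^sup>+ r\<in>{-1<..<1}. F (t * r) (t * sqrt (1 - r\<^sup>2))
          * ennreal (t ^ (n + 1) * (1 - r\<^sup>2) powr ((real n - 1) / 2)) \<partial>lborel) \<partial>lborel)"
proof -
  let ?G = "\<lambda>v. \<integral>\<^sup>+ t\<in>{0<..}. F (t * (v / sqrt (1 + v\<^sup>2))) (t / sqrt (1 + v\<^sup>2))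
      * ennreal (t ^ (n + 1) / sqrt (1 + v\<^sup>2) ^ (n + 2)) \<partial>lborel"
  have "(\<integral>\<^sup>+ y. (\<integral>\<^sup>+ \<tau>\<in>{0<..}. F y \<tau> * ennreal (\<tau> ^ n) \<partial>lborel) \<partial>lborel)
      = (\<integral>\<^sup>+ \<tau>. (\<integral>\<^sup>+ y. F y \<tau> * ennreal (\<tau> ^ n) * indicator {0<..} \<tau> \<partial>lborel) \<partial>lborel)"
    by (subst lborel_pair.Fubini') auto
  also have "\<dots> = (\<integral>\<^sup>+ \<tau>. (\<integral>\<^sup>+ v. F (\<tau> * v) \<tau> * ennreal (\<tau> ^ (n + 1)) * indicator {0<..} \<tau> \<partial>lborel) \<partial>lborel)"
  proof (rule nn_integral_cong)
    fix \<tau> :: real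
    show "(\<integral>\<^sup>+ y. F y \<tau> * ennreal (\<tau> ^ n) * indicator {0<..} \<tau> \<partial>lborel)
        = (\<integral>\<^sup>+ v. F (\<tau> * v) \<tau> * ennreal (\<tau> ^ (n + 1)) * indicator {0<..} \<tau> \<partial>lborel)"
    proof (cases "\<tau> > 0")
      case True
      then have "(\<integral>\<^sup>+ y. F y \<tau> * ennreal (\<tau> ^ n) * indicator {0<..} \<tau> \<partial>lborel)
          = ennreal \<tau> * (\<integral>\<^sup>+ v. F (\<tau> * v) \<tau> * ennreal (\<tau> ^ n) * indicator {0<..} \<tau> \<partial>lborel)"
        by (subst nn_integral_real_affine[where c = \<tau> and t = 0]) auto
      also have "\<dots> = (\<integral>\<^sup>+ v. ennreal \<tau> * (F (\<tau> * v) \<tau> * ennreal (\<tau> ^ n) * indicator {0<..} \<tau>) \<partial>lborel)"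
        by (simp add: nn_integral_cmult)
      also have "\<dots> = (\<integral>\<^sup>+ v. F (\<tau> * v) \<tau> * ennreal (\<tau> ^ (n + 1)) * indicator {0<..} \<tau> \<partial>lborel)"
        using True by (intro nn_integral_cong) (simp add: ennreal_mult' mult_ac)
      finally show ?thesis .
    qed simp
  qed
  also have "\<dots> = (\<integral>\<^sup>+ v. (\<integral>\<^sup>+ \<tau>\<in>{0<..}. F (\<tau> * v) \<tau> * ennreal (\<tau> ^ (n + 1)) \<partial>lborel) \<partial>lborel)"
    by (subst lborel_pair.Fubini') auto
  also have "\<dots> = (\<integral>\<^sup>+ v. ?G v \<partial>lborel)"
  proof (rule nn_integral_cong)
    fix v :: real
    let ?c = "1 / sqrt (1 + v\<^sup>2)"
    have c: "?c > 0" by (simp add: add_pos_nonneg)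
    have "(\<integral>\<^sup>+ \<tau>\<in>{0<..}. F (\<tau> * v) \<tau> * ennreal (\<tau> ^ (n + 1)) \<partial>lborel)
        = (\<integral>\<^sup>+ t\<in>{0<..}. F (?c * t * v) (?c * t) * ennreal ((?c * t) ^ (n + 1)) * ennreal ?c \<partial>lborel)"
      by (rule nn_integral_scale_pos[OF _ c]) measurable
    also have "\<dots> = ?G v"
    proof (rule nn_integral_cong)
      fix t :: real
      have "(?c * t) ^ (n + 1) * ?c = t ^ (n + 1) / sqrt (1 + v\<^sup>2) ^ (n + 2)"
        by (simp add: power_divide)
      then have "ennreal ((?c * t) ^ (n + 1)) * ennreal ?c = ennreal (t ^ (n + 1) / sqrt (1 + v\<^sup>2) ^ (n + 2))"
        using c by (subst ennreal_mult''[symmetric]) auto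
      then show "F (?c * t * v) (?c * t) * ennreal ((?c * t) ^ (n + 1)) * ennreal ?c * indicator {0<..} t
        = F (t * (v / sqrt (1 + v\<^sup>2))) (t / sqrt (1 + v\<^sup>2))
          * ennreal (t ^ (n + 1) / sqrt (1 + v\<^sup>2) ^ (n + 2)) * indicator {0<..} t"
        by (simp add: mult.assoc del: power_Suc)
    qed
    finally show "(\<integral>\<^sup>+ \<tau>\<in>{0<..}. F (\<tau> * v) \<tau> * ennreal (\<tau> ^ (n + 1)) \<partial>lborel) = ?G v" .
  qed
  also have "\<dots> = (\<integral>\<^sup>+ r\<in>{-1<..<1}. ?G (r / sqrt (1 - r\<^sup>2)) * ennreal ((1 - r\<^sup>2) powr (-3/2)) \<partial>lborel)"
    by (rule nn_integral_planar_substitution) measurable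
  also have "\<dots> = (\<integral>\<^sup>+ r. (\<integral>\<^sup>+ t. F (t * r) (t * sqrt (1 - r\<^sup>2))
          * ennreal (t ^ (n + 1) * (1 - r\<^sup>2) powr ((real n - 1) / 2)) * indicator {-1<..<1} r * indicator {0<..} t \<partial>lborel) \<partial>lborel)"
  proof (rule nn_integral_cong)
    fix r :: real
    show "?G (r / sqrt (1 - r\<^sup>2)) * ennreal ((1 - r\<^sup>2) powr (-3/2)) * indicator {-1<..<1} r
      = (\<integral>\<^sup>+ t. F (t * r) (t * sqrt (1 - r\<^sup>2))
          * ennreal (t ^ (n + 1) * (1 - r\<^sup>2) powr ((real n - 1) / 2)) * indicator {-1<..<1} r * indicator {0<..} t \<partial>lborel)"
    proof (cases "r \<in> {-1<..<1}")
      case True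
      let ?q = "1 - r\<^sup>2"
      have q: "?q > 0" using True by (auto simp: abs_square_less_1)
      have s: "sqrt (1 + (r / sqrt ?q)\<^sup>2) = 1 / sqrt ?q"
      proof -
        have "1 + (r / sqrt ?q)\<^sup>2 = 1 / ?q"
          using q by (simp add: power_divide field_simps)
        then show ?thesis by (simp add: real_sqrt_divide)
      qed
      \<comment> \<open>The exponent is \<open>(n + 2) / 2\<close> from rescaling
        \<open>\<tau>\<close>, minus \<open>3 / 2\<close> from the derivative of
        \<open>v\<close>.\<close>
      have pw: "1 / (1 / sqrt ?q) ^ (n + 2) * ?q powr (-3/2) = ?q powr ((real n - 1) / 2)"
      proof -
        have x: "1 / (1 / sqrt ?q) ^ (n + 2) = ?q powr ((real n + 2) / 2)"
          using q by (simp only: power_one_over powr_half_sqrt[symmetric] powr_realpow[symmetric] powr_powr powr_gt_zero)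
            (simp add: powr_powr powr_realpow[symmetric] add.commute)
        have "(real n + 2) / 2 + -3/2 = (real n - 1) / 2" by (simp add: field_simps)
        then show ?thesis unfolding x by (simp only: powr_add[symmetric])
      qed
      have "?G (r / sqrt ?q) = (\<integral>\<^sup>+ t\<in>{0<..}. F (t * r) (t * sqrt ?q)
          * ennreal (t ^ (n + 1) * (1 / (1 / sqrt ?q) ^ (n + 2))) \<partial>lborel)"
        unfolding s using q by (simp add: field_simps)
      then have "?G (r / sqrt ?q) * ennreal (?q powr (-3/2)) * indicator {-1<..<1} r
          = (\<integral>\<^sup>+ t\<in>{0<..}. F (t * r) (t * sqrt ?q)
          * ennreal (t ^ (n + 1) * (1 / (1 / sqrt ?q) ^ (n + 2))) \<partial>lborel) * ennreal (?q powr (-3/2))"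
        using True by simp
      also have "\<dots> = (\<integral>\<^sup>+ t. (F (t * r) (t * sqrt ?q)
          * ennreal (t ^ (n + 1) * (1 / (1 / sqrt ?q) ^ (n + 2))) * indicator {0<..} t) * ennreal (?q powr (-3/2)) \<partial>lborel)"
        by (subst nn_integral_multc) auto
      also have "\<dots> = (\<integral>\<^sup>+ t. F (t * r) (t * sqrt (1 - r\<^sup>2))
          * ennreal (t ^ (n + 1) * (1 - r\<^sup>2) powr ((real n - 1) / 2)) * indicator {-1<..<1} r * indicator {0<..} t \<partial>lborel)"
        using True unfolding pw[symmetric]
        by (intro nn_integral_cong) (auto simp: indicator_def mult.assoc ennreal_mult'[symmetric] ennreal_mult''[symmetric])
      finally show ?thesis .
    qed simp
  qed
  also have "\<dots> = (\<integral>\<^sup>+ t. (\<integral>\<^sup>+ r. F (t * r) (t * sqrt (1 - r\<^sup>2))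
          * ennreal (t ^ (n + 1) * (1 - r\<^sup>2) powr ((real n - 1) / 2)) * indicator {-1<..<1} r * indicator {0<..} t \<partial>lborel) \<partial>lborel)"
    by (subst lborel_pair.Fubini') auto
  also have "\<dots> = (\<integral>\<^sup>+ t\<in>{0<..}. (\<integral>\<^sup>+ r\<in>{-1<..<1}. F (t * r) (t * sqrt (1 - r\<^sup>2))
          * ennreal (t ^ (n + 1) * (1 - r\<^sup>2) powr ((real n - 1) / 2)) \<partial>lborel) \<partial>lborel)"
    by (intro nn_integral_cong, subst nn_integral_multc) auto
  finally show ?thesis .
qed

text \<open>By the functional equation of \<open>Gamma\<close>, the normalisation of
  \<open>Phi\<close> is the factor produced by the radial formula in dimension
  \<open>d - 1\<close>.\<close>

lemma omega_sphere_eq: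
  assumes "d \<ge> 2"
  shows "omega_sphere d = real (d - 1) * unit_ball_vol (real (d - 1))"
proof -
  define x where "x = (real d - 1) / 2"
  have x: "x > 0" "real d - 1 = 2 * x" "real (d - 1) = 2 * x"
    using assms by (auto simp: x_def)
  have "Gamma (x + 1) = x * Gamma x"
    using x by (intro Gamma_plus1) (auto elim!: nonpos_Ints_cases)
  then show ?thesis
    using x Gamma_real_pos[OF x(1)] unfolding omega_sphere_def unit_ball_vol_def x(2,3) by simp
qed

text \<open>Cylindrical coordinates around the axis \<open>b\<close>: the orthogonal complement has
  dimension \<open>DIM('a) - 1\<close>, and only its radial variable enters, with Jacobian
  \<open>\<tau> ^ (DIM('a) - 2)\<close>.\<close>

lemma nn_integral_axial:
  fixes F :: "real \<Rightarrow> real \<Rightarrow> ennreal" and b :: "'a::euclidean_space"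
  assumes b: "b \<in> Basis" and d: "DIM('a) \<ge> 2"
    and F [measurable]: "case_prod F \<in> borel_measurable (borel \<Otimes>\<^sub>M borel)"
  shows "(\<integral>\<^sup>+ (z::'a). F (z \<bullet> b) (sqrt (\<Sum>i\<in>Basis-{b}. (z \<bullet> i)\<^sup>2)) \<partial>lborel)
    = ennreal (omega_sphere DIM('a))
      * (\<integral>\<^sup>+ y. (\<integral>\<^sup>+ \<tau>\<in>{0<..}. F y \<tau> * ennreal (\<tau> ^ (DIM('a) - 2)) \<partial>lborel) \<partial>lborel)"
proof -
  interpret product_sigma_finite "\<lambda>_::'a. lborel :: real measure"
    by standard
  let ?A = "Basis - {b}"
  have A: "finite ?A" "card ?A = DIM('a) - 1" "?A \<noteq> {}"
  proof -
    show "finite ?A" "card ?A = DIM('a) - 1" using b by auto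
    then show "?A \<noteq> {}" using d by (metis One_nat_def card.empty diff_is_0_eq not_less_eq_eq numeral_2_eq_2)
  qed
  have "(\<integral>\<^sup>+ (z::'a). F (z \<bullet> b) (sqrt (\<Sum>i\<in>?A. (z \<bullet> i)\<^sup>2)) \<partial>lborel)
      = (\<integral>\<^sup>+ f. F ((\<Sum>i\<in>Basis. f i *\<^sub>R i) \<bullet> b) (sqrt (\<Sum>j\<in>?A. ((\<Sum>i\<in>Basis. f i *\<^sub>R i) \<bullet> j)\<^sup>2)) \<partial>Pi\<^sub>M Basis (\<lambda>_. lborel))"
    by (rule nn_integral_lborel_PiM) measurable
  also have "\<dots> = (\<integral>\<^sup>+ f. F (f b) (sqrt (\<Sum>j\<in>?A. (f j)\<^sup>2)) \<partial>Pi\<^sub>M (insert b ?A) (\<lambda>_. lborel))"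
    using b by (simp add: insert_absorb)
  also have "\<dots> = (\<integral>\<^sup>+ y. (\<integral>\<^sup>+ f. F y (sqrt (\<Sum>j\<in>?A. (f j)\<^sup>2)) \<partial>Pi\<^sub>M ?A (\<lambda>_. lborel)) \<partial>lborel)"
    by (subst product_nn_integral_insert_rev) (auto intro!: nn_integral_cong arg_cong2[where f = F] sum.cong)
  also have "\<dots> = (\<integral>\<^sup>+ y. (\<integral>\<^sup>+ \<tau>\<in>{0<..}. F y \<tau> *
      ennreal (real (card ?A) * unit_ball_vol (card ?A) * \<tau> ^ (card ?A - 1)) \<partial>lborel) \<partial>lborel)"
    by (intro nn_integral_cong nn_integral_radial_PiM A) measurable
  also have "\<dots> = (\<integral>\<^sup>+ y. ennreal (omega_sphere DIM('a)) * (\<integral>\<^sup>+ \<tau>\<in>{0<..}. F y \<tau> * ennreal (\<tau> ^ (DIM('a) - 2)) \<partial>lborel) \<partial>lborel)"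
    unfolding A(2) omega_sphere_eq[OF d]
    by (subst nn_integral_cmult[symmetric])
       (auto intro!: nn_integral_cong simp: ennreal_mult' mult_ac numeral_2_eq_2)
  also have "\<dots> = ennreal (omega_sphere DIM('a))
      * (\<integral>\<^sup>+ y. (\<integral>\<^sup>+ \<tau>\<in>{0<..}. F y \<tau> * ennreal (\<tau> ^ (DIM('a) - 2)) \<partial>lborel) \<partial>lborel)"
    by (subst nn_integral_cmult) auto
  finally show ?thesis .
qed

section \<open>Integrals against a power of the distance to a unit vector\<close>

lemma nn_integral_lborel_affine:
  fixes F :: "'a::euclidean_space \<Rightarrow> ennreal"
  assumes [measurable]: "F \<in> borel_measurable borel" and c: "c \<noteq> 0"
  shows "(\<integral>\<^sup>+ y. F y \<partial>lborel) = ennreal (\<bar>c\<bar> ^ DIM('a)) * (\<integral>\<^sup>+ y. F (t + c *\<^sub>R y) \<partial>lborel)"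
  by (subst lborel_affine[OF c, of t])
     (simp add: nn_integral_density nn_integral_distr nn_integral_cmult)

text \<open>Translation invariance determines Lebesgue measure up to a factor, and the unit ball shows that
  the factor is 1.\<close>

lemma nn_integral_lborel_isometric_involution:
  fixes f :: "'a::euclidean_space \<Rightarrow> 'a" and F :: "'a \<Rightarrow> ennreal"
  assumes f: "linear f" "\<And>x. norm (f x) = norm x" "\<And>x. f (f x) = x"
    and F: "F \<in> borel_measurable borel"
  shows "(\<integral>\<^sup>+ x. F (f x) \<partial>lborel) = (\<integral>\<^sup>+ x. F x \<partial>lborel)"
proof -
  have f_meas [measurable]: "f \<in> borel_measurable borel"
    by (intro borel_measurable_continuous_onI linear_continuous_on linear_linear[THEN iffD2] f)
  have "distr lborel borel f = lborel"
  proof (rule measure_eqI)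
    fix A assume "A \<in> sets (distr lborel borel f)"
    then have A [measurable]: "A \<in> sets borel" by simp
    let ?B = "ball (0::'a) 1"
    have B_sets [measurable]: "?B \<in> sets borel" by simp
    have B: "emeasure lborel ?B \<noteq> 0" "emeasure lborel ?B \<noteq> \<infinity>"
      using unit_ball_vol_pos[of "real DIM('a)"] by (simp_all add: emeasure_ball del: unit_ball_vol_pos)
    have fB: "indicator ?B (f x) = (indicator ?B x :: ennreal)" for x
      by (simp add: indicator_def f)
    \<comment> \<open>Both sides are evaluations of one double integral, of the indicator of
      \<open>f x \<in> A\<close> and \<open>f x + y \<in> ?B\<close>, in the two orders.\<close>
    have "emeasure (distr lborel borel f) A * emeasure lborel ?B
        = (\<integral>\<^sup>+ x. indicator A (f x) * emeasure lborel ?B \<partial>lborel)"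
    proof (subst nn_integral_multc)
      have "emeasure (distr lborel borel f) A = (\<integral>\<^sup>+ x. indicator A x \<partial>distr lborel borel f)"
        by simp
      also have "\<dots> = (\<integral>\<^sup>+ x. indicator A (f x) \<partial>lborel)"
        by (rule nn_integral_distr) measurable
      finally show "emeasure (distr lborel borel f) A * emeasure lborel ?B
          = (\<integral>\<^sup>+ x. indicator A (f x) \<partial>lborel) * emeasure lborel ?B" by simp
    qed measurable
    also have "\<dots> = (\<integral>\<^sup>+ x. (\<integral>\<^sup>+ y. indicator A (f x) * indicator ?B (f x + y) \<partial>lborel) \<partial>lborel)"
    proof (rule nn_integral_cong)
      fix x
      have "emeasure lborel ?B = (\<integral>\<^sup>+ y. indicator ?B (f x + y) \<partial>lborel)"
        using nn_integral_lborel_affine[of "indicator ?B :: 'a \<Rightarrow> ennreal" 1 "f x"]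
        by (simp add: borel_measurable_indicator)
      then show "indicator A (f x) * emeasure lborel ?B = (\<integral>\<^sup>+ y. indicator A (f x) * indicator ?B (f x + y) \<partial>lborel)"
        by (subst nn_integral_cmult) auto
    qed
    also have "\<dots> = (\<integral>\<^sup>+ y. (\<integral>\<^sup>+ x. indicator A (f x) * indicator ?B (f x + y) \<partial>lborel) \<partial>lborel)"
      by (subst lborel_pair.Fubini') auto
    \<comment> \<open>The translation by \<open>- f y\<close> turns \<open>f x\<close> into
      \<open>f x - y\<close>, because \<open>f\<close> is an involution, and \<open>f x + y\<close>
      into \<open>f x\<close>, which lies in the ball exactly if \<open>x\<close> does.\<close>
    also have "\<dots> = (\<integral>\<^sup>+ y. (\<integral>\<^sup>+ x. indicator A (f x - y) * indicator ?B x \<partial>lborel) \<partial>lborel)"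
    proof (rule nn_integral_cong)
      fix y
      have "(\<integral>\<^sup>+ x. indicator A (f x) * indicator ?B (f x + y) \<partial>lborel)
          = (\<integral>\<^sup>+ x. indicator A (f (- f y + x)) * indicator ?B (f (- f y + x) + y) \<partial>lborel)"
        using nn_integral_lborel_affine[of "\<lambda>x. indicator A (f x) * indicator ?B (f x + y)" 1 "- f y"] by simp
      also have "\<dots> = (\<integral>\<^sup>+ x. indicator A (f x - y) * indicator ?B x \<partial>lborel)"
        by (intro nn_integral_cong) (simp add: linear_diff[OF f(1)] f(3) fB)
      finally show "(\<integral>\<^sup>+ x. indicator A (f x) * indicator ?B (f x + y) \<partial>lborel) =
          (\<integral>\<^sup>+ x. indicator A (f x - y) * indicator ?B x \<partial>lborel)" .
    qed
    also have "\<dots> = (\<integral>\<^sup>+ x. (\<integral>\<^sup>+ y. indicator A (f x - y) * indicator ?B x \<partial>lborel) \<partial>lborel)"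
      by (subst lborel_pair.Fubini') auto
    also have "\<dots> = (\<integral>\<^sup>+ x. emeasure lborel A * indicator ?B x \<partial>lborel)"
    proof (rule nn_integral_cong)
      fix x
      have "emeasure lborel A = (\<integral>\<^sup>+ y. indicator A (f x - y) \<partial>lborel)"
        using nn_integral_lborel_affine[of "indicator A :: 'a \<Rightarrow> ennreal" "-1" "f x"]
        by (simp add: borel_measurable_indicator)
      then show "(\<integral>\<^sup>+ y. indicator A (f x - y) * indicator ?B x \<partial>lborel) = emeasure lborel A * indicator ?B x"
        by (subst nn_integral_multc) auto
    qed
    also have "\<dots> = emeasure lborel A * emeasure lborel ?B"
      by (simp add: nn_integral_cmult)
    finally show "emeasure (distr lborel borel f) A = emeasure lborel A"
      using B by (metis ennreal_mult_divide_eq infinity_ennreal_def)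
  qed simp
  then have "(\<integral>\<^sup>+ x. F x \<partial>lborel) = (\<integral>\<^sup>+ x. F x \<partial>distr lborel borel f)" by simp
  also have "\<dots> = (\<integral>\<^sup>+ x. F (f x) \<partial>lborel)"
    using F by (subst nn_integral_distr) auto
  finally show ?thesis ..
qed

text \<open>Since \<open>|a| = |b|\<close>, the reflection in the hyperplane orthogonal to
  \<open>a - b\<close> exchanges \<open>a\<close> and \<open>b\<close>, and a reflection is a linear
  isometric involution.\<close>

lemma nn_integral_dist_rotate:
  fixes a b :: "'a::euclidean_space" and h k :: "real \<Rightarrow> ennreal"
  assumes ab: "norm a = norm b"
    and [measurable]: "h \<in> borel_measurable borel" "k \<in> borel_measurable borel"
  shows "(\<integral>\<^sup>+ y. h (norm y) * k (norm (a - y)) \<partial>lborel) = (\<integral>\<^sup>+ y. h (norm y) * k (norm (b - y)) \<partial>lborel)"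
proof (cases "a = b")
  case False
  define v where "v = a - b"
  have v: "v \<bullet> v \<noteq> 0" using False by (simp add: v_def)
  define f where "f y = y - (2 * (y \<bullet> v) / (v \<bullet> v)) *\<^sub>R v" for y
  have lin: "linear f"
    by (rule linearI) (simp_all add: f_def inner_add_left algebra_simps add_divide_distrib)
  have inv: "f (f x) = x" for x
    using v by (simp add: f_def inner_diff_left diff_divide_distrib algebra_simps)
  have norm_f: "norm (f x) = norm x" for x
  proof -
    have "f x \<bullet> f x = x \<bullet> x"
      using v by (simp add: f_def inner_diff_left inner_diff_right inner_commute field_simps)
    then show ?thesis by (simp add: norm_eq_sqrt_inner)
  qed
  have "v \<bullet> v = 2 * (b \<bullet> b) - 2 * (a \<bullet> b)" "b \<bullet> v = a \<bullet> b - b \<bullet> b"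
    using ab by (simp_all add: v_def inner_diff_left inner_diff_right inner_commute norm_eq_sqrt_inner)
  then have "2 * (b \<bullet> v) = - (v \<bullet> v)" by simp
  then have "f b = a"
    using v by (simp add: f_def v_def)
  then have "norm (a - f y) = norm (b - y)" for y
    by (metis lin linear_diff norm_f)
  then have "(\<integral>\<^sup>+ y. h (norm (f y)) * k (norm (a - f y)) \<partial>lborel) = (\<integral>\<^sup>+ y. h (norm y) * k (norm (b - y)) \<partial>lborel)"
    by (simp add: norm_f)
  then show ?thesis
    using nn_integral_lborel_isometric_involution[OF lin norm_f inv, of "\<lambda>y. h (norm y) * k (norm (a - y))"]
    by simp
qed simp

text \<open>\<open>Psi d m\<close> extends \<open>Phi d s p\<close>, with \<open>m = d + s p\<close>, from \<open>(0,1)\<close> to \<open>(0,\<infinity>)\<close>, and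
  \<open>radN d m h\<close> is the integral of \<open>h |z| * |e - z| powr (- m)\<close> over \<open>z\<close> in dimension \<open>d\<close>, for a unit vector \<open>e\<close>
  (lemma \<open>nn_integral_kernel_Basis\<close>).\<close>

definition Psi :: "nat \<Rightarrow> real \<Rightarrow> real \<Rightarrow> ennreal" where
  "Psi d m t = (if d = 1 then ennreal (\<bar>1 - t\<bar> powr (-m) + \<bar>1 + t\<bar> powr (-m))
    else ennreal (omega_sphere d) *
      (\<integral>\<^sup>+ r\<in>{-1<..<1}. ennreal ((1 - r\<^sup>2) powr ((real d - 3) / 2) * (1 - 2 * t * r + t\<^sup>2) powr (- m / 2)) \<partial>lborel))"

definition radN :: "nat \<Rightarrow> real \<Rightarrow> (real \<Rightarrow> ennreal) \<Rightarrow> ennreal" where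
  "radN d m h = (\<integral>\<^sup>+ t\<in>{0<..}. h t * ennreal (t powr (real d - 1)) * Psi d m t \<partial>lborel)"

lemma Psi_measurable [measurable]: "Psi d m \<in> borel_measurable borel"
  unfolding Psi_def by measurable

lemma powr_half_square: "x \<ge> 0 \<Longrightarrow> (x\<^sup>2) powr (a / 2) = x powr a" for x :: real
  by (cases "x = 0") (simp_all add: powr_powr flip: powr_numeral)

lemma nn_integral_Basis_singleton:
  fixes F :: "real \<Rightarrow> ennreal" and b :: "'a::euclidean_space"
  assumes b: "Basis = {b}" and [measurable]: "F \<in> borel_measurable borel"
  shows "(\<integral>\<^sup>+ (z::'a). F (z \<bullet> b) \<partial>lborel) = (\<integral>\<^sup>+ y. F y \<partial>lborel)"
proof -
  interpret product_sigma_finite "\<lambda>_::'a. lborel :: real measure"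
    by standard
  have bb: "b \<in> Basis" unfolding b by simp
  have "(\<integral>\<^sup>+ (z::'a). F (z \<bullet> b) \<partial>lborel) = (\<integral>\<^sup>+ f. F ((\<Sum>i\<in>Basis. f i *\<^sub>R i) \<bullet> b) \<partial>Pi\<^sub>M Basis (\<lambda>_::'a. lborel))"
    by (rule nn_integral_lborel_PiM) measurable
  also have "\<dots> = (\<integral>\<^sup>+ f. F (f b) \<partial>Pi\<^sub>M {b} (\<lambda>_::'a. lborel))"
    using bb by (simp add: b[symmetric])
  also have "\<dots> = (\<integral>\<^sup>+ y. F y \<partial>lborel)"
    by (rule product_nn_integral_singleton) measurable
  finally show ?thesis .
qed

text \<open>By the law of cosines \<open>|b - z|^2 = 1 - 2 (z \<bullet> b) + |z|^2\<close>, so the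
  integrand depends only on the axial coordinate and the distance from the axis; polar coordinates
  in that half-plane give \<open>t = |z|\<close> and the cosine \<open>r\<close>. In dimension 1 the
  two half-lines play the role of the sphere.\<close>

lemma nn_integral_kernel_Basis:
  fixes b :: "'a::euclidean_space" and h :: "real \<Rightarrow> ennreal"
  assumes b: "b \<in> Basis" and h [measurable]: "h \<in> borel_measurable borel"
  shows "(\<integral>\<^sup>+ (z::'a). h (norm z) * ennreal (norm (b - z) powr (-m)) \<partial>lborel) = radN DIM('a) m h"
proof (cases "DIM('a) = 1")
  case True
  then have B: "Basis = {b}"
    using b by (metis card_1_singletonE singletonD)
  have [simp]: "norm b = 1" "b \<bullet> b = 1" using b by auto
  have z: "z = (z \<bullet> b) *\<^sub>R b" for z :: 'a
    using euclidean_representation[of z] unfolding B by simp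
  have n: "norm z = \<bar>z \<bullet> b\<bar>" and n': "norm (b - z) = \<bar>1 - z \<bullet> b\<bar>" for z :: 'a
  proof -
    show "norm z = \<bar>z \<bullet> b\<bar>" by (subst z) simp
    have "b - z = (1 - z \<bullet> b) *\<^sub>R b"
      using z[of z] by (simp add: algebra_simps)
    then show "norm (b - z) = \<bar>1 - z \<bullet> b\<bar>" by simp
  qed
  let ?F = "\<lambda>y. h \<bar>y\<bar> * ennreal (\<bar>1 - y\<bar> powr (-m))"
  have "(\<integral>\<^sup>+ (z::'a). h (norm z) * ennreal (norm (b - z) powr (-m)) \<partial>lborel) = (\<integral>\<^sup>+ y. ?F y \<partial>lborel)"
    unfolding n' unfolding n by (rule nn_integral_Basis_singleton[OF B, of ?F]) measurable
  \<comment> \<open>Reflecting the negative half-line produces the summand with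
    \<open>|1 + t|\<close> in \<open>Psi\<close>.\<close>
  also have "\<dots> = (\<integral>\<^sup>+ y. ?F y * indicator {0<..} y + ?F y * indicator {..<0} y \<partial>lborel)"
  proof (rule nn_integral_cong_AE)
    have "AE x in lborel. x \<notin> {0 :: real}"
      by (intro AE_not_in countable_imp_null_set_lborel) auto
    then show "AE y in lborel. ?F y = ?F y * indicator {0<..} y + ?F y * indicator {..<0} y"
      by eventually_elim (auto simp: indicator_def)
  qed
  also have "\<dots> = (\<integral>\<^sup>+ y\<in>{0<..}. ?F y \<partial>lborel) + (\<integral>\<^sup>+ y\<in>{..<0}. ?F y \<partial>lborel)"
    by (rule nn_integral_add) measurable
  also have "(\<integral>\<^sup>+ y\<in>{..<0}. ?F y \<partial>lborel) = (\<integral>\<^sup>+ y\<in>{0<..}. ?F (- y) \<partial>lborel)"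
    by (subst nn_integral_real_affine[where c = "-1" and t = 0])
       (auto intro!: nn_integral_cong simp: indicator_def)
  also have "(\<integral>\<^sup>+ y\<in>{0<..}. ?F y \<partial>lborel) + (\<integral>\<^sup>+ y\<in>{0<..}. ?F (- y) \<partial>lborel)
      = (\<integral>\<^sup>+ y. ?F y * indicator {0<..} y + ?F (- y) * indicator {0<..} y \<partial>lborel)"
    by (rule nn_integral_add[symmetric]) measurable
  also have "\<dots> = radN DIM('a) m h"
    unfolding radN_def Psi_def True
    by (intro nn_integral_cong) (auto simp: indicator_def distrib_left ennreal_plus)
  finally show ?thesis .
next
  case False
  have "DIM('a) \<noteq> 0" using DIM_positive[where 'a='a] by simp
  with False have d: "DIM('a) \<ge> 2" by linarith
  define d where "d = DIM('a)"
  let ?F = "\<lambda>y \<tau>. h (sqrt (y\<^sup>2 + \<tau>\<^sup>2)) * ennreal ((1 - 2 * y + (y\<^sup>2 + \<tau>\<^sup>2)) powr (- m / 2))"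
  have "h (norm z) * ennreal (norm (b - z) powr (-m)) = ?F (z \<bullet> b) (sqrt (\<Sum>i\<in>Basis-{b}. (z \<bullet> i)\<^sup>2))" for z
  proof -
    have "(norm z)\<^sup>2 = (\<Sum>i\<in>Basis. (z \<bullet> i)\<^sup>2)"
      unfolding power2_norm_eq_inner by (subst euclidean_inner) (simp add: power2_eq_square)
    also have "\<dots> = (z \<bullet> b)\<^sup>2 + (\<Sum>i\<in>Basis-{b}. (z \<bullet> i)\<^sup>2)"
      using b by (simp add: sum.remove)
    finally have nz: "(z \<bullet> b)\<^sup>2 + (sqrt (\<Sum>i\<in>Basis-{b}. (z \<bullet> i)\<^sup>2))\<^sup>2 = (norm z)\<^sup>2"
      by (simp add: sum_nonneg)
    have "(norm (b - z))\<^sup>2 = 1 - 2 * (z \<bullet> b) + (norm z)\<^sup>2"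
      using b by (simp add: power2_norm_eq_inner inner_diff_left inner_diff_right inner_commute)
    then have "norm (b - z) powr (-m) = (1 - 2 * (z \<bullet> b) + (norm z)\<^sup>2) powr (- m / 2)"
      using powr_half_square[of "norm (b - z)" "-m"] by simp
    then show ?thesis unfolding nz by simp
  qed
  then have "(\<integral>\<^sup>+ (z::'a). h (norm z) * ennreal (norm (b - z) powr (-m)) \<partial>lborel)
      = (\<integral>\<^sup>+ (z::'a). ?F (z \<bullet> b) (sqrt (\<Sum>i\<in>Basis-{b}. (z \<bullet> i)\<^sup>2)) \<partial>lborel)" by simp
  also have "\<dots> = ennreal (omega_sphere d)
      * (\<integral>\<^sup>+ y. (\<integral>\<^sup>+ \<tau>\<in>{0<..}. ?F y \<tau> * ennreal (\<tau> ^ (d - 2)) \<partial>lborel) \<partial>lborel)"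
    unfolding d_def by (rule nn_integral_axial[OF b d]) measurable
  also have "(\<integral>\<^sup>+ y. (\<integral>\<^sup>+ \<tau>\<in>{0<..}. ?F y \<tau> * ennreal (\<tau> ^ (d - 2)) \<partial>lborel) \<partial>lborel)
      = (\<integral>\<^sup>+ t\<in>{0<..}. (\<integral>\<^sup>+ r\<in>{-1<..<1}. ?F (t * r) (t * sqrt (1 - r\<^sup>2))
          * ennreal (t ^ (d - 2 + 1) * (1 - r\<^sup>2) powr ((real (d - 2) - 1) / 2)) \<partial>lborel) \<partial>lborel)"
    by (rule nn_integral_polar) measurable
  also have "\<dots> = (\<integral>\<^sup>+ t\<in>{0<..}. h t * ennreal (t powr (real d - 1)) * (\<integral>\<^sup>+ r\<in>{-1<..<1}.
      ennreal ((1 - r\<^sup>2) powr ((real d - 3) / 2) * (1 - 2 * t * r + t\<^sup>2) powr (- m / 2)) \<partial>lborel) \<partial>lborel)"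
  proof (rule nn_integral_cong)
    fix t :: real
    have "(\<integral>\<^sup>+ r\<in>{-1<..<1}. ?F (t * r) (t * sqrt (1 - r\<^sup>2))
          * ennreal (t ^ (d - 2 + 1) * (1 - r\<^sup>2) powr ((real (d - 2) - 1) / 2)) \<partial>lborel)
        = h t * ennreal (t powr (real d - 1)) * (\<integral>\<^sup>+ r\<in>{-1<..<1}.
      ennreal ((1 - r\<^sup>2) powr ((real d - 3) / 2) * (1 - 2 * t * r + t\<^sup>2) powr (- m / 2)) \<partial>lborel)" if "t > 0"
    proof -
      have e: "?F (t * r) (t * sqrt (1 - r\<^sup>2)) * ennreal (t ^ (d - 2 + 1) * (1 - r\<^sup>2) powr ((real (d - 2) - 1) / 2)) * indicator {-1<..<1} r
        = h t * ennreal (t powr (real d - 1)) * (ennreal ((1 - r\<^sup>2) powr ((real d - 3) / 2) * (1 - 2 * t * r + t\<^sup>2) powr (- m / 2)) * indicator {-1<..<1} r)" for r :: real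
      proof (cases "r \<in> {-1<..<1}")
        case True
        then have q: "1 - r\<^sup>2 \<ge> 0" by (auto simp: abs_square_le_1)
        have s: "(t * r)\<^sup>2 + (t * sqrt (1 - r\<^sup>2))\<^sup>2 = t\<^sup>2"
          using q by (simp add: power_mult_distrib algebra_simps)
        have "t ^ (d - 2 + 1) = t powr (real d - 1)"
        proof -
          have "real (d - 2 + 1) = real d - 1" using d by (simp add: d_def)
          then show ?thesis using powr_realpow[OF that, of "d - 2 + 1"] by simp
        qed
        moreover have "real (d - 2) - 1 = real d - 3" using d by (simp add: d_def)
        moreover have "?F (t * r) (t * sqrt (1 - r\<^sup>2)) = h t * ennreal ((1 - 2 * t * r + t\<^sup>2) powr (- m / 2))"
          unfolding s using that by (simp add: mult.assoc)
        ultimately show ?thesis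
          using that by (simp add: ennreal_mult' mult_ac)
      qed simp
      show ?thesis unfolding e by (rule nn_integral_cmult) measurable
    qed
    then show "(\<integral>\<^sup>+ r\<in>{-1<..<1}. ?F (t * r) (t * sqrt (1 - r\<^sup>2))
          * ennreal (t ^ (d - 2 + 1) * (1 - r\<^sup>2) powr ((real (d - 2) - 1) / 2)) \<partial>lborel) * indicator {0<..} t
        = h t * ennreal (t powr (real d - 1)) * (\<integral>\<^sup>+ r\<in>{-1<..<1}.
      ennreal ((1 - r\<^sup>2) powr ((real d - 3) / 2) * (1 - 2 * t * r + t\<^sup>2) powr (- m / 2)) \<partial>lborel) * indicator {0<..} t"
      by (cases "t > 0") simp_all
  qed
  also have "ennreal (omega_sphere d) * \<dots> = radN d m h"
    using False unfolding radN_def Psi_def d_def[symmetric]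
    by (subst nn_integral_cmult[symmetric]) (auto intro!: nn_integral_cong simp: mult_ac)
  finally show ?thesis by (simp add: d_def)
qed

text \<open>Rotate \<open>x\<close> to \<open>|x| b\<close> and scale by \<open>|x|\<close>: the
  Jacobian contributes \<open>|x| powr d\<close> and the kernel
  \<open>|x| powr (- m)\<close>.\<close>

lemma nn_integral_kernel:
  fixes x :: "'a::euclidean_space" and h :: "real \<Rightarrow> ennreal"
  assumes x: "x \<noteq> 0" and h [measurable]: "h \<in> borel_measurable borel"
  shows "(\<integral>\<^sup>+ y. h (norm y) * ennreal (norm (x - y) powr (-m)) \<partial>lborel)
    = ennreal (norm x powr (real DIM('a) - m)) * radN DIM('a) m (\<lambda>t. h (norm x * t))"
proof -
  obtain b :: 'a where b: "b \<in> Basis" using nonempty_Basis by blast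
  let ?x = "norm x" and ?k = "\<lambda>t. ennreal (t powr (-m))"
  have x0: "?x > 0" using x by simp
  have "(\<integral>\<^sup>+ y. h (norm y) * ?k (norm (x - y)) \<partial>lborel)
      = (\<integral>\<^sup>+ y. h (norm y) * ?k (norm (?x *\<^sub>R b - y)) \<partial>lborel)"
    using b by (intro nn_integral_dist_rotate) auto
  also have "\<dots> = ennreal (?x ^ DIM('a)) *
      (\<integral>\<^sup>+ y. h (norm (?x *\<^sub>R y)) * ?k (norm (?x *\<^sub>R b - ?x *\<^sub>R y)) \<partial>lborel)"
    using x0 by (subst nn_integral_lborel_affine[where c = ?x and t = 0]) auto
  also have "\<dots> = (\<integral>\<^sup>+ y. ennreal (?x ^ DIM('a)) * (h (norm (?x *\<^sub>R y)) * ?k (norm (?x *\<^sub>R b - ?x *\<^sub>R y))) \<partial>lborel)"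
    by (rule nn_integral_cmult[symmetric]) measurable
  also have "\<dots> = (\<integral>\<^sup>+ y. ennreal (?x powr (real DIM('a) - m)) * (h (?x * norm y) * ?k (norm (b - y))) \<partial>lborel)"
  proof (rule nn_integral_cong)
    fix y :: 'a
    have "norm (?x *\<^sub>R b - ?x *\<^sub>R y) = ?x * norm (b - y)"
      by (simp add: scaleR_diff_right[symmetric])
    then have "?k (norm (?x *\<^sub>R b - ?x *\<^sub>R y)) = ennreal (?x powr (-m)) * ?k (norm (b - y))"
      by (simp add: powr_mult ennreal_mult')
    moreover have "ennreal (?x powr (real DIM('a) - m)) = ennreal (?x ^ DIM('a)) * ennreal (?x powr (-m))"
      using x0 by (simp add: ennreal_mult'[symmetric] powr_diff powr_realpow powr_minus divide_inverse)
    ultimately show "ennreal (?x ^ DIM('a)) * (h (norm (?x *\<^sub>R y)) * ?k (norm (?x *\<^sub>R b - ?x *\<^sub>R y)))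
        = ennreal (?x powr (real DIM('a) - m)) * (h (?x * norm y) * ?k (norm (b - y)))"
      by (simp add: mult_ac)
  qed
  also have "\<dots> = ennreal (?x powr (real DIM('a) - m)) * (\<integral>\<^sup>+ y. h (?x * norm y) * ?k (norm (b - y)) \<partial>lborel)"
    by (rule nn_integral_cmult) measurable
  also have "(\<integral>\<^sup>+ y. h (?x * norm y) * ?k (norm (b - y)) \<partial>lborel) = radN DIM('a) m (\<lambda>t. h (?x * t))"
    by (rule nn_integral_kernel_Basis[OF b]) measurable
  finally show ?thesis .
qed

section \<open>The inversion \<open>t \<mapsto> 1 / t\<close> of the radial variable\<close>

lemma nn_integral_inversion:
  fixes g :: "real \<Rightarrow> ennreal"
  assumes [measurable]: "g \<in> borel_measurable borel"
  shows "(\<integral>\<^sup>+ t\<in>{0<..}. g t \<partial>lborel) = (\<integral>\<^sup>+ t\<in>{0<..}. g (1 / t) * ennreal (t powr (-2)) \<partial>lborel)"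
proof -
  have "(\<integral>\<^sup>+ t\<in>{0<..}. g t \<partial>lborel) = (\<integral>\<^sup>+ y. g (exp y) * ennreal (exp y) \<partial>lborel)"
    by (rule nn_integral_exp_substitution) measurable
  also have "\<dots> = (\<integral>\<^sup>+ y. g (exp (- y)) * ennreal (exp (- y)) \<partial>lborel)"
    by (subst nn_integral_real_affine[where c = "-1" and t = 0]) auto
  also have "\<dots> = (\<integral>\<^sup>+ y. (g (1 / exp y) * ennreal (exp y powr (-2))) * ennreal (exp y) \<partial>lborel)"
  proof (rule nn_integral_cong)
    fix y :: real
    have "exp y powr (-2) * exp y = exp (- y)"
      by (simp add: exp_powr_real exp_add[symmetric])
    then show "g (exp (- y)) * ennreal (exp (- y)) = (g (1 / exp y) * ennreal (exp y powr (-2))) * ennreal (exp y)"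
      by (simp add: mult.assoc ennreal_mult'[symmetric] exp_minus divide_inverse)
  qed
  also have "\<dots> = (\<integral>\<^sup>+ t\<in>{0<..}. g (1 / t) * ennreal (t powr (-2)) \<partial>lborel)"
    by (rule nn_integral_exp_substitution[symmetric]) measurable
  finally show ?thesis .
qed

text \<open>For unit vectors, \<open>|e - \<sigma> / t| = |t e - \<sigma>| / t = |e - t \<sigma>| /
  t\<close>.\<close>

lemma Psi_inversion:
  assumes t: "t > 0"
  shows "Psi d m (1 / t) = ennreal (t powr m) * Psi d m t"
proof (cases "d = 1")
  case True
  have "\<bar>1 - 1 / t\<bar> = \<bar>1 - t\<bar> / t" "\<bar>1 + 1 / t\<bar> = \<bar>1 + t\<bar> / t"
    using t by (auto simp: field_simps abs_if)
  then have "\<bar>1 - 1 / t\<bar> powr (-m) + \<bar>1 + 1 / t\<bar> powr (-m) = t powr m * (\<bar>1 - t\<bar> powr (-m) + \<bar>1 + t\<bar> powr (-m))"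
    using t by (simp add: powr_divide powr_minus field_simps)
  then show ?thesis
    using True by (simp add: Psi_def ennreal_mult')
next
  case False
  have "(\<integral>\<^sup>+ r\<in>{-1<..<1}. ennreal ((1 - r\<^sup>2) powr ((real d - 3) / 2) * (1 - 2 * (1 / t) * r + (1 / t)\<^sup>2) powr (- m / 2)) \<partial>lborel)
    = (\<integral>\<^sup>+ r. ennreal (t powr m) * (ennreal ((1 - r\<^sup>2) powr ((real d - 3) / 2) * (1 - 2 * t * r + t\<^sup>2) powr (- m / 2)) * indicator {-1<..<1} r) \<partial>lborel)"
  proof (rule nn_integral_cong)
    fix r :: real
    have "(1 - 2 * (1 / t) * r + (1 / t)\<^sup>2) powr (- m / 2) = t powr m * (1 - 2 * t * r + t\<^sup>2) powr (- m / 2)"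
      if "r \<in> {-1<..<1}"
    proof -
      have "1 - 2 * t * r + t\<^sup>2 = (t - r)\<^sup>2 + (1 - r\<^sup>2)" by (simp add: power2_eq_square algebra_simps)
      moreover have "1 - r\<^sup>2 \<ge> 0" using that by (auto simp: abs_square_le_1)
      ultimately have nn: "1 - 2 * t * r + t\<^sup>2 \<ge> 0" by (metis add_nonneg_nonneg zero_le_power2)
      have "1 - 2 * (1 / t) * r + (1 / t)\<^sup>2 = (1 - 2 * t * r + t\<^sup>2) / t\<^sup>2"
        using t by (simp add: field_simps power2_eq_square)
      then have "(1 - 2 * (1 / t) * r + (1 / t)\<^sup>2) powr (- m / 2)
          = (1 - 2 * t * r + t\<^sup>2) powr (- m / 2) / (t\<^sup>2) powr (- m / 2)"
        using nn by (simp only: powr_divide zero_le_power2)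
      also have "(t\<^sup>2) powr (- m / 2) = t powr (-m)"
        using t by (intro powr_half_square) simp
      finally show ?thesis
        using t by (simp add: powr_minus field_simps)
    qed
    then show "ennreal ((1 - r\<^sup>2) powr ((real d - 3) / 2) * (1 - 2 * (1 / t) * r + (1 / t)\<^sup>2) powr (- m / 2)) * indicator {-1<..<1} r
      = ennreal (t powr m) * (ennreal ((1 - r\<^sup>2) powr ((real d - 3) / 2) * (1 - 2 * t * r + t\<^sup>2) powr (- m / 2)) * indicator {-1<..<1} r)"
      by (cases "r \<in> {-1<..<1}") (simp_all add: ennreal_mult' mult_ac)
  qed
  also have "\<dots> = ennreal (t powr m) * (\<integral>\<^sup>+ r\<in>{-1<..<1}. ennreal ((1 - r\<^sup>2) powr ((real d - 3) / 2) * (1 - 2 * t * r + t\<^sup>2) powr (- m / 2)) \<partial>lborel)"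
    by (rule nn_integral_cmult) measurable
  finally show ?thesis
    using False by (simp add: Psi_def mult_ac)
qed

lemma radN_inversion_aux:
  assumes "t > 0"
  shows "h (1 / t) * ennreal ((1 / t) powr (real d - 1)) * Psi d m (1 / t) * ennreal (t powr (-2))
    = h (1 / t) * ennreal (t powr (m - real d - 1)) * Psi d m t"
proof -
  have "(1 / t) powr (real d - 1) * t powr m * t powr (-2) = t powr (m - real d - 1)"
  proof -
    have "(1 / t) powr (real d - 1) = t powr (1 - real d)"
      using assms by (simp add: powr_divide powr_minus_divide[symmetric])
    then show ?thesis by (simp add: powr_add[symmetric] algebra_simps)
  qed
  then have "ennreal ((1 / t) powr (real d - 1)) * ennreal (t powr m) * ennreal (t powr (-2)) = ennreal (t powr (m - real d - 1))"
    by (simp add: ennreal_mult'[symmetric])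
  then show ?thesis
    unfolding Psi_inversion[OF assms] by (simp add: mult_ac flip: \<open>_ = ennreal (t powr (m - real d - 1))\<close>)
qed

text \<open>One-dimensional form of exchanging \<open>x\<close> and \<open>y\<close>, which inverts
  \<open>|y| / |x|\<close>. The power comes from \<open>t powr (1 - d)\<close>,
  \<open>t powr m\<close> and the Jacobian \<open>t powr (- 2)\<close>, after
  \<open>t powr (d - 1)\<close> is split off again.\<close>

lemma radN_inversion:
  assumes [measurable]: "h \<in> borel_measurable borel"
  shows "radN d m (\<lambda>t. h (1 / t) * ennreal (t powr (m - 2 * real d))) = radN d m h"
proof -
  have "radN d m h = (\<integral>\<^sup>+ t\<in>{0<..}. h (1 / t) * ennreal ((1 / t) powr (real d - 1)) * Psi d m (1 / t) * ennreal (t powr (-2)) \<partial>lborel)"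
    unfolding radN_def by (rule nn_integral_inversion) measurable
  also have "\<dots> = radN d m (\<lambda>t. h (1 / t) * ennreal (t powr (m - 2 * real d)))"
    unfolding radN_def
  proof (rule nn_integral_cong)
    fix t :: real
    show "h (1 / t) * ennreal ((1 / t) powr (real d - 1)) * Psi d m (1 / t) * ennreal (t powr (-2)) * indicator {0<..} t
      = h (1 / t) * ennreal (t powr (m - 2 * real d)) * ennreal (t powr (real d - 1)) * Psi d m t * indicator {0<..} t"
    proof (cases "t > 0")
      case True
      have "t powr (m - 2 * real d) * t powr (real d - 1) = t powr (m - real d - 1)"
        by (simp add: powr_add[symmetric] algebra_simps)
      then show ?thesis
        unfolding radN_inversion_aux[OF True] by (simp add: mult.assoc ennreal_mult'[symmetric])
    qed simp
  qed
  finally show ?thesis ..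
qed

text \<open>The half-line \<open>t > 1\<close> is mapped to \<open>(0,1)\<close>. This is the origin
  of the two summands in the bracket of the constant.\<close>

lemma radN_fold:
  assumes [measurable]: "h \<in> borel_measurable borel"
  shows "radN d m h = (\<integral>\<^sup>+ t\<in>{0<..<1}. (h t * ennreal (t powr (real d - 1))
      + h (1 / t) * ennreal (t powr (m - real d - 1))) * Psi d m t \<partial>lborel)"
proof -
  let ?G = "\<lambda>t. h t * ennreal (t powr (real d - 1)) * Psi d m t"
  have "radN d m h = (\<integral>\<^sup>+ t. ?G t * indicator {0<..<1} t + ?G t * indicator {1<..} t * indicator {0<..} t \<partial>lborel)"
    unfolding radN_def
  proof (rule nn_integral_cong_AE)
    have "AE x in lborel. x \<notin> {1 :: real}"
      by (intro AE_not_in countable_imp_null_set_lborel) auto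
    then show "AE t in lborel. ?G t * indicator {0<..} t = ?G t * indicator {0<..<1} t + ?G t * indicator {1<..} t * indicator {0<..} t"
      by eventually_elim (auto simp: indicator_def)
  qed
  also have "\<dots> = (\<integral>\<^sup>+ t\<in>{0<..<1}. ?G t \<partial>lborel) + (\<integral>\<^sup>+ t\<in>{0<..}. ?G t * indicator {1<..} t \<partial>lborel)"
    by (rule nn_integral_add) measurable
  also have "(\<integral>\<^sup>+ t\<in>{0<..}. ?G t * indicator {1<..} t \<partial>lborel)
      = (\<integral>\<^sup>+ t\<in>{0<..}. ?G (1 / t) * indicator {1<..} (1 / t) * ennreal (t powr (-2)) \<partial>lborel)"
    by (rule nn_integral_inversion) measurable
  also have "\<dots> = (\<integral>\<^sup>+ t\<in>{0<..<1}. h (1 / t) * ennreal (t powr (m - real d - 1)) * Psi d m t \<partial>lborel)"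
  proof (rule nn_integral_cong)
    fix t :: real
    show "?G (1 / t) * indicator {1<..} (1 / t) * ennreal (t powr (-2)) * indicator {0<..} t
      = h (1 / t) * ennreal (t powr (m - real d - 1)) * Psi d m t * indicator {0<..<1} t"
    proof (cases "t > 0")
      case True
      then have "indicator {1<..} (1 / t) = (indicator {0<..<1} t :: ennreal)"
        by (auto simp: indicator_def field_simps)
      then show ?thesis
        using True unfolding radN_inversion_aux[OF True, symmetric] by (simp add: mult_ac)
    qed simp
  qed
  also have "(\<integral>\<^sup>+ t\<in>{0<..<1}. ?G t \<partial>lborel) + \<dots>
      = (\<integral>\<^sup>+ t. ?G t * indicator {0<..<1} t + h (1 / t) * ennreal (t powr (m - real d - 1)) * Psi d m t * indicator {0<..<1} t \<partial>lborel)"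
    by (rule nn_integral_add[symmetric]) measurable
  also have "\<dots> = (\<integral>\<^sup>+ t\<in>{0<..<1}. (h t * ennreal (t powr (real d - 1))
      + h (1 / t) * ennreal (t powr (m - real d - 1))) * Psi d m t \<partial>lborel)"
    by (intro nn_integral_cong) (simp add: distrib_right)
  finally show ?thesis .
qed

section \<open>Finiteness\<close>

lemma set_nn_integral_finite_if_has_integral:
  fixes f :: "'a::euclidean_space \<Rightarrow> real"
  assumes "\<And>x. x \<in> \<Omega> \<Longrightarrow> 0 \<le> f x" "(f has_integral I) \<Omega>"
  shows "(\<integral>\<^sup>+ x\<in>\<Omega>. ennreal (f x) \<partial>lborel) < \<infinity>"
proof -
  have "(\<integral>\<^sup>+ x\<in>\<Omega>. ennreal (f x) \<partial>lborel) = (\<integral>\<^sup>+ x. ennreal (indicator \<Omega> x * f x) \<partial>lborel)"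
    by (intro nn_integral_cong) (simp add: indicator_def)
  then show ?thesis using nn_integral_has_integral_lebesgue[OF assms] by simp
qed

lemma radial_weight_eq:
  fixes t :: real
  assumes "t > 0"
  shows "ennreal (t powr \<tau>) * ennreal (real DIM('a::euclidean_space) * unit_ball_vol (DIM('a)) * t ^ (DIM('a) - 1))
    = ennreal (real DIM('a) * unit_ball_vol (DIM('a))) * ennreal (t powr (\<tau> + real DIM('a) - 1))"
proof -
  have "real (DIM('a) - 1) = real DIM('a) - 1"
    using DIM_positive[where 'a = 'a] by linarith
  then have "t ^ (DIM('a) - 1) = t powr (real DIM('a) - 1)"
    using powr_realpow[OF assms, of "DIM('a) - 1"] by simp
  then have "t powr \<tau> * (real DIM('a) * unit_ball_vol (DIM('a)) * t ^ (DIM('a) - 1))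
    = real DIM('a) * unit_ball_vol (DIM('a)) * (t powr \<tau> * t powr (real DIM('a) - 1))"
    by simp
  also have "t powr \<tau> * t powr (real DIM('a) - 1) = t powr (\<tau> + real DIM('a) - 1)"
    by (simp add: powr_add[symmetric] add_diff_eq)
  finally show ?thesis
    by (simp only: ennreal_mult'[OF powr_ge_zero, symmetric] ennreal_mult''[OF powr_ge_zero, symmetric])
qed

lemma nn_integral_norm_powr_le_finite:
  assumes \<tau>: "\<tau> > - real DIM('a::euclidean_space)" and R: "R \<ge> 0"
  shows "(\<integral>\<^sup>+ (z::'a). ennreal (norm z powr \<tau>) * indicator {..R} (norm z) \<partial>lborel) < \<infinity>"
proof -
  let ?c = "ennreal (real DIM('a) * unit_ball_vol (DIM('a)))"
  have "(\<integral>\<^sup>+ (z::'a). ennreal (norm z powr \<tau>) * indicator {..R} (norm z) \<partial>lborel)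
      = (\<integral>\<^sup>+ t\<in>{0<..}. ennreal (t powr \<tau>) * indicator {..R} t
          * ennreal (real DIM('a) * unit_ball_vol (DIM('a)) * t ^ (DIM('a) - 1)) \<partial>lborel)"
    by (rule nn_integral_radial[of "\<lambda>t. ennreal (t powr \<tau>) * indicator {..R} t"]) measurable
  also have "\<dots> \<le> (\<integral>\<^sup>+ t. ?c * (ennreal (t powr (\<tau> + real DIM('a) - 1)) * indicator {0..R} t) \<partial>lborel)"
  proof (rule nn_integral_mono)
    fix t :: real
    show "ennreal (t powr \<tau>) * indicator {..R} t * ennreal (real DIM('a) * unit_ball_vol (DIM('a)) * t ^ (DIM('a) - 1))
        * indicator {0<..} t \<le> ?c * (ennreal (t powr (\<tau> + real DIM('a) - 1)) * indicator {0..R} t)"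
      using radial_weight_eq[of t \<tau>, where 'a = 'a] by (auto simp: indicator_def)
  qed
  also have "\<dots> = ?c * (\<integral>\<^sup>+ t\<in>{0..R}. ennreal (t powr (\<tau> + real DIM('a) - 1)) \<partial>lborel)"
    by (rule nn_integral_cmult) measurable
  also have "\<dots> < \<infinity>"
    using set_nn_integral_finite_if_has_integral[OF _ has_integral_powr_from_0[of "\<tau> + real DIM('a) - 1" R]] \<tau> R
    by (simp add: ennreal_mult_less_top)
  finally show ?thesis .
qed

lemma nn_integral_norm_powr_ge_finite:
  assumes \<tau>: "\<tau> < - real DIM('a::euclidean_space)" and R: "R > 0"
  shows "(\<integral>\<^sup>+ (z::'a). ennreal (norm z powr \<tau>) * indicator {R..} (norm z) \<partial>lborel) < \<infinity>"
proof -
  let ?c = "ennreal (real DIM('a) * unit_ball_vol (DIM('a)))"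
  have "(\<integral>\<^sup>+ (z::'a). ennreal (norm z powr \<tau>) * indicator {R..} (norm z) \<partial>lborel)
      = (\<integral>\<^sup>+ t\<in>{0<..}. ennreal (t powr \<tau>) * indicator {R..} t
          * ennreal (real DIM('a) * unit_ball_vol (DIM('a)) * t ^ (DIM('a) - 1)) \<partial>lborel)"
    by (rule nn_integral_radial[of "\<lambda>t. ennreal (t powr \<tau>) * indicator {R..} t"]) measurable
  also have "\<dots> \<le> (\<integral>\<^sup>+ t. ?c * (ennreal (t powr (\<tau> + real DIM('a) - 1)) * indicator {R..} t) \<partial>lborel)"
  proof (rule nn_integral_mono)
    fix t :: real
    show "ennreal (t powr \<tau>) * indicator {R..} t * ennreal (real DIM('a) * unit_ball_vol (DIM('a)) * t ^ (DIM('a) - 1))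
        * indicator {0<..} t \<le> ?c * (ennreal (t powr (\<tau> + real DIM('a) - 1)) * indicator {R..} t)"
      using radial_weight_eq[of t \<tau>, where 'a = 'a] by (auto simp: indicator_def)
  qed
  also have "\<dots> = ?c * (\<integral>\<^sup>+ t\<in>{R..}. ennreal (t powr (\<tau> + real DIM('a) - 1)) \<partial>lborel)"
    by (rule nn_integral_cmult) measurable
  also have "\<dots> < \<infinity>"
    using set_nn_integral_finite_if_has_integral[OF _ has_integral_powr_to_inf[of "\<tau> + real DIM('a) - 1" R]] \<tau> R
    by (simp add: ennreal_mult_less_top)
  finally show ?thesis .
qed

lemma abs_ln_powr_le:
  fixes t :: real
  assumes "t > 0" "p > 0" "\<kappa> > 0"
  shows "t \<ge> 1 \<Longrightarrow> \<bar>ln t\<bar> powr p \<le> (p / \<kappa>) powr p * t powr \<kappa>"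
    and "t \<le> 1 \<Longrightarrow> \<bar>ln t\<bar> powr p \<le> (p / \<kappa>) powr p * t powr (-\<kappa>)"
proof -
  have *: "\<bar>ln t\<bar> powr p \<le> (p / \<kappa>) powr p * t powr \<kappa>" if "t \<ge> 1" for t :: real
  proof -
    have "ln t \<le> t powr (\<kappa> / p) / (\<kappa> / p)"
      using that assms by (intro ln_powr_bound) auto
    then have "\<bar>ln t\<bar> \<le> (p / \<kappa>) * t powr (\<kappa> / p)"
      using that by (simp add: field_simps)
    then have "\<bar>ln t\<bar> powr p \<le> ((p / \<kappa>) * t powr (\<kappa> / p)) powr p"
      using assms by (intro powr_mono2) auto
    also have "\<dots> = (p / \<kappa>) powr p * t powr \<kappa>"
      using assms by (subst powr_mult) (simp_all add: powr_powr)
    finally show ?thesis .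
  qed
  then show "t \<ge> 1 \<Longrightarrow> \<bar>ln t\<bar> powr p \<le> (p / \<kappa>) powr p * t powr \<kappa>" .
  assume "t \<le> 1"
  then have "1 / t \<ge> 1" using assms by simp
  from *[OF this] show "\<bar>ln t\<bar> powr p \<le> (p / \<kappa>) powr p * t powr (-\<kappa>)"
    using assms by (simp add: ln_div powr_divide powr_minus_divide)
qed

lemma abs_ln_le_near_1:
  fixes t :: real
  assumes "t \<ge> 1/2"
  shows "\<bar>ln t\<bar> \<le> 2 * \<bar>t - 1\<bar>"
proof (cases "t \<ge> 1")
  case True
  then show ?thesis using ln_le_minus_one[of t] by simp
next
  case False
  have "ln (1 / t) \<le> 1 / t - 1" using assms by (intro ln_le_minus_one) simp
  also have "\<dots> = (1 - t) / t" using assms by (simp add: field_simps)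
  also have "\<dots> \<le> (1 - t) / (1/2)"
    using assms False by (intro divide_left_mono) auto
  finally show ?thesis using assms False by (simp add: ln_div)
qed

text \<open>All finiteness statements about \<open>K\<close> and the error terms reduce to this one.
  At \<open>t = 1\<close> the logarithm vanishes to first order, which leaves
  \<open>|b - z| powr (p - m)\<close>, integrable because \<open>p - m > - d\<close> for
  \<open>s < 1\<close>. At 0 and at infinity the logarithm costs only a small power, for which the
  strict bounds on \<open>\<sigma>\<close> leave room.\<close>

lemma radN_abs_ln_powr_finite:
  fixes s p \<sigma> :: real
  assumes s: "s < 1" and p: "p > 0" and \<sigma>: "\<sigma> > - real DIM('a::euclidean_space)" "\<sigma> < s * p"
    and m: "m = real DIM('a) + s * p"
  shows "radN DIM('a) m (\<lambda>t. ennreal (\<bar>ln t\<bar> powr p * t powr \<sigma>)) < \<infinity>"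
proof -
  obtain b :: 'a where b: "b \<in> Basis" using nonempty_Basis by blast
  then have [simp]: "norm b = 1" by simp
  let ?d = "real DIM('a)"
  \<comment> \<open>Half the distance from \<open>\<sigma>\<close> to the nearer end of the
    admissible interval.\<close>
  define \<kappa> where "\<kappa> = min (\<sigma> + ?d) (s * p - \<sigma>) / 2"
  have \<kappa>: "\<kappa> > 0" "\<sigma> - \<kappa> > - ?d" "\<sigma> + \<kappa> < s * p"
    using \<sigma> by (auto simp: \<kappa>_def min_def field_simps)
  define K where "K = (p / \<kappa>) powr p"
  \<comment> \<open>One constant for each region: \<open>|z| \<le> 1/2\<close>, where
    \<open>|b - z| \<ge> 1/2\<close>; \<open>|z| \<ge> 2\<close>, where
    \<open>|b - z| \<ge> |z| / 2\<close>; and the annulus between, where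
    \<open>|b - z| < 3\<close>.\<close>
  define C1 where "C1 = K * ((1/2) powr (-m) + 1)"
  define C2 where "C2 = K * 2 powr m"
  define C3 where "C3 = 2 powr p * 2 powr \<bar>\<sigma>\<bar>"
  have sp: "s * p < p" using s p by simp
  \<comment> \<open>No sign of \<open>s\<close> is assumed here: \<open>- d < \<sigma> < s p\<close>
    already forces \<open>d + s p > 0\<close>.\<close>
  have m0: "m > 0"
    using \<sigma> m by linarith
  have K: "K \<ge> 0" by (simp add: K_def)
  let ?f = "\<lambda>z::'a. ennreal (\<bar>ln (norm z)\<bar> powr p * norm z powr \<sigma>) * ennreal (norm (b - z) powr (-m))"
  let ?g1 = "\<lambda>z::'a. ennreal C1 * (ennreal (norm z powr (\<sigma> - \<kappa>)) * indicator {..1/2} (norm z))"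
  let ?g2 = "\<lambda>z::'a. ennreal C2 * (ennreal (norm z powr (\<sigma> + \<kappa> - m)) * indicator {2..} (norm z))"
  let ?g3 = "\<lambda>z::'a. ennreal C3 * (ennreal (norm (b - z) powr (p - m)) * indicator {..3} (norm (b - z)))"
  have le: "?f z \<le> ?g1 z + ?g2 z + ?g3 z" if "z \<noteq> 0" for z :: 'a
  proof -
    let ?t = "norm z"
    have t: "?t > 0" using that by simp
    have tri: "\<bar>?t - 1\<bar> \<le> norm (b - z)" "norm (b - z) \<le> 1 + ?t"
      using norm_triangle_ineq3[of z b] norm_triangle_ineq4[of b z] by (auto simp: norm_minus_commute)
    consider "?t \<le> 1/2" | "?t \<ge> 2" | "1/2 < ?t" "?t < 2" by linarith
    then show ?thesis
    proof cases
      case 1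
      have "\<bar>ln ?t\<bar> powr p \<le> K * ?t powr (-\<kappa>)"
        unfolding K_def using t p \<kappa> 1 by (intro abs_ln_powr_le) auto
      moreover have "norm (b - z) powr (-m) \<le> (1/2) powr (-m)"
        using tri 1 m0 by (intro powr_mono2') auto
      ultimately have "\<bar>ln ?t\<bar> powr p * ?t powr \<sigma> * norm (b - z) powr (-m)
          \<le> (K * ?t powr (-\<kappa>)) * ?t powr \<sigma> * (1/2) powr (-m)"
        using K by (intro mult_mono) auto
      also have "\<dots> = K * (1/2) powr (-m) * ?t powr (\<sigma> - \<kappa>)"
        by (simp add: powr_add[symmetric] powr_diff powr_minus field_simps)
      also have "\<dots> \<le> C1 * ?t powr (\<sigma> - \<kappa>)"
        unfolding C1_def using K by (intro mult_right_mono mult_left_mono) auto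
      finally have "?f z \<le> ?g1 z"
        using 1 K by (simp add: ennreal_mult'[symmetric] C1_def ennreal_leI)
      then show ?thesis by (simp add: add_increasing2)
    next
      case 2
      have "\<bar>ln ?t\<bar> powr p \<le> K * ?t powr \<kappa>"
        unfolding K_def using t p \<kappa> 2 by (intro abs_ln_powr_le) auto
      moreover have "norm (b - z) powr (-m) \<le> (?t / 2) powr (-m)"
        using tri 2 m0 t by (intro powr_mono2') auto
      ultimately have "\<bar>ln ?t\<bar> powr p * ?t powr \<sigma> * norm (b - z) powr (-m)
          \<le> (K * ?t powr \<kappa>) * ?t powr \<sigma> * (?t / 2) powr (-m)"
        using K by (intro mult_mono) auto
      also have "\<dots> = C2 * ?t powr (\<sigma> + \<kappa> - m)"
        unfolding C2_def using t by (simp add: powr_add powr_diff powr_minus powr_divide field_simps)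
      finally have "?f z \<le> ?g2 z"
        using 2 K by (simp add: ennreal_mult'[symmetric] C2_def ennreal_leI)
      then show ?thesis by (simp add: add_increasing add_increasing2)
    next
      case 3
      have "\<bar>ln ?t\<bar> \<le> 2 * norm (b - z)"
        using abs_ln_le_near_1[of ?t] 3 tri by simp
      then have "\<bar>ln ?t\<bar> powr p \<le> (2 * norm (b - z)) powr p"
        using p by (intro powr_mono2) auto
      moreover have "?t powr \<sigma> \<le> 2 powr \<bar>\<sigma>\<bar>"
      proof (cases "\<sigma> \<ge> 0")
        case True
        then show ?thesis using 3 by (simp add: powr_mono2)
      next
        case False
        then have "?t powr \<sigma> \<le> (1/2) powr \<sigma>"
          using 3 t by (intro powr_mono2') auto
        then show ?thesis using False by (simp add: powr_divide powr_minus_divide)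
      qed
      ultimately have "\<bar>ln ?t\<bar> powr p * ?t powr \<sigma> * norm (b - z) powr (-m)
          \<le> (2 * norm (b - z)) powr p * 2 powr \<bar>\<sigma>\<bar> * norm (b - z) powr (-m)"
        by (intro mult_mono) auto
      also have "\<dots> = C3 * norm (b - z) powr (p - m)"
        unfolding C3_def by (cases "norm (b - z) = 0") (simp_all add: powr_mult powr_diff powr_minus field_simps)
      finally have "?f z \<le> ?g3 z"
        using 3 tri by (simp add: ennreal_mult'[symmetric] C3_def ennreal_leI)
      then show ?thesis by (simp add: add_increasing)
    qed
  qed
  have "radN DIM('a) m (\<lambda>t. ennreal (\<bar>ln t\<bar> powr p * t powr \<sigma>)) = (\<integral>\<^sup>+ z. ?f z \<partial>lborel)"
    by (rule nn_integral_kernel_Basis[OF b, symmetric]) measurable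
  also have "\<dots> \<le> (\<integral>\<^sup>+ z. ?g1 z + ?g2 z + ?g3 z \<partial>lborel)"
  proof (rule nn_integral_mono_AE)
    have "AE z in lborel. z \<notin> {0 :: 'a}"
      by (intro AE_not_in countable_imp_null_set_lborel) auto
    then show "AE z in lborel. ?f z \<le> ?g1 z + ?g2 z + ?g3 z"
      by eventually_elim (rule le, simp)
  qed
  also have "\<dots> = (\<integral>\<^sup>+ z. ?g1 z \<partial>lborel) + (\<integral>\<^sup>+ z. ?g2 z \<partial>lborel) + (\<integral>\<^sup>+ z. ?g3 z \<partial>lborel)"
    by (subst nn_integral_add, measurable)+
  also have "\<dots> < \<infinity>"
  proof -
    have "(\<integral>\<^sup>+ z. ?g1 z \<partial>lborel) < \<infinity>"
      using nn_integral_norm_powr_le_finite[where 'a = 'a, of "\<sigma> - \<kappa>" "1/2"] \<kappa>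
      by (subst nn_integral_cmult) (auto simp: ennreal_mult_less_top)
    moreover have "(\<integral>\<^sup>+ z. ?g2 z \<partial>lborel) < \<infinity>"
      using nn_integral_norm_powr_ge_finite[where 'a = 'a, of "\<sigma> + \<kappa> - m" 2] \<kappa> m
      by (subst nn_integral_cmult) (auto simp: ennreal_mult_less_top)
    moreover have "(\<integral>\<^sup>+ z. ?g3 z \<partial>lborel) < \<infinity>"
    proof -
      have "(\<integral>\<^sup>+ (z::'a). ennreal (norm (b - z) powr (p - m)) * indicator {..3} (norm (b - z)) \<partial>lborel)
          = (\<integral>\<^sup>+ (z::'a). ennreal (norm z powr (p - m)) * indicator {..3} (norm z) \<partial>lborel)"
        using nn_integral_lborel_affine[of "\<lambda>z::'a. ennreal (norm z powr (p - m)) * indicator {..3} (norm z)" "-1" b]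
        by simp
      then show ?thesis
        using nn_integral_norm_powr_le_finite[where 'a = 'a, of "p - m" 3] sp m
        by (subst nn_integral_cmult) (auto simp: ennreal_mult_less_top)
    qed
    ultimately show ?thesis by simp
  qed
  finally show ?thesis .
qed

text \<open>\<open>Phi\<close> uses the Lebesgue integral and \<open>Psi\<close> the extended one,
  so finiteness must come first: otherwise \<open>enn2real\<close> would return its default 0. As
  \<open>(d - 3) / 2 \<ge> - 1 / 2\<close>, the angular weight is dominated by
  \<open>1 / sqrt (1 - r^2)\<close>, the derivative of \<open>arcsin\<close>.\<close>

lemma Psi_eq_Phi:
  assumes t: "0 < t" "t < 1" and d: "d \<ge> 1" and m: "m = real d + s * p"
  shows "Psi d m t = ennreal (Phi d s p t)"
proof (cases "d = 1")
  case True
  then show ?thesis using t m by (simp add: Psi_def Phi_def algebra_simps)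
next
  case False
  then have d2: "d \<ge> 2" using d by simp
  let ?f = "\<lambda>r. (1 - r\<^sup>2) powr ((real d - 3) / 2) / (1 - 2 * t * r + t\<^sup>2) powr ((real d + s * p) / 2)"
  let ?X = "\<integral>\<^sup>+ r. ennreal (indicator {-1<..<1} r * ?f r) \<partial>lborel"
  have X: "(\<integral>\<^sup>+ r\<in>{-1<..<1}. ennreal ((1 - r\<^sup>2) powr ((real d - 3) / 2) * (1 - 2 * t * r + t\<^sup>2) powr (- m / 2)) \<partial>lborel) = ?X"
  proof (rule nn_integral_cong)
    fix r :: real
    have "(1 - 2 * t * r + t\<^sup>2) powr (- m / 2) = 1 / (1 - 2 * t * r + t\<^sup>2) powr (m / 2)"
      by (simp add: powr_minus_divide)
    then show "ennreal ((1 - r\<^sup>2) powr ((real d - 3) / 2) * (1 - 2 * t * r + t\<^sup>2) powr (- m / 2)) * indicator {-1<..<1} r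
      = ennreal (indicator {-1<..<1} r * ?f r)"
      by (simp add: indicator_def m)
  qed
  have "?X < \<infinity>"
  proof -
    \<comment> \<open>The base \<open>1 - 2 t r + t^2\<close> lies between \<open>(1 - t)^2\<close>
      and \<open>(1 + t)^2\<close>; the two summands cover the cases \<open>m \<ge> 0\<close> and
      \<open>m < 0\<close>.\<close>
    define M where "M = max 1 (((1 - t)\<^sup>2) powr (- m / 2)) + ((1 + t)\<^sup>2) powr (- m / 2)"
    have M0: "M \<ge> 0" by (simp add: M_def add_nonneg_nonneg)
    have "((\<lambda>r. 1 / sqrt (1 - r\<^sup>2)) has_integral arcsin 1 - arcsin (-1)) {-1..1}"
    proof (rule fundamental_theorem_of_calculus_interior)
      show "(arcsin has_vector_derivative 1 / sqrt (1 - r\<^sup>2)) (at r)" if "r \<in> {-1<..<1}" for r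
        using that by (auto intro!: derivative_eq_intros
          simp: has_real_derivative_iff_has_vector_derivative[symmetric] divide_inverse)
    qed (auto intro!: continuous_intros)
    then have fin: "(\<integral>\<^sup>+ r\<in>{-1..1}. ennreal (1 / sqrt (1 - r\<^sup>2)) \<partial>lborel) < \<infinity>"
      by (rule set_nn_integral_finite_if_has_integral[rotated]) (auto simp: abs_square_le_1)
    have "?X \<le> (\<integral>\<^sup>+ r. ennreal M * (ennreal (1 / sqrt (1 - r\<^sup>2)) * indicator {-1..1} r) \<partial>lborel)"
    proof (rule nn_integral_mono)
      fix r :: real
      show "ennreal (indicator {-1<..<1} r * ?f r) \<le> ennreal M * (ennreal (1 / sqrt (1 - r\<^sup>2)) * indicator {-1..1} r)"
      proof (cases "r \<in> {-1<..<1}")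
        case True
        let ?q = "1 - r\<^sup>2" and ?D = "1 - 2 * t * r + t\<^sup>2"
        have q: "?q > 0" "?q \<le> 1" using True by (auto simp: abs_square_less_1)
        have "?q powr ((real d - 3) / 2) \<le> ?q powr (-1/2)"
          using q d2 by (intro powr_mono') auto
        also have "\<dots> = 1 / sqrt ?q"
          using q by (simp add: powr_minus_divide powr_half_sqrt)
        finally have 1: "?q powr ((real d - 3) / 2) \<le> 1 / sqrt ?q" .
        have lo: "(1 - t)\<^sup>2 \<le> ?D" and hi: "?D \<le> (1 + t)\<^sup>2"
          using True t mult_left_mono[of r 1 t] mult_left_mono[of "-1" r t]
          by (auto simp: power2_eq_square algebra_simps)
        have D0: "(1 - t)\<^sup>2 > 0" using t by simp
        have "?D powr (- m / 2) \<le> M"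
        proof (cases "m \<ge> 0")
          case True
          then have "?D powr (- m / 2) \<le> ((1 - t)\<^sup>2) powr (- m / 2)"
            using D0 lo by (intro powr_mono2') auto
          also have "\<dots> \<le> M" by (simp add: M_def add_increasing2)
          finally show ?thesis .
        next
          case False
          then have "?D powr (- m / 2) \<le> ((1 + t)\<^sup>2) powr (- m / 2)"
            using D0 lo hi by (intro powr_mono2) linarith+
          also have "\<dots> \<le> M" by (simp add: M_def)
          finally show ?thesis .
        qed
        then have "?q powr ((real d - 3) / 2) * ?D powr (- m / 2) \<le> 1 / sqrt ?q * M"
          using 1 q by (intro mult_mono) auto
        moreover have "?f r = ?q powr ((real d - 3) / 2) * ?D powr (- m / 2)"
        proof -
          have "?D powr (- m / 2) = 1 / ?D powr (m / 2)"
            by (simp add: powr_minus_divide)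
          then show ?thesis by (simp only: m[symmetric] times_divide_eq_right mult_1_right)
        qed
        ultimately show ?thesis
          using True M0 q by (simp add: ennreal_mult'[symmetric] mult.commute ennreal_leI)
      qed simp
    qed
    also have "\<dots> = ennreal M * (\<integral>\<^sup>+ r\<in>{-1..1}. ennreal (1 / sqrt (1 - r\<^sup>2)) \<partial>lborel)"
      by (rule nn_integral_cmult) measurable
    also have "\<dots> < \<infinity>" using fin by (simp add: ennreal_mult_less_top)
    finally show ?thesis .
  qed
  then have "?X = ennreal (enn2real ?X)" by simp
  also have "enn2real ?X = (LBINT r:{-1<..<1}. ?f r)"
    unfolding set_lebesgue_integral_def by (subst integral_eq_nn_integral) auto
  finally have "?X = ennreal (LBINT r:{-1<..<1}. ?f r)" .
  moreover have "omega_sphere d \<ge> 0"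
    unfolding omega_sphere_eq[OF d2] by simp
  moreover have "Psi d m t = ennreal (omega_sphere d) * ?X"
    using False by (simp only: Psi_def if_False X)
  ultimately show ?thesis
    using False by (simp add: Phi_def ennreal_mult')
qed

section \<open>The pointwise inequalities\<close>

lemma radN_cong:
  assumes "\<And>t. t > 0 \<Longrightarrow> h t = h' t"
  shows "radN d m h = radN d m h'"
  unfolding radN_def using assms by (intro nn_integral_cong) (auto simp: indicator_def)

lemma radN_mono:
  assumes "\<And>t. t > 0 \<Longrightarrow> h t \<le> h' t"
  shows "radN d m h \<le> radN d m h'"
  unfolding radN_def using assms
  by (intro nn_integral_mono) (auto simp: indicator_def intro!: mult_right_mono)

lemma radN_cmult:
  assumes [measurable]: "h \<in> borel_measurable borel"
  shows "radN d m (\<lambda>t. c * h t) = c * radN d m h"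
  unfolding radN_def by (subst nn_integral_cmult[symmetric]) (auto simp: mult_ac)

lemma radN_add:
  assumes [measurable]: "h \<in> borel_measurable borel" "h' \<in> borel_measurable borel"
  shows "radN d m (\<lambda>t. h t + h' t) = radN d m h + radN d m h'"
  unfolding radN_def by (subst nn_integral_add[symmetric]) (auto simp: distrib_right intro!: nn_integral_cong)

text \<open>Convexity of the power, with \<open>x + y\<close> written as the convex combination of
  \<open>x / (1 - \<theta>)\<close> and \<open>y / \<theta>\<close>. In the Picone inequality
  \<open>\<theta>\<close> is the ratio of the values of \<open>w\<close>; in the sharpness proof it
  is a free parameter tending to 0.\<close>

lemma powr_add_le:
  fixes x y \<theta> q :: real
  assumes "0 < \<theta>" "\<theta> < 1" "q \<ge> 1" "x \<ge> 0" "y \<ge> 0"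
  shows "(x + y) powr q \<le> (1 - \<theta>) powr (1 - q) * x powr q + \<theta> powr (1 - q) * y powr q"
proof -
  have single: "z powr q \<le> \<eta> powr (1 - q) * z powr q" if "0 < \<eta>" "\<eta> < 1" for \<eta> z :: real
  proof -
    have "1 \<le> \<eta> powr (1 - q)"
      using that assms(3) powr_mono2'[of "1 - q" \<eta> 1] by simp
    then show ?thesis using mult_right_mono[of 1 "\<eta> powr (1 - q)" "z powr q"] by simp
  qed
  consider "x = 0" | "y = 0" | "x > 0" "y > 0" using assms by linarith
  then show ?thesis
  proof cases
    case 1
    then show ?thesis using single[of \<theta> y] assms by simp
  next
    case 2
    then show ?thesis using single[of "1 - \<theta>" x] assms by simp
  next
    case 3
    have scale: "\<eta> * (z / \<eta>) powr q = \<eta> powr (1 - q) * z powr q" if "\<eta> > 0" "z > 0" for \<eta> z :: real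
      using that by (simp add: powr_divide powr_diff)
    have "((1 - \<theta>) * (x / (1 - \<theta>)) + \<theta> * (y / \<theta>)) powr q
        \<le> (1 - \<theta>) * (x / (1 - \<theta>)) powr q + \<theta> * (y / \<theta>) powr q"
      using convex_onD[OF powr_convex[OF assms(3)], of \<theta> "x / (1 - \<theta>)" "y / \<theta>"] 3 assms
      by simp
    then show ?thesis
      using assms 3 by (simp add: scale)
  qed
qed

text \<open>Pointwise form of the reverse triangle inequality, with equality at \<open>b = \<theta> * a\<close>.\<close>

lemma picone_less_1:
  fixes a b \<theta> q :: real
  assumes \<theta>: "0 < \<theta>" "\<theta> < 1" and q: "q \<ge> 1"
  shows "(1 - \<theta>) powr (q - 1) * \<bar>a\<bar> powr q
    \<le> \<bar>a - b\<bar> powr q + (1 - \<theta>) powr (q - 1) * \<theta> powr (1 - q) * \<bar>b\<bar> powr q"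
proof -
  have "\<bar>a\<bar> powr q \<le> (\<bar>a - b\<bar> + \<bar>b\<bar>) powr q"
    using q by (intro powr_mono2) auto
  also have "\<dots> \<le> (1 - \<theta>) powr (1 - q) * \<bar>a - b\<bar> powr q + \<theta> powr (1 - q) * \<bar>b\<bar> powr q"
    using assms by (intro powr_add_le) auto
  finally have "(1 - \<theta>) powr (q - 1) * \<bar>a\<bar> powr q
      \<le> (1 - \<theta>) powr (q - 1) * ((1 - \<theta>) powr (1 - q) * \<bar>a - b\<bar> powr q + \<theta> powr (1 - q) * \<bar>b\<bar> powr q)"
    by (rule mult_left_mono) simp
  also have "(1 - \<theta>) powr (q - 1) * (1 - \<theta>) powr (1 - q) = 1"
    using \<theta> by (simp add: powr_add[symmetric])
  then have "(1 - \<theta>) powr (q - 1) * ((1 - \<theta>) powr (1 - q) * \<bar>a - b\<bar> powr q + \<theta> powr (1 - q) * \<bar>b\<bar> powr q)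
      = \<bar>a - b\<bar> powr q + (1 - \<theta>) powr (q - 1) * \<theta> powr (1 - q) * \<bar>b\<bar> powr q"
    by (simp add: distrib_left mult.assoc[symmetric])
  finally show ?thesis .
qed

text \<open>The previous lemma with \<open>a\<close> and \<open>b\<close> exchanged and
  \<open>1 / \<theta>\<close> for \<open>\<theta>\<close>; equality again at
  \<open>b = \<theta> * a\<close>.\<close>

lemma picone_greater_1:
  fixes a b \<theta> q :: real
  assumes \<theta>: "1 < \<theta>" and q: "q \<ge> 1"
  shows "(\<theta> - 1) powr (q - 1) * \<theta> powr (1 - q) * \<bar>b\<bar> powr q
    \<le> \<bar>a - b\<bar> powr q + (\<theta> - 1) powr (q - 1) * \<bar>a\<bar> powr q"
proof -
  have "(1 - 1 / \<theta>) powr (q - 1) = ((\<theta> - 1) / \<theta>) powr (q - 1)"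
    using \<theta> by (simp add: field_simps)
  also have "\<dots> = (\<theta> - 1) powr (q - 1) * \<theta> powr (1 - q)"
    using \<theta> by (simp add: powr_divide powr_diff field_simps)
  finally have e: "(1 - 1 / \<theta>) powr (q - 1) = (\<theta> - 1) powr (q - 1) * \<theta> powr (1 - q)" .
  have "\<theta> powr (1 - q) * (1 / \<theta>) powr (1 - q) = 1"
    using \<theta> by (simp add: powr_mult[symmetric])
  then show ?thesis
    using picone_less_1[of "1 / \<theta>" q b a] \<theta> q
    by (simp add: e abs_minus_commute mult.assoc)
qed

text \<open>Hoelder's inequality with exponents \<open>p / q\<close> and \<open>p / (p - q)\<close>.
  It is derived from Young's inequality for the normalised functions, so that the case
  \<open>q = p\<close> needs no separate treatment.\<close>

lemma Hoelder_weighted: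
  fixes f g :: "'a \<Rightarrow> real" and w :: "'a \<Rightarrow> ennreal"
  assumes [measurable]: "f \<in> borel_measurable M" "g \<in> borel_measurable M" "w \<in> borel_measurable M"
    and nn: "\<And>x. f x \<ge> 0" "\<And>x. g x \<ge> 0" and pq: "0 < q" "q \<le> p"
    and G: "(\<integral>\<^sup>+ x. ennreal (g x powr p) * w x \<partial>M) = ennreal G" "G > 0"
  shows "(\<integral>\<^sup>+ x. ennreal (f x powr q * g x powr (p - q)) * w x \<partial>M)
    \<le> epowr (\<integral>\<^sup>+ x. ennreal (f x powr p) * w x \<partial>M) (q / p) * ennreal (G powr (1 - q / p))"
    (is "?I \<le> epowr ?F _ * _")
proof -
  have p: "p > 0" using pq by linarith
  consider "?F = \<infinity>" | "?F = 0" | "?F \<noteq> \<infinity>" "?F \<noteq> 0" by blast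
  then show ?thesis
  proof cases
    case 1
    then show ?thesis using G(2) by (simp add: epowr_def ennreal_top_mult)
  next
    case 2
    then have "AE x in M. ennreal (f x powr p) * w x = 0"
      by (subst (asm) nn_integral_0_iff_AE) auto
    then have "AE x in M. ennreal (f x powr q * g x powr (p - q)) * w x = 0"
      by eventually_elim (auto simp: nn less_le)
    then have "?I = 0"
      by (subst nn_integral_0_iff_AE) auto
    then show ?thesis by simp
  next
    case 3
    define F where "F = enn2real ?F"
    have F: "?F = ennreal F" "F > 0"
      using 3 by (auto simp: F_def enn2real_positive_iff less_top zero_less_iff_neq_zero)
    \<comment> \<open>\<open>c\<close> is the claimed bound. Young's inequality multiplied by
      \<open>c\<close> integrates to \<open>c * (q / p) + c * (1 - q / p) = c\<close>.\<close>
    define c where "c = F powr (q / p) * G powr (1 - q / p)"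
    have c: "c \<ge> 0" by (simp add: c_def)
    have qp: "0 \<le> 1 - q / p" "q / p \<ge> 0" using pq p by auto
    have nn2: "c * (q / p / F) \<ge> 0" "c * ((1 - q / p) / G) \<ge> 0"
      using c qp F(2) G(2) p pq by (auto intro!: mult_nonneg_nonneg divide_nonneg_pos)
    have pw: "f x powr q * g x powr (p - q) \<le> c * (q / p / F) * f x powr p + c * ((1 - q / p) / G) * g x powr p" for x
    \<comment> \<open>Here the convention \<open>0 powr 0 = 0\<close> matters: for
      \<open>p = q\<close> the factor \<open>g x powr (p - q)\<close> is the indicator of
      \<open>g x \<noteq> 0\<close>, not the constant 1.\<close>
    proof (cases "f x = 0 \<or> g x = 0")
      case True
      then have "f x powr q * g x powr (p - q) = 0" by auto
      then show ?thesis using nn2 by (simp only: add_nonneg_nonneg mult_nonneg_nonneg powr_ge_zero)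
    next
      case False
      then have fg: "f x > 0" "g x > 0" using nn[of x] by auto
      have "(f x powr p / F) powr (q / p) * (g x powr p / G) powr (1 - q / p)
          \<le> (q / p) * (f x powr p / F) + (1 - q / p) * (g x powr p / G)"
        using qp fg F G(2) by (intro Youngs_inequality_0) auto
      also have "(f x powr p / F) powr (q / p) = f x powr q / F powr (q / p)"
        using p F by (simp add: powr_divide powr_powr)
      also have "(g x powr p / G) powr (1 - q / p) = g x powr (p - q) / G powr (1 - q / p)"
        using p G(2) by (simp add: powr_divide powr_powr right_diff_distrib)
      finally have "f x powr q * g x powr (p - q) / c \<le> (q / p) * (f x powr p / F) + (1 - q / p) * (g x powr p / G)"
        by (simp add: c_def)
      moreover have "c > 0" using F G(2) by (simp add: c_def)
      ultimately have "f x powr q * g x powr (p - q) \<le> c * ((q / p) * (f x powr p / F) + (1 - q / p) * (g x powr p / G))"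
        by (simp add: pos_divide_le_eq mult.commute)
      then show ?thesis by (simp add: distrib_left)
    qed
    have "?I \<le> (\<integral>\<^sup>+ x. ennreal (c * (q / p / F)) * (ennreal (f x powr p) * w x)
        + ennreal (c * ((1 - q / p) / G)) * (ennreal (g x powr p) * w x) \<partial>M)"
    proof (rule nn_integral_mono)
      fix x
      have "ennreal (f x powr q * g x powr (p - q)) * w x
          \<le> ennreal (c * (q / p / F) * f x powr p + c * ((1 - q / p) / G) * g x powr p) * w x"
        by (intro mult_right_mono ennreal_leI pw) simp
      also have "ennreal (c * (q / p / F) * f x powr p + c * ((1 - q / p) / G) * g x powr p)
          = ennreal (c * (q / p / F)) * ennreal (f x powr p) + ennreal (c * ((1 - q / p) / G)) * ennreal (g x powr p)"
        using nn2 by (simp only: ennreal_plus mult_nonneg_nonneg powr_ge_zero ennreal_mult)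
      finally show "ennreal (f x powr q * g x powr (p - q)) * w x \<le> ennreal (c * (q / p / F)) * (ennreal (f x powr p) * w x)
        + ennreal (c * ((1 - q / p) / G)) * (ennreal (g x powr p) * w x)"
        by (simp only: distrib_right mult.assoc)
    qed
    also have "\<dots> = ennreal (c * (q / p / F)) * ?F + ennreal (c * ((1 - q / p) / G)) * ennreal G"
      by (subst nn_integral_add, measurable) (subst nn_integral_cmult, measurable, simp add: G)+
    also have "\<dots> = ennreal (c * (q / p / F) * F + c * ((1 - q / p) / G) * G)"
      using nn2 F G(2) by (simp only: F(1) ennreal_plus mult_nonneg_nonneg less_imp_le ennreal_mult)
    also have "c * (q / p / F) * F + c * ((1 - q / p) / G) * G = c"
      using F G(2) by (simp add: algebra_simps add_divide_distrib[symmetric] diff_divide_distrib)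
    also have "ennreal c = epowr ?F (q / p) * ennreal (G powr (1 - q / p))"
      using F by (simp add: epowr_def c_def ennreal_mult')
    finally show ?thesis .
  qed
qed

section \<open>The Hardy inequality\<close>

locale hardy_parameters =
  fixes s p q \<alpha> \<beta> :: real and d :: nat
  assumes s: "0 < s" "s < 1" and q: "1 \<le> q" "q \<le> p" and d: "d \<ge> 1"
    and \<alpha>: "\<alpha> < s * q - (1 - q / p) * real d" "\<alpha> > - real d"
    and \<beta>: "\<beta> < s * p" "\<beta> > - real d"
begin

definition \<gamma> :: real where "\<gamma> = (real d + \<alpha> + q * \<beta> / p - s * q) / q"
definition m :: real where "m = real d + s * p"
definition \<theta> :: "real \<Rightarrow> real" where "\<theta> t = t powr (- \<gamma>)"
text \<open>With \<open>t = |y| / |x|\<close>, \<open>\<theta> t\<close> is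
  \<open>w y / w x\<close>, and the inner integral of \<open>w\<close> at \<open>x\<close> is
  \<open>K\<close> times \<open>|x| powr (\<beta> - s p - \<gamma> p)\<close>. That
  \<open>enn2real\<close> loses nothing is shown in \<open>radN_eq_K\<close>.\<close>

definition K :: real where "K = enn2real (radN d m (\<lambda>t. ennreal (\<bar>1 - \<theta> t\<bar> powr p * t powr \<beta>)))"

lemma p: "p \<ge> 1" "p > 0" and q0: "q > 0"
  using q by auto

lemma \<gamma>_p: "\<gamma> * p = p / q * (real d + \<alpha>) + \<beta> - s * p"
  using p q0 by (simp add: \<gamma>_def field_simps)

lemma \<gamma>_q: "\<gamma> * q = real d + \<alpha> + q * \<beta> / p - s * q"
  using q0 by (simp add: \<gamma>_def)

text \<open>Because \<open>\<beta> - \<gamma> p = s p - (p / q) (d + \<alpha>)\<close>, these are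
  the two hypotheses on \<open>\<alpha>\<close>. They make \<open>\<beta> - \<gamma> p\<close>, the
  exponent of \<open>\<theta> t powr p * t powr \<beta>\<close>, admissible for the logarithmic
  integrals.\<close>

lemma \<beta>_\<gamma>: "\<beta> - \<gamma> * p < s * p" "\<beta> - \<gamma> * p > - real d"
proof -
  have "p / q * (real d + \<alpha>) > 0" using p q0 \<alpha> by simp
  then show "\<beta> - \<gamma> * p < s * p" by (simp add: \<gamma>_p)
  have "\<alpha> + real d < s * q + (q / p) * real d" using \<alpha> by (simp add: algebra_simps)
  then have "p / q * (real d + \<alpha>) < p / q * (s * q + (q / p) * real d)"
    using p q0 by (intro mult_strict_left_mono) auto
  also have "\<dots> = s * p + real d" using p q0 by (simp add: field_simps)
  finally show "\<beta> - \<gamma> * p > - real d" by (simp add: \<gamma>_p)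
qed

lemma \<theta>_measurable [measurable]: "\<theta> \<in> borel_measurable borel"
  unfolding \<theta>_def by measurable

lemma \<theta>_pos: "t > 0 \<Longrightarrow> \<theta> t > 0"
  by (simp add: \<theta>_def)

text \<open>From \<open>|1 - exp z| \<le> |z| * max 1 (exp z)\<close> with
  \<open>z = - \<gamma> * ln t\<close>. The two summands lead to the logarithmic integrals with
  exponents \<open>\<beta>\<close> and \<open>\<beta> - \<gamma> p\<close>.\<close>

lemma abs_one_minus_\<theta>_le:
  assumes "t > 0"
  shows "\<bar>1 - \<theta> t\<bar> powr p \<le> \<bar>\<gamma>\<bar> powr p * (\<bar>ln t\<bar> powr p * (1 + t powr (- \<gamma> * p)))"
proof -
  let ?x = "- \<gamma> * ln t"
  have \<theta>: "\<theta> t = exp ?x" using assms by (simp add: \<theta>_def powr_def)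
  have "\<bar>1 - exp ?x\<bar> \<le> \<bar>?x\<bar> * max 1 (exp ?x)"
  proof (cases "?x \<ge> 0")
    case True
    have "1 - ?x \<le> exp (- ?x)" using exp_ge_add_one_self[of "- ?x"] by simp
    then have "(1 - ?x) * exp ?x \<le> exp (- ?x) * exp ?x" by (rule mult_right_mono) simp
    then have "exp ?x - 1 \<le> ?x * exp ?x" by (simp add: exp_add[symmetric] algebra_simps)
    moreover have "exp ?x \<ge> 1" using True by simp
    ultimately show ?thesis using True by simp
  next
    case False
    then have "exp ?x \<le> 1" by (metis exp_le_one_iff linear)
    moreover have "1 + ?x \<le> exp ?x" by (rule exp_ge_add_one_self)
    ultimately show ?thesis using False by simp
  qed
  then have "\<bar>1 - \<theta> t\<bar> powr p \<le> (\<bar>?x\<bar> * max 1 (exp ?x)) powr p"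
    unfolding \<theta> using p by (intro powr_mono2) auto
  also have "\<dots> = \<bar>\<gamma>\<bar> powr p * \<bar>ln t\<bar> powr p * (max 1 (exp ?x)) powr p"
    by (simp add: powr_mult abs_mult)
  also have "(max 1 (exp ?x)) powr p \<le> 1 + t powr (- \<gamma> * p)"
    unfolding \<theta>[symmetric] by (simp add: max_def \<theta>_def powr_powr)
  finally show ?thesis by (simp add: mult_left_mono mult.assoc)
qed

lemma radN_eq_K:
  assumes dim: "d = DIM('a::euclidean_space)"
  shows "radN d m (\<lambda>t. ennreal (\<bar>1 - \<theta> t\<bar> powr p * t powr \<beta>)) = ennreal K"
proof -
  have mm: "m = real DIM('a) + s * p" unfolding dim[symmetric] by (rule m_def)
  have ln_fin: "radN d m (\<lambda>t. ennreal (\<bar>ln t\<bar> powr p * t powr \<sigma>)) < \<infinity>" if "- real d < \<sigma>" "\<sigma> < s * p" for \<sigma>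
    using radN_abs_ln_powr_finite[where 'a = 'a, OF s(2) p(2) _ _ mm, of \<sigma>] that
    unfolding dim[symmetric] by simp
  have "radN d m (\<lambda>t. ennreal (\<bar>1 - \<theta> t\<bar> powr p * t powr \<beta>))
      \<le> radN d m (\<lambda>t. ennreal (\<bar>\<gamma>\<bar> powr p) * (ennreal (\<bar>ln t\<bar> powr p * t powr \<beta>)
          + ennreal (\<bar>ln t\<bar> powr p * t powr (\<beta> - \<gamma> * p))))"
  proof (rule radN_mono)
    fix t :: real assume t: "t > 0"
    have "\<bar>1 - \<theta> t\<bar> powr p * t powr \<beta> \<le> \<bar>\<gamma>\<bar> powr p * (\<bar>ln t\<bar> powr p * (1 + t powr (- \<gamma> * p))) * t powr \<beta>"
      by (intro mult_right_mono abs_one_minus_\<theta>_le t) simp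
    also have "\<dots> = \<bar>\<gamma>\<bar> powr p * (\<bar>ln t\<bar> powr p * t powr \<beta> + \<bar>ln t\<bar> powr p * t powr (\<beta> - \<gamma> * p))"
      by (simp add: powr_diff powr_minus field_simps)
    finally have "ennreal (\<bar>1 - \<theta> t\<bar> powr p * t powr \<beta>)
        \<le> ennreal (\<bar>\<gamma>\<bar> powr p * (\<bar>ln t\<bar> powr p * t powr \<beta> + \<bar>ln t\<bar> powr p * t powr (\<beta> - \<gamma> * p)))"
      by (rule ennreal_leI)
    also have "\<dots> = ennreal (\<bar>\<gamma>\<bar> powr p) * ennreal (\<bar>ln t\<bar> powr p * t powr \<beta> + \<bar>ln t\<bar> powr p * t powr (\<beta> - \<gamma> * p))"
      by (rule ennreal_mult') simp
    also have "ennreal (\<bar>ln t\<bar> powr p * t powr \<beta> + \<bar>ln t\<bar> powr p * t powr (\<beta> - \<gamma> * p))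
        = ennreal (\<bar>ln t\<bar> powr p * t powr \<beta>) + ennreal (\<bar>ln t\<bar> powr p * t powr (\<beta> - \<gamma> * p))"
      by (rule ennreal_plus) simp_all
    finally show "ennreal (\<bar>1 - \<theta> t\<bar> powr p * t powr \<beta>) \<le> ennreal (\<bar>\<gamma>\<bar> powr p) *
        (ennreal (\<bar>ln t\<bar> powr p * t powr \<beta>) + ennreal (\<bar>ln t\<bar> powr p * t powr (\<beta> - \<gamma> * p)))" .
  qed
  also have "\<dots> = ennreal (\<bar>\<gamma>\<bar> powr p) * (radN d m (\<lambda>t. ennreal (\<bar>ln t\<bar> powr p * t powr \<beta>))
          + radN d m (\<lambda>t. ennreal (\<bar>ln t\<bar> powr p * t powr (\<beta> - \<gamma> * p))))"
  proof -
    let ?h1 = "\<lambda>t. ennreal (\<bar>ln t\<bar> powr p * t powr \<beta>)"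
    let ?h2 = "\<lambda>t. ennreal (\<bar>ln t\<bar> powr p * t powr (\<beta> - \<gamma> * p))"
    have h [measurable]: "?h1 \<in> borel_measurable borel" "?h2 \<in> borel_measurable borel"
      by measurable
    have "(\<lambda>t. ?h1 t + ?h2 t) \<in> borel_measurable borel" by measurable
    from radN_cmult[OF this, of d m "ennreal (\<bar>\<gamma>\<bar> powr p)"] radN_add[OF h, of d m]
    show ?thesis by simp
  qed
  also have "\<dots> < \<infinity>"
    using ln_fin[of \<beta>] ln_fin[of "\<beta> - \<gamma> * p"] \<beta> \<beta>_\<gamma> by (simp add: ennreal_mult_less_top)
  finally show ?thesis unfolding K_def by simp
qed

lemma K_nonneg: "K \<ge> 0"
  by (simp add: K_def)

text \<open>In the folded integral, the part from \<open>t < 1\<close> gives the summand with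
  \<open>d\<close> and \<open>\<alpha>\<close>, the part from \<open>t > 1\<close> the summand
  \<open>t powr (- \<beta>)\<close>.\<close>

lemma Cconst_eq:
  assumes dim: "d = DIM('a::euclidean_space)"
  shows "Cconst d s p q \<alpha> \<beta> = ennreal (K powr (q / p))"
proof -
  let ?h = "\<lambda>t. ennreal (\<bar>1 - \<theta> t\<bar> powr p * t powr \<beta>)"
  have "ennreal K = radN d m ?h"
    by (rule radN_eq_K[OF dim, symmetric])
  also have "\<dots> = (\<integral>\<^sup>+ t\<in>{0<..<1}. (?h t * ennreal (t powr (real d - 1))
      + ?h (1 / t) * ennreal (t powr (m - real d - 1))) * Psi d m t \<partial>lborel)"
    by (rule radN_fold) measurable
  also have "\<dots> = (\<integral>\<^sup>+ t\<in>{0<..<1}. ennreal (t powr (s*p - 1)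
          * (t powr (-(p/q - 1) * real d - p*\<alpha>/q) + t powr (-\<beta>))
          * \<bar>1 - t powr ((real d + \<alpha> + q*\<beta>/p - s*q) / q)\<bar> powr p
          * Phi d s p t) \<partial>lborel)"
  proof (rule nn_integral_cong)
    fix t :: real
    let ?A = "\<bar>1 - t powr \<gamma>\<bar> powr p"
    have "(?h t * ennreal (t powr (real d - 1)) + ?h (1 / t) * ennreal (t powr (m - real d - 1))) * Psi d m t
        = ennreal (t powr (s*p - 1) * (t powr (-(p/q - 1) * real d - p*\<alpha>/q) + t powr (-\<beta>)) * ?A * Phi d s p t)"
      if t: "0 < t" "t < 1"
    proof -
      \<comment> \<open>Both parts must show the common factor \<open>|1 - t powr \<gamma>|\<close>;
        the power \<open>t powr (- \<gamma> p)\<close> split off here is what replaces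
        \<open>\<beta>\<close> by \<open>\<alpha>\<close> in the exponent.\<close>
      have "\<bar>1 - \<theta> t\<bar> = t powr (- \<gamma>) * \<bar>1 - t powr \<gamma>\<bar>"
      proof -
        have "1 - \<theta> t = t powr (- \<gamma>) * (t powr \<gamma> - 1)"
          using t by (simp add: \<theta>_def right_diff_distrib powr_add[symmetric])
        then show ?thesis by (simp add: abs_mult abs_minus_commute)
      qed
      then have "\<bar>1 - \<theta> t\<bar> powr p * t powr \<beta> * t powr (real d - 1) = ?A * (t powr (- \<gamma> * p) * t powr \<beta> * t powr (real d - 1))"
        by (simp add: powr_mult powr_powr)
      also have "t powr (- \<gamma> * p) * t powr \<beta> * t powr (real d - 1) = t powr (s*p - 1) * t powr (-(p/q - 1) * real d - p*\<alpha>/q)"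
      proof -
        have "- \<gamma> * p + \<beta> + (real d - 1) = s*p - 1 + (-(p/q - 1) * real d - p*\<alpha>/q)"
          using \<gamma>_p by (simp add: algebra_simps)
        then show ?thesis by (simp only: powr_add[symmetric])
      qed
      finally have 1: "\<bar>1 - \<theta> t\<bar> powr p * t powr \<beta> * t powr (real d - 1)
          = t powr (s*p - 1) * t powr (-(p/q - 1) * real d - p*\<alpha>/q) * ?A" by (simp add: mult_ac)
      have "\<theta> (1 / t) = t powr \<gamma>"
        using t by (simp add: \<theta>_def powr_divide powr_minus_divide)
      moreover have "(1 / t) powr \<beta> = t powr (- \<beta>)"
        using t by (simp add: powr_divide powr_minus_divide)
      ultimately have 2: "\<bar>1 - \<theta> (1 / t)\<bar> powr p * (1 / t) powr \<beta> * t powr (m - real d - 1)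
          = t powr (s*p - 1) * t powr (- \<beta>) * ?A" by (simp add: m_def mult_ac)
      have Psi: "Psi d m t = ennreal (Phi d s p t)"
        using t d by (intro Psi_eq_Phi) (auto simp: m_def)
      have 3: "?h t * ennreal (t powr (real d - 1)) + ?h (1 / t) * ennreal (t powr (m - real d - 1))
        = ennreal (t powr (s*p - 1) * t powr (-(p/q - 1) * real d - p*\<alpha>/q) * ?A + t powr (s*p - 1) * t powr (- \<beta>) * ?A)"
        unfolding 1[symmetric] 2[symmetric] by (simp add: ennreal_mult')
      show ?thesis
        unfolding Psi 3
        by (subst ennreal_mult'[symmetric]) (simp_all add: distrib_left distrib_right mult_ac)
    qed
    then show "(?h t * ennreal (t powr (real d - 1)) + ?h (1 / t) * ennreal (t powr (m - real d - 1))) * Psi d m t * indicator {0<..<1} t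
        = ennreal (t powr (s*p - 1) * (t powr (-(p/q - 1) * real d - p*\<alpha>/q) + t powr (-\<beta>))
          * \<bar>1 - t powr ((real d + \<alpha> + q*\<beta>/p - s*q) / q)\<bar> powr p * Phi d s p t) * indicator {0<..<1} t"
      unfolding \<gamma>_def[symmetric] by (simp add: indicator_def)
  qed
  finally have e: "ennreal K = (\<integral>\<^sup>+ t\<in>{0<..<1}. ennreal (t powr (s*p - 1)
          * (t powr (-(p/q - 1) * real d - p*\<alpha>/q) + t powr (-\<beta>))
          * \<bar>1 - t powr ((real d + \<alpha> + q*\<beta>/p - s*q) / q)\<bar> powr p
          * Phi d s p t) \<partial>lborel)" .
  show ?thesis
    unfolding Cconst_def e[symmetric] by (simp add: epowr_def K_nonneg)
qed

end

lemma epowr_measurable [measurable]: "(\<lambda>x. epowr x a) \<in> borel_measurable borel"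
  unfolding epowr_def by measurable

lemma AE_lborel_nonzero: "AE x in lborel. x \<noteq> (0 :: 'a::euclidean_space)"
  using AE_not_in[OF countable_imp_null_set_lborel, of "{0 :: 'a}"] by simp

section \<open>The kernel left by Hoelder's inequality and the proof of the lower bound\<close>

context hardy_parameters
begin

text \<open>Hoelder's inequality in \<open>y\<close> turns the weight \<open>|x| powr \<alpha>\<close> into \<open>|x| powr \<kappa>\<close>.\<close>

definition \<kappa> :: real where "\<kappa> = \<alpha> + (1 - q / p) * (s * p - \<beta>)"

definition W :: "'a::euclidean_space \<Rightarrow> 'a \<Rightarrow> ennreal" where
  "W x y = ennreal (norm (x - y) powr (- m)) * ennreal (norm y powr \<beta>) * ennreal (norm x powr \<kappa>)"

lemma W_measurable [measurable]: "case_prod W \<in> borel_measurable (borel \<Otimes>\<^sub>M borel)"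
  unfolding W_def by measurable

lemma \<kappa>_eq: "\<kappa> + \<beta> - s * p = - (s * q - \<alpha> - q * \<beta> / p)"
  using p by (simp add: \<kappa>_def field_simps)

text \<open>Exponent balance behind the cancellation of the Picone terms: under inversion the factor
  \<open>\<theta> powr (1 - q)\<close> belonging to \<open>u y\<close> becomes a plain
  \<open>\<theta>\<close>.\<close>

lemma \<kappa>_\<gamma>: "- \<gamma> * (1 - q) - \<kappa> + (m - 2 * real d) = - \<gamma> + \<beta>"
  using \<kappa>_eq \<gamma>_q by (simp add: m_def algebra_simps)

lemma RHS_integrand:
  assumes "x \<noteq> 0"
  shows "\<bar>u\<bar> powr q / norm x powr (s * q - \<alpha> - q * \<beta> / p) = \<bar>u\<bar> powr q * norm x powr (real d - m + \<beta> + \<kappa>)"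
proof -
  have "real d - m + \<beta> + \<kappa> = - (s * q - \<alpha> - q * \<beta> / p)"
    using \<kappa>_eq by (simp add: m_def)
  then show ?thesis by (simp only: powr_minus_divide times_divide_eq_right mult_1_right)
qed

text \<open>A factor \<open>c\<close> of the ratio alone is unchanged by scaling, so the only power
  of \<open>|x|\<close> is the one of the kernel and the weight.\<close>

lemma nn_integral_kernel_ratio:
  fixes x :: "'a::euclidean_space" and c :: "real \<Rightarrow> ennreal"
  assumes dim: "d = DIM('a)" and x: "x \<noteq> 0" and [measurable]: "c \<in> borel_measurable borel"
  shows "(\<integral>\<^sup>+ y. c (norm y / norm x) * (ennreal (norm (x - y) powr (- m)) * ennreal (norm y powr \<beta>)) \<partial>lborel)
    = ennreal (norm x powr (\<beta> - s * p)) * radN d m (\<lambda>t. c t * ennreal (t powr \<beta>))"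
proof -
  let ?r = "norm x"
  let ?h = "\<lambda>r. c (r / ?r) * ennreal (r powr \<beta>)"
  have "(\<integral>\<^sup>+ y. c (norm y / ?r) * (ennreal (norm (x - y) powr (- m)) * ennreal (norm y powr \<beta>)) \<partial>lborel)
      = (\<integral>\<^sup>+ y. ?h (norm y) * ennreal (norm (x - y) powr (- m)) \<partial>lborel)"
    by (intro nn_integral_cong) (simp only: mult_ac)
  also have "\<dots> = ennreal (?r powr (real d - m)) * radN d m (\<lambda>t. ?h (?r * t))"
    unfolding dim[symmetric]
    using nn_integral_kernel[OF x, of ?h m] by (simp add: dim[symmetric])
  also have "radN d m (\<lambda>t. ?h (?r * t)) = radN d m (\<lambda>t. ennreal (?r powr \<beta>) * (c t * ennreal (t powr \<beta>)))"
    using x by (intro radN_cong) (simp add: powr_mult ennreal_mult' mult_ac)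
  also have "\<dots> = ennreal (?r powr \<beta>) * radN d m (\<lambda>t. c t * ennreal (t powr \<beta>))"
    by (rule radN_cmult) measurable
  also have "ennreal (?r powr (real d - m)) * \<dots> = ennreal (?r powr (real d - m) * ?r powr \<beta>) * radN d m (\<lambda>t. c t * ennreal (t powr \<beta>))"
    by (simp add: ennreal_mult' mult_ac)
  also have "?r powr (real d - m) * ?r powr \<beta> = ?r powr (\<beta> - s * p)"
    by (simp add: m_def powr_add[symmetric])
  finally show ?thesis .
qed

lemma nn_integral_weighted_x:
  fixes u :: "'a::euclidean_space \<Rightarrow> real" and c :: "real \<Rightarrow> ennreal"
  assumes dim: "d = DIM('a)" and [measurable]: "u \<in> borel_measurable borel" "c \<in> borel_measurable borel"
  shows "(\<integral>\<^sup>+ x. (\<integral>\<^sup>+ y. c (norm y / norm x) * ennreal (\<bar>u x\<bar> powr q) * W x y \<partial>lborel) \<partial>lborel)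
    = RHS s p q \<alpha> \<beta> u * radN d m (\<lambda>t. c t * ennreal (t powr \<beta>))"
proof -
  let ?N = "radN d m (\<lambda>t. c t * ennreal (t powr \<beta>))"
  have "(\<integral>\<^sup>+ x. (\<integral>\<^sup>+ y. c (norm y / norm x) * ennreal (\<bar>u x\<bar> powr q) * W x y \<partial>lborel) \<partial>lborel)
    = (\<integral>\<^sup>+ (x::'a). ennreal (\<bar>u x\<bar> powr q / norm x powr (s * q - \<alpha> - q * \<beta> / p)) * ?N \<partial>lborel)"
  proof (rule nn_integral_cong_AE, use AE_lborel_nonzero in eventually_elim)
    fix x :: 'a assume x: "x \<noteq> 0"
    let ?r = "norm x"
    let ?C = "ennreal (\<bar>u x\<bar> powr q) * ennreal (?r powr \<kappa>)"
    have "(\<integral>\<^sup>+ y. c (norm y / ?r) * ennreal (\<bar>u x\<bar> powr q) * W x y \<partial>lborel)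
        = (\<integral>\<^sup>+ y. (c (norm y / ?r) * (ennreal (norm (x - y) powr (- m)) * ennreal (norm y powr \<beta>))) * ?C \<partial>lborel)"
      by (intro nn_integral_cong) (simp only: W_def mult_ac)
    also have "\<dots> = (\<integral>\<^sup>+ y. c (norm y / ?r) * (ennreal (norm (x - y) powr (- m)) * ennreal (norm y powr \<beta>)) \<partial>lborel) * ?C"
      by (rule nn_integral_multc) measurable
    also have "\<dots> = ennreal (\<bar>u x\<bar> powr q * (?r powr (\<beta> - s * p) * ?r powr \<kappa>)) * ?N"
      unfolding nn_integral_kernel_ratio[OF dim x assms(3)] by (simp add: ennreal_mult' mult_ac)
    also have "?r powr (\<beta> - s * p) * ?r powr \<kappa> = ?r powr (real d - m + \<beta> + \<kappa>)"
      by (simp add: m_def powr_add[symmetric] algebra_simps)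
    finally show "(\<integral>\<^sup>+ y. c (norm y / ?r) * ennreal (\<bar>u x\<bar> powr q) * W x y \<partial>lborel)
      = ennreal (\<bar>u x\<bar> powr q / ?r powr (s * q - \<alpha> - q * \<beta> / p)) * ?N"
      unfolding RHS_integrand[OF x] .
  qed
  also have "\<dots> = RHS s p q \<alpha> \<beta> u * ?N"
    unfolding RHS_def by (rule nn_integral_multc) measurable
  finally show ?thesis .
qed

text \<open>Counterpart for the terms in \<open>u y\<close>: Fubini makes \<open>x\<close> the inner
  variable, the radial variable is then \<open>|x| / |y|\<close>, and inversion returns to
  \<open>|y| / |x|\<close>, so that these multiples can be compared with those of
  \<open>u x\<close>.\<close>

lemma nn_integral_weighted_y:
  fixes u :: "'a::euclidean_space \<Rightarrow> real" and c :: "real \<Rightarrow> ennreal"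
  assumes dim: "d = DIM('a)" and [measurable]: "u \<in> borel_measurable borel" "c \<in> borel_measurable borel"
  shows "(\<integral>\<^sup>+ x. (\<integral>\<^sup>+ y. c (norm y / norm x) * ennreal (\<theta> (norm y / norm x) powr (1 - q)) * ennreal (\<bar>u y\<bar> powr q) * W x y \<partial>lborel) \<partial>lborel)
    = RHS s p q \<alpha> \<beta> u * radN d m (\<lambda>t. c t * ennreal (\<theta> t) * ennreal (t powr \<beta>))"
proof -
  let ?N = "radN d m (\<lambda>t. c t * ennreal (\<theta> t) * ennreal (t powr \<beta>))"
  \<comment> \<open>The integrand of the inner \<open>x\<close>-integral in the variable
    \<open>|x| / |y|\<close>, before inversion.\<close>
  let ?G = "\<lambda>t. c (1 / t) * ennreal (\<theta> (1 / t) powr (1 - q)) * ennreal (t powr \<kappa>)"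
  have "radN d m ?G = radN d m (\<lambda>t. ?G (1 / t) * ennreal (t powr (m - 2 * real d)))"
    by (rule radN_inversion[symmetric]) measurable
  also have "\<dots> = ?N"
  proof (rule radN_cong)
    fix t :: real assume t: "t > 0"
    have "\<theta> t powr (1 - q) * (1 / t) powr \<kappa> * t powr (m - 2 * real d) = t powr (- \<gamma> * (1 - q) - \<kappa> + (m - 2 * real d))"
      using t by (simp only: \<theta>_def powr_powr powr_divide powr_add[of t] powr_diff[of t "_ * _" \<kappa>]) simp
    also have "\<dots> = \<theta> t * t powr \<beta>"
      unfolding \<kappa>_\<gamma> by (simp only: \<theta>_def powr_add)
    finally have "ennreal (\<theta> t powr (1 - q)) * ennreal ((1 / t) powr \<kappa>) * ennreal (t powr (m - 2 * real d)) = ennreal (\<theta> t) * ennreal (t powr \<beta>)"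
      using \<theta>_pos[OF t] by (simp only: ennreal_mult[symmetric] powr_ge_zero mult_nonneg_nonneg less_imp_le)
    then show "?G (1 / t) * ennreal (t powr (m - 2 * real d)) = c t * ennreal (\<theta> t) * ennreal (t powr \<beta>)"
      by (simp add: mult.assoc)
  qed
  finally have N: "radN d m ?G = ?N" .
  have "(\<integral>\<^sup>+ x. (\<integral>\<^sup>+ y. c (norm y / norm x) * ennreal (\<theta> (norm y / norm x) powr (1 - q)) * ennreal (\<bar>u y\<bar> powr q) * W x y \<partial>lborel) \<partial>lborel)
    = (\<integral>\<^sup>+ y. (\<integral>\<^sup>+ x. c (norm y / norm x) * ennreal (\<theta> (norm y / norm x) powr (1 - q)) * ennreal (\<bar>u y\<bar> powr q) * W x y \<partial>lborel) \<partial>lborel)"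
    by (rule lborel_pair.Fubini') measurable
  also have "\<dots> = (\<integral>\<^sup>+ (y::'a). ennreal (\<bar>u y\<bar> powr q / norm y powr (s * q - \<alpha> - q * \<beta> / p)) * ?N \<partial>lborel)"
  proof (rule nn_integral_cong_AE, use AE_lborel_nonzero in eventually_elim)
    fix y :: 'a assume y: "y \<noteq> 0"
    let ?r = "norm y"
    let ?h = "\<lambda>r. c (?r / r) * ennreal (\<theta> (?r / r) powr (1 - q)) * ennreal (r powr \<kappa>)"
    have "(\<integral>\<^sup>+ x. c (?r / norm x) * ennreal (\<theta> (?r / norm x) powr (1 - q)) * ennreal (\<bar>u y\<bar> powr q) * W x y \<partial>lborel)
        = (\<integral>\<^sup>+ x. (?h (norm x) * ennreal (norm (y - x) powr (- m))) * (ennreal (\<bar>u y\<bar> powr q) * ennreal (?r powr \<beta>)) \<partial>lborel)"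
      by (intro nn_integral_cong) (simp only: W_def mult_ac norm_minus_commute)
    also have "\<dots> = (\<integral>\<^sup>+ x. ?h (norm x) * ennreal (norm (y - x) powr (- m)) \<partial>lborel) * (ennreal (\<bar>u y\<bar> powr q) * ennreal (?r powr \<beta>))"
      by (rule nn_integral_multc) measurable
    also have "(\<integral>\<^sup>+ x. ?h (norm x) * ennreal (norm (y - x) powr (- m)) \<partial>lborel)
        = ennreal (?r powr (real d - m)) * radN d m (\<lambda>t. ?h (?r * t))"
      unfolding dim[symmetric]
      using nn_integral_kernel[OF y, of ?h m] by (simp add: dim[symmetric])
    also have "radN d m (\<lambda>t. ?h (?r * t)) = radN d m (\<lambda>t. ennreal (?r powr \<kappa>) * ?G t)"
      using y by (intro radN_cong) (simp add: powr_mult ennreal_mult' mult_ac)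
    also have "\<dots> = ennreal (?r powr \<kappa>) * ?N"
      unfolding N[symmetric] by (rule radN_cmult) measurable
    also have "ennreal (?r powr (real d - m)) * (ennreal (?r powr \<kappa>) * ?N) * (ennreal (\<bar>u y\<bar> powr q) * ennreal (?r powr \<beta>))
        = ennreal (\<bar>u y\<bar> powr q * (?r powr (real d - m) * ?r powr \<beta> * ?r powr \<kappa>)) * ?N"
      by (simp add: ennreal_mult' mult_ac)
    also have "?r powr (real d - m) * ?r powr \<beta> * ?r powr \<kappa> = ?r powr (real d - m + \<beta> + \<kappa>)"
      by (simp only: powr_add)
    finally show "(\<integral>\<^sup>+ x. c (?r / norm x) * ennreal (\<theta> (?r / norm x) powr (1 - q)) * ennreal (\<bar>u y\<bar> powr q) * W x y \<partial>lborel)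
      = ennreal (\<bar>u y\<bar> powr q / ?r powr (s * q - \<alpha> - q * \<beta> / p)) * ?N"
      unfolding RHS_integrand[OF y] .
  qed
  also have "\<dots> = RHS s p q \<alpha> \<beta> u * ?N"
    unfolding RHS_def by (rule nn_integral_multc) measurable
  finally show ?thesis .
qed


text \<open>Discarding a neighbourhood of \<open>\<theta> = 1\<close> makes the two halves of the Picone inequality separately
  integrable, although the kernel is singular at \<open>x = y\<close>.\<close>

lemma Hardy_truncated:
  fixes u :: "'a::euclidean_space \<Rightarrow> real" and \<delta> :: real
  assumes dim: "d = DIM('a)" and u [measurable]: "u \<in> borel_measurable borel"
    and R: "RHS s p q \<alpha> \<beta> u < \<infinity>" and \<delta>: "\<delta> > 0"
  defines "g \<equiv> \<lambda>t. if \<delta> \<le> \<bar>1 - \<theta> t\<bar> then \<bar>1 - \<theta> t\<bar> else 0"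
  shows "RHS s p q \<alpha> \<beta> u * radN d m (\<lambda>t. ennreal (g t powr p) * ennreal (t powr \<beta>))
    \<le> (\<integral>\<^sup>+ x. (\<integral>\<^sup>+ y. ennreal (\<bar>u x - u y\<bar> powr q * g (norm y / norm x) powr (p - q)) * W x y \<partial>lborel) \<partial>lborel)"
proof -
  \<comment> \<open>Coefficients of the Picone inequality times \<open>g powr (p - q)\<close>, with
    the powers \<open>p - q\<close> and \<open>q - 1\<close> merged: \<open>c1\<close> lives where
    \<open>w y < w x\<close>, \<open>c2\<close> where \<open>w y > w x\<close>.\<close>
  define c1 where "c1 t = (if \<theta> t < 1 then g t powr (p - 1) else 0)" for t
  define c2 where "c2 t = (if \<theta> t > 1 then g t powr (p - 1) else 0)" for t
  have [measurable]: "g \<in> borel_measurable borel" unfolding g_def by measurable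
  have [measurable]: "c1 \<in> borel_measurable borel" "c2 \<in> borel_measurable borel"
    unfolding c1_def c2_def by measurable
  have g0: "g t \<ge> 0" for t by (simp add: g_def)
  have c0: "c1 t \<ge> 0" "c2 t \<ge> 0" for t by (simp_all add: c1_def c2_def)
  let ?R = "RHS s p q \<alpha> \<beta> u"
  let ?I = "\<lambda>x y. ennreal (\<bar>u x - u y\<bar> powr q * g (norm y / norm x) powr (p - q)) * W x y"
  let ?X = "\<lambda>c x y. ennreal (c (norm y / norm x)) * ennreal (\<bar>u x\<bar> powr q) * W x y"
  let ?Y = "\<lambda>c x y. ennreal (c (norm y / norm x)) * ennreal (\<theta> (norm y / norm x) powr (1 - q)) * ennreal (\<bar>u y\<bar> powr q) * W x y"
  let ?A = "\<lambda>c. radN d m (\<lambda>t. ennreal (c t) * ennreal (t powr \<beta>))"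
  let ?B = "\<lambda>c. radN d m (\<lambda>t. ennreal (c t) * ennreal (\<theta> t) * ennreal (t powr \<beta>))"
  let ?K = "radN d m (\<lambda>t. ennreal (g t powr p) * ennreal (t powr \<beta>))"
  \<comment> \<open>The subtracted Picone terms are put on the right. All integrands are then
    nonnegative, and these terms are cancelled only after integration.\<close>
  have pointwise: "c1 t * a powr q + c2 t * \<theta> t powr (1 - q) * b powr q
      \<le> e powr q * g t powr (p - q) + (c2 t * a powr q + c1 t * \<theta> t powr (1 - q) * b powr q)"
    if t: "t > 0" and ab: "a = \<bar>a'\<bar>" "b = \<bar>b'\<bar>" "e = \<bar>a' - b'\<bar>" for t a b e a' b' :: real
  proof (cases "\<delta> \<le> \<bar>1 - \<theta> t\<bar>")
    case False
    \<comment> \<open>Inside the truncated zone all coefficients vanish, also for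
      \<open>p = 1\<close> and \<open>p = q\<close>, since \<open>0 powr 0 = 0\<close>.\<close>
    then have "g t = 0" by (simp add: g_def)
    then show ?thesis by (simp add: c1_def c2_def)
  next
    case True
    have split: "z powr (p - 1) = z powr (p - q) * z powr (q - 1)" for z :: real
      by (simp add: powr_add[symmetric])
    show ?thesis
    proof (cases "\<theta> t < 1")
      case less: True
      have eqs: "c1 t = (1 - \<theta> t) powr (p - q) * (1 - \<theta> t) powr (q - 1)" "c2 t = 0" "g t = 1 - \<theta> t"
        using less True by (simp_all add: c1_def c2_def g_def split)
      have "(1 - \<theta> t) powr (p - q) * ((1 - \<theta> t) powr (q - 1) * a powr q)
        \<le> (1 - \<theta> t) powr (p - q) * (e powr q + (1 - \<theta> t) powr (q - 1) * \<theta> t powr (1 - q) * b powr q)"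
        unfolding ab by (intro mult_left_mono picone_less_1 \<theta>_pos t less q) simp
      then show ?thesis unfolding eqs by (simp add: algebra_simps)
    next
      case False
      then have gt: "\<theta> t > 1" using True \<delta> by (cases "\<theta> t = 1") auto
      have eqs: "c2 t = (\<theta> t - 1) powr (p - q) * (\<theta> t - 1) powr (q - 1)" "c1 t = 0" "g t = \<theta> t - 1"
        using gt True by (simp_all add: c1_def c2_def g_def split)
      have "(\<theta> t - 1) powr (p - q) * ((\<theta> t - 1) powr (q - 1) * \<theta> t powr (1 - q) * b powr q)
        \<le> (\<theta> t - 1) powr (p - q) * (e powr q + (\<theta> t - 1) powr (q - 1) * a powr q)"
        unfolding ab by (intro mult_left_mono picone_greater_1 gt q) simp
      then show ?thesis unfolding eqs by (simp add: algebra_simps)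
    qed
  qed
  have le: "?X c1 x y + ?Y c2 x y \<le> ?I x y + (?X c2 x y + ?Y c1 x y)" if "x \<noteq> 0" "y \<noteq> 0" for x y
  proof -
    let ?t = "norm y / norm x"
    have t: "?t > 0" using that by simp
    have "ennreal (c1 ?t * \<bar>u x\<bar> powr q + c2 ?t * \<theta> ?t powr (1 - q) * \<bar>u y\<bar> powr q)
      \<le> ennreal (\<bar>u x - u y\<bar> powr q * g ?t powr (p - q) + (c2 ?t * \<bar>u x\<bar> powr q + c1 ?t * \<theta> ?t powr (1 - q) * \<bar>u y\<bar> powr q))"
      by (intro ennreal_leI pointwise[OF t refl refl refl])
    then have "ennreal (c1 ?t * \<bar>u x\<bar> powr q + c2 ?t * \<theta> ?t powr (1 - q) * \<bar>u y\<bar> powr q) * W x y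
      \<le> ennreal (\<bar>u x - u y\<bar> powr q * g ?t powr (p - q) + (c2 ?t * \<bar>u x\<bar> powr q + c1 ?t * \<theta> ?t powr (1 - q) * \<bar>u y\<bar> powr q)) * W x y"
      by (rule mult_right_mono) simp
    then show ?thesis
      using c0 g0 by (simp add: ennreal_plus ennreal_mult distrib_right)
  qed
  have "?R * ?A c1 + ?R * ?B c2
      = (\<integral>\<^sup>+ x. (\<integral>\<^sup>+ y. ?X c1 x y \<partial>lborel) \<partial>lborel) + (\<integral>\<^sup>+ x. (\<integral>\<^sup>+ y. ?Y c2 x y \<partial>lborel) \<partial>lborel)"
    using nn_integral_weighted_x[OF dim u, of "\<lambda>t. ennreal (c1 t)"] nn_integral_weighted_y[OF dim u, of "\<lambda>t. ennreal (c2 t)"]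
    by simp
  also have "\<dots> = (\<integral>\<^sup>+ x. (\<integral>\<^sup>+ y. ?X c1 x y + ?Y c2 x y \<partial>lborel) \<partial>lborel)"
    by (simp add: nn_integral_add)
  also have "\<dots> \<le> (\<integral>\<^sup>+ x. (\<integral>\<^sup>+ y. ?I x y + (?X c2 x y + ?Y c1 x y) \<partial>lborel) \<partial>lborel)"
  proof (rule nn_integral_mono_AE, use AE_lborel_nonzero in eventually_elim)
    fix x :: 'a assume x: "x \<noteq> 0"
    show "(\<integral>\<^sup>+ y. ?X c1 x y + ?Y c2 x y \<partial>lborel) \<le> (\<integral>\<^sup>+ y. ?I x y + (?X c2 x y + ?Y c1 x y) \<partial>lborel)"
      by (rule nn_integral_mono_AE, use AE_lborel_nonzero in eventually_elim) (rule le[OF x])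
  qed
  also have "\<dots> = (\<integral>\<^sup>+ x. (\<integral>\<^sup>+ y. ?I x y \<partial>lborel) \<partial>lborel)
      + ((\<integral>\<^sup>+ x. (\<integral>\<^sup>+ y. ?X c2 x y \<partial>lborel) \<partial>lborel) + (\<integral>\<^sup>+ x. (\<integral>\<^sup>+ y. ?Y c1 x y \<partial>lborel) \<partial>lborel))"
    by (simp add: nn_integral_add)
  also have "(\<integral>\<^sup>+ x. (\<integral>\<^sup>+ y. ?X c2 x y \<partial>lborel) \<partial>lborel) + (\<integral>\<^sup>+ x. (\<integral>\<^sup>+ y. ?Y c1 x y \<partial>lborel) \<partial>lborel)
      = ?R * ?A c2 + ?R * ?B c1"
    using nn_integral_weighted_x[OF dim u, of "\<lambda>t. ennreal (c2 t)"] nn_integral_weighted_y[OF dim u, of "\<lambda>t. ennreal (c1 t)"]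
    by simp
  finally have main: "?R * (?A c1 + ?B c2) \<le> (\<integral>\<^sup>+ x. (\<integral>\<^sup>+ y. ?I x y \<partial>lborel) \<partial>lborel) + ?R * (?A c2 + ?B c1)"
    by (simp add: distrib_left)
  have AB: "?A c + ?B c' = radN d m (\<lambda>t. ennreal ((c t + c' t * \<theta> t) * t powr \<beta>))"
    if [measurable]: "c \<in> borel_measurable borel" "c' \<in> borel_measurable borel"
      and nn: "\<And>t. c t \<ge> 0" "\<And>t. c' t \<ge> 0" for c c'
  proof -
    have "?A c + ?B c' = radN d m (\<lambda>t. ennreal (c t) * ennreal (t powr \<beta>) + ennreal (c' t) * ennreal (\<theta> t) * ennreal (t powr \<beta>))"
      by (rule radN_add[symmetric]) measurable
    also have "\<dots> = radN d m (\<lambda>t. ennreal ((c t + c' t * \<theta> t) * t powr \<beta>))"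
      by (intro radN_cong) (simp add: nn \<theta>_pos less_imp_le ennreal_plus ennreal_mult distrib_right)
    finally show ?thesis .
  qed
  let ?D = "radN d m (\<lambda>t. ennreal ((c2 t + c1 t * \<theta> t) * t powr \<beta>))"
  have "radN d m (\<lambda>t. ennreal ((c1 t + c2 t * \<theta> t) * t powr \<beta>))
      = radN d m (\<lambda>t. ennreal ((c2 t + c1 t * \<theta> t) * t powr \<beta>) + ennreal (g t powr p) * ennreal (t powr \<beta>))"
  proof (rule radN_cong)
    fix t :: real assume t: "t > 0"
    \<comment> \<open>The net multiple: \<open>(c1 + c2 \<theta>) - (c2 + c1 \<theta>)\<close> is
      \<open>(c1 - c2) (1 - \<theta>)\<close>, and the sign of \<open>c1 - c2\<close> agrees with
      that of \<open>1 - \<theta>\<close>. This supplies the factor that raises \<open>p - 1\<close>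
      to \<open>p\<close>.\<close>
    have "g t powr p = (c1 t - c2 t) * (1 - \<theta> t)"
    proof (cases "g t = 0")
      case False
      then have "g t = \<bar>1 - \<theta> t\<bar>" "g t > 0" by (auto simp: g_def split: if_splits)
      moreover have "g t powr p = g t powr (p - 1) * g t"
        using \<open>g t > 0\<close> by (simp add: powr_diff)
      ultimately show ?thesis by (auto simp: c1_def c2_def abs_if algebra_simps)
    qed (simp add: c1_def c2_def)
    then have "c1 t + c2 t * \<theta> t = c2 t + c1 t * \<theta> t + g t powr p" by (simp add: algebra_simps)
    then show "ennreal ((c1 t + c2 t * \<theta> t) * t powr \<beta>)
      = ennreal ((c2 t + c1 t * \<theta> t) * t powr \<beta>) + ennreal (g t powr p) * ennreal (t powr \<beta>)"
      using c0 \<theta>_pos[OF t] by (simp add: distrib_right ennreal_mult ennreal_plus)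
  qed
  also have "\<dots> = ?D + ?K"
    by (rule radN_add) measurable
  finally have split: "?A c1 + ?B c2 = ?D + ?K"
    using AB[of c1 c2] c0 by simp
  \<comment> \<open>Finiteness of the multiple to be cancelled: where
    \<open>|1 - \<theta>| \<ge> \<delta>\<close>, the power \<open>p - 1\<close> is at most
    \<open>1 / \<delta>\<close> times the power \<open>p\<close>, which is integrable.\<close>
  have "?D \<le> radN d m (\<lambda>t. ennreal (1 / \<delta>) * ennreal (\<bar>1 - \<theta> t\<bar> powr p * t powr \<beta>))"
  proof (rule radN_mono)
    fix t :: real assume t: "t > 0"
    have "c2 t + c1 t * \<theta> t \<le> 1 / \<delta> * \<bar>1 - \<theta> t\<bar> powr p"
    proof (cases "\<delta> \<le> \<bar>1 - \<theta> t\<bar>")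
      case True
      have "c2 t + c1 t * \<theta> t \<le> \<bar>1 - \<theta> t\<bar> powr (p - 1)"
        using True \<theta>_pos[OF t] mult_left_mono[of "\<theta> t" 1 "\<bar>1 - \<theta> t\<bar> powr (p - 1)"] by (auto simp: c1_def c2_def g_def)
      also have "\<dots> \<le> \<bar>1 - \<theta> t\<bar> powr (p - 1) * (\<bar>1 - \<theta> t\<bar> / \<delta>)"
        using True \<delta> mult_left_mono[of 1 "\<bar>1 - \<theta> t\<bar> / \<delta>" "\<bar>1 - \<theta> t\<bar> powr (p - 1)"] by simp
      also have "\<dots> = 1 / \<delta> * \<bar>1 - \<theta> t\<bar> powr p"
        using True \<delta> by (simp add: powr_diff)
      finally show ?thesis .
    next
      case False
      then have "g t = 0" by (simp add: g_def)
      then show ?thesis using \<delta> by (simp add: c1_def c2_def)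
    qed
    then have "(c2 t + c1 t * \<theta> t) * t powr \<beta> \<le> 1 / \<delta> * \<bar>1 - \<theta> t\<bar> powr p * t powr \<beta>"
      by (rule mult_right_mono) simp
    then show "ennreal ((c2 t + c1 t * \<theta> t) * t powr \<beta>) \<le> ennreal (1 / \<delta>) * ennreal (\<bar>1 - \<theta> t\<bar> powr p * t powr \<beta>)"
      using \<delta> by (subst ennreal_mult[symmetric]) (auto intro: ennreal_leI simp: mult.assoc)
  qed
  also have "\<dots> = ennreal (1 / \<delta>) * ennreal K"
    unfolding radN_eq_K[OF dim, symmetric] by (rule radN_cmult) measurable
  also have "\<dots> < \<infinity>" by (simp add: ennreal_mult_less_top)
  finally have D: "?R * ?D < \<infinity>" using R by (simp add: ennreal_mult_less_top)
  have "?R * ?D + ?R * ?K \<le> ?R * ?D + (\<integral>\<^sup>+ x. (\<integral>\<^sup>+ y. ?I x y \<partial>lborel) \<partial>lborel)"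
    using main unfolding split using AB[of c2 c1] c0 by (simp add: distrib_left add.commute)
  then show ?thesis using D by (auto simp: ennreal_add_left_cancel_le less_top)
qed


text \<open>At each truncation level Hoelder's inequality is applied with the truncated second
  function \<open>g n\<close>, so that it starts from exactly the integral bounded in
  \<open>Hardy_truncated\<close>. The truncated constants then increase to \<open>K\<close>.\<close>

lemma Hardy_inequality:
  fixes u :: "'a::euclidean_space \<Rightarrow> real"
  assumes dim: "d = DIM('a)" and u [measurable]: "u \<in> borel_measurable borel"
    and R: "RHS s p q \<alpha> \<beta> u < \<infinity>"
  shows "Cconst d s p q \<alpha> \<beta> * RHS s p q \<alpha> \<beta> u \<le> LHS s p q \<alpha> \<beta> u"
proof -
  let ?R = "RHS s p q \<alpha> \<beta> u" and ?L = "LHS s p q \<alpha> \<beta> u"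
  define g where "g n t = (if 1 / real (Suc n) \<le> \<bar>1 - \<theta> t\<bar> then \<bar>1 - \<theta> t\<bar> else 0)" for n t
  have g_meas [measurable]: "g n \<in> borel_measurable borel" for n
    unfolding g_def by measurable
  have g0: "g n t \<ge> 0" for n t by (simp add: g_def)
  define N where "N n = radN d m (\<lambda>t. ennreal (g n t powr p) * ennreal (t powr \<beta>))" for n
  have N_le: "N n \<le> ennreal K" for n
    unfolding N_def radN_eq_K[OF dim, symmetric]
  proof (rule radN_mono)
    fix t :: real
    have "g n t powr p * t powr \<beta> \<le> \<bar>1 - \<theta> t\<bar> powr p * t powr \<beta>"
      using p by (intro mult_right_mono powr_mono2) (auto simp: g_def)
    from ennreal_leI[OF this]
    show "ennreal (g n t powr p) * ennreal (t powr \<beta>) \<le> ennreal (\<bar>1 - \<theta> t\<bar> powr p * t powr \<beta>)"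
      by (subst ennreal_mult[symmetric]) auto
  qed
  define k where "k n = enn2real (N n)" for n
  have N: "N n = ennreal (k n)" "k n \<ge> 0" for n
  proof -
    have "N n < top" using N_le[of n] by (rule le_less_trans) simp
    then show "N n = ennreal (k n)" by (simp add: k_def)
    show "k n \<ge> 0" by (simp add: k_def)
  qed
  have step: "ennreal (k n powr (q / p)) * ?R \<le> ?L" for n
  proof (cases "k n > 0")
    case False
    then have "k n = 0" using N(2)[of n] by simp
    then show ?thesis by simp
  next
    case k: True
    let ?F = "\<lambda>x. \<integral>\<^sup>+ y. ennreal (\<bar>u x - u y\<bar> powr p / norm (x - y) powr (real DIM('a) + s * p) * norm y powr \<beta>) \<partial>lborel"
    let ?I = "\<lambda>x y. ennreal (\<bar>u x - u y\<bar> powr q * g n (norm y / norm x) powr (p - q)) * W x y"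
    have "?R * ennreal (k n) \<le> (\<integral>\<^sup>+ x. (\<integral>\<^sup>+ y. ?I x y \<partial>lborel) \<partial>lborel)"
      using Hardy_truncated[OF dim u R, of "1 / real (Suc n)"] N(1)[of n]
      by (simp add: N_def g_def)
    also have "\<dots> \<le> (\<integral>\<^sup>+ x. epowr (?F x) (q / p) * ennreal (norm x powr \<alpha>) * ennreal (k n powr (1 - q / p)) \<partial>lborel)"
    proof (rule nn_integral_mono_AE, use AE_lborel_nonzero in eventually_elim)
      fix x :: 'a assume x: "x \<noteq> 0"
      let ?r = "norm x"
      let ?w = "\<lambda>y. ennreal (norm (x - y) powr (- m)) * ennreal (norm y powr \<beta>)"
      \<comment> \<open>The integral of the second Hoelder function to the power \<open>p\<close>
        scales like \<open>|x| powr (\<beta> - s p)\<close>. Its power \<open>1 - q / p\<close>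
        times \<open>|x| powr \<kappa>\<close> is \<open>|x| powr \<alpha>\<close>, which explains
        the value of \<open>\<kappa>\<close>.\<close>
      have G: "(\<integral>\<^sup>+ y. ennreal (g n (norm y / ?r) powr p) * ?w y \<partial>lborel) = ennreal (?r powr (\<beta> - s * p) * k n)"
        using nn_integral_kernel_ratio[OF dim x, of "\<lambda>t. ennreal (g n t powr p)"] N(1)[of n]
        by (simp add: N_def ennreal_mult')
      have F: "(\<integral>\<^sup>+ y. ennreal (\<bar>u x - u y\<bar> powr p) * ?w y \<partial>lborel) = ?F x"
        unfolding dim[symmetric] by (intro nn_integral_cong)
          (simp add: m_def powr_minus divide_inverse ennreal_mult'[symmetric] mult.assoc del: minus_add_distrib)
      have "(\<integral>\<^sup>+ y. ?I x y \<partial>lborel)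
          = (\<integral>\<^sup>+ y. (ennreal (\<bar>u x - u y\<bar> powr q * g n (norm y / ?r) powr (p - q)) * ?w y) * ennreal (?r powr \<kappa>) \<partial>lborel)"
        by (simp only: W_def mult.assoc)
      also have "\<dots> = (\<integral>\<^sup>+ y. ennreal (\<bar>u x - u y\<bar> powr q * g n (norm y / ?r) powr (p - q)) * ?w y \<partial>lborel) * ennreal (?r powr \<kappa>)"
        by (rule nn_integral_multc) measurable
      also have "\<dots> \<le> (epowr (?F x) (q / p) * ennreal ((?r powr (\<beta> - s * p) * k n) powr (1 - q / p))) * ennreal (?r powr \<kappa>)"
        unfolding F[symmetric] using q q0 k x g0
        by (intro mult_right_mono Hoelder_weighted G) auto
      also have "ennreal ((?r powr (\<beta> - s * p) * k n) powr (1 - q / p)) * ennreal (?r powr \<kappa>)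
          = ennreal (?r powr \<alpha>) * ennreal (k n powr (1 - q / p))"
      proof -
        have "(?r powr (\<beta> - s * p) * k n) powr (1 - q / p) * ?r powr \<kappa> = ?r powr ((\<beta> - s * p) * (1 - q / p) + \<kappa>) * k n powr (1 - q / p)"
          using k by (simp add: powr_mult powr_powr powr_add)
        also have "(\<beta> - s * p) * (1 - q / p) + \<kappa> = \<alpha>"
          by (simp add: \<kappa>_def algebra_simps)
        finally show ?thesis by (simp add: ennreal_mult'[symmetric])
      qed
      then have "(epowr (?F x) (q / p) * ennreal ((?r powr (\<beta> - s * p) * k n) powr (1 - q / p))) * ennreal (?r powr \<kappa>)
          = epowr (?F x) (q / p) * ennreal (?r powr \<alpha>) * ennreal (k n powr (1 - q / p))"
        by (simp only: mult.assoc)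
      finally show "(\<integral>\<^sup>+ y. ?I x y \<partial>lborel) \<le> epowr (?F x) (q / p) * ennreal (?r powr \<alpha>) * ennreal (k n powr (1 - q / p))" .
    qed
    also have "\<dots> = ?L * ennreal (k n powr (1 - q / p))"
      unfolding LHS_def by (rule nn_integral_multc) measurable
    \<comment> \<open>This multiplication leaves \<open>k n powr (q / p)\<close> on the left and
      removes the Hoelder factor on the right.\<close>
    finally have "ennreal (k n powr (q / p - 1)) * (?R * ennreal (k n)) \<le> ennreal (k n powr (q / p - 1)) * (?L * ennreal (k n powr (1 - q / p)))"
      by (rule mult_left_mono) simp
    moreover have "ennreal (k n powr (q / p - 1)) * ennreal (k n) = ennreal (k n powr (q / p))"
      using k by (simp add: ennreal_mult'[symmetric] powr_diff)
    moreover have "ennreal (k n powr (q / p - 1)) * ennreal (k n powr (1 - q / p)) = 1"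
      using k by (simp add: ennreal_mult'[symmetric] powr_add[symmetric])
    ultimately show ?thesis
      by (simp add: mult.left_commute[of _ ?R] mult.left_commute[of _ ?L] mult.commute[of _ ?R])
  qed
  \<comment> \<open>Monotone convergence; at points with \<open>\<theta> t = 1\<close> both the
    truncated and the full integrand are 0.\<close>
  have "(\<lambda>n. N n) \<longlonglongrightarrow> radN d m (\<lambda>t. ennreal (\<bar>1 - \<theta> t\<bar> powr p * t powr \<beta>))"
    unfolding N_def radN_def
  proof (rule nn_integral_LIMSEQ)
    show "incseq (\<lambda>n t. ennreal (g n t powr p) * ennreal (t powr \<beta>) * ennreal (t powr (real d - 1)) * Psi d m t * indicator {0<..} t)"
    proof (rule incseq_SucI, rule le_funI)
      fix n t
      have "1 / real (Suc (Suc n)) \<le> 1 / real (Suc n)" by (simp add: field_simps)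
      then have "g n t \<le> g (Suc n) t" by (auto simp: g_def)
      then have "ennreal (g n t powr p) \<le> ennreal (g (Suc n) t powr p)"
        using p g0 by (intro ennreal_leI powr_mono2) auto
      then show "ennreal (g n t powr p) * ennreal (t powr \<beta>) * ennreal (t powr (real d - 1)) * Psi d m t * indicator {0<..} t
        \<le> ennreal (g (Suc n) t powr p) * ennreal (t powr \<beta>) * ennreal (t powr (real d - 1)) * Psi d m t * indicator {0<..} t"
        by (intro mult_right_mono) auto
    qed
    fix t :: real
    have "\<forall>\<^sub>F n in sequentially. g n t = \<bar>1 - \<theta> t\<bar>"
    proof (cases "\<theta> t = 1")
      case False
      then have "\<bar>1 - \<theta> t\<bar> > 0" by simp
      then obtain n0 where n0: "inverse (real (Suc n0)) < \<bar>1 - \<theta> t\<bar>"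
        using reals_Archimedean by blast
      have "g n t = \<bar>1 - \<theta> t\<bar>" if "n \<ge> n0" for n
      proof -
        have "1 / real (Suc n) \<le> inverse (real (Suc n0))"
          using that by (simp add: divide_inverse[symmetric] inverse_eq_divide frac_le)
        then show ?thesis using n0 by (simp add: g_def)
      qed
      then show ?thesis by (auto simp: eventually_sequentially)
    qed (simp add: g_def)
    then have "\<forall>\<^sub>F n in sequentially.
        ennreal (g n t powr p) * ennreal (t powr \<beta>) * ennreal (t powr (real d - 1)) * Psi d m t * indicator {0<..} t
        = ennreal (\<bar>1 - \<theta> t\<bar> powr p * t powr \<beta>) * ennreal (t powr (real d - 1)) * Psi d m t * indicator {0<..} t"
      by eventually_elim (simp add: ennreal_mult')
    then show "(\<lambda>n. ennreal (g n t powr p) * ennreal (t powr \<beta>) * ennreal (t powr (real d - 1)) * Psi d m t * indicator {0<..} t)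
      \<longlonglongrightarrow> ennreal (\<bar>1 - \<theta> t\<bar> powr p * t powr \<beta>) * ennreal (t powr (real d - 1)) * Psi d m t * indicator {0<..} t"
      by (rule tendsto_eventually)
  qed measurable
  then have "(\<lambda>n. ennreal (k n)) \<longlonglongrightarrow> ennreal K"
    by (simp add: N(1) radN_eq_K[OF dim])
  then have "k \<longlonglongrightarrow> K"
    using N(2) K_nonneg by (simp add: tendsto_ennreal_iff)
  then have "(\<lambda>n. k n powr (q / p)) \<longlonglongrightarrow> K powr (q / p)"
    by (intro tendsto_powr' tendsto_const) (simp_all add: p q0 N(2))
  then have "(\<lambda>n. ennreal (k n powr (q / p) * enn2real ?R)) \<longlonglongrightarrow> ennreal (K powr (q / p) * enn2real ?R)"
    by (intro tendsto_ennrealI tendsto_mult tendsto_const)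
  moreover have "ennreal (k n powr (q / p) * enn2real ?R) \<le> ?L" for n
    using step[of n] R by (simp add: ennreal_mult' less_top)
  ultimately have "ennreal (K powr (q / p) * enn2real ?R) \<le> ?L"
    by (intro LIMSEQ_le_const2[where X = "\<lambda>n. ennreal (k n powr (q / p) * enn2real ?R)"]) auto
  then show ?thesis
    using R by (simp add: Cconst_eq[OF dim] ennreal_mult' less_top)
qed

end

section \<open>Truncated powers as test functions\<close>

text \<open>\<open>C1c\<close> speaks of derivatives on \<open>U\<close> only; a point outside
  \<open>U\<close> has a neighbourhood disjoint from the support.\<close>

lemma C1c_isCont:
  assumes "C1c U u" 
  shows "isCont u x"
proof (cases "x \<in> U")
  case True
  then show ?thesis
    using assms unfolding C1c_def by (blast intro: has_derivative_continuous)
next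
  case False
  let ?S = "closure {x. u x \<noteq> 0}"
  have x: "x \<in> - ?S" using False assms by (auto simp: C1c_def)
  have "u y = 0" if "y \<in> - ?S" for y
    using that closure_subset[of "{x. u x \<noteq> 0}"] by blast
  then have "\<forall>\<^sub>F y in nhds x. u y = 0"
    by (rule eventually_nhds_in_open[OF open_Compl[OF closed_closure] x, THEN eventually_mono])
  then have "isCont u x \<longleftrightarrow> isCont (\<lambda>_. 0 :: real) x"
    by (rule isCont_cong)
  then show ?thesis by simp
qed

lemma C1c_borel_measurable:
  assumes "C1c U u"
  shows "u \<in> borel_measurable borel"
  by (intro borel_measurable_continuous_onI continuous_at_imp_continuous_on ballI C1c_isCont[OF assms])

lemma C1c_bounded:
  fixes u :: "'a::euclidean_space \<Rightarrow> real"
  assumes "C1c U u"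
  obtains B where "B \<ge> 0" "\<And>x. \<bar>u x\<bar> \<le> B"
proof -
  let ?S = "closure {x. u x \<noteq> 0}"
  have "compact ?S" using assms by (simp add: C1c_def)
  moreover have "continuous_on ?S u"
    by (intro continuous_at_imp_continuous_on ballI C1c_isCont[OF assms])
  ultimately have "bounded (u ` ?S)" by (intro compact_imp_bounded compact_continuous_image)
  then obtain B where B: "\<And>x. x \<in> ?S \<Longrightarrow> \<bar>u x\<bar> \<le> B" by (auto simp: bounded_iff)
  have "\<bar>u x\<bar> \<le> max 0 B" for x
  proof (cases "u x = 0")
    case False
    then have "x \<in> ?S" using closure_subset[of "{x. u x \<noteq> 0}"] by auto
    then show ?thesis using B[of x] by simp
  qed simp
  then show thesis by (intro that[of "max 0 B"]) auto
qed

text \<open>The choice of \<open>U\<close> enters here. If the Hardy exponent is below the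
  dimension, the weight is integrable on bounded sets; if it is above, the support avoids a ball
  around 0 and the weight is integrable outside that ball.\<close>

lemma C1c_RHS_finite:
  fixes u :: "'a::euclidean_space \<Rightarrow> real"
  assumes u: "C1c U u" and q: "q > 0"
    and a: "s * q - \<alpha> - q * \<beta> / p \<noteq> real DIM('a)"
    and U: "U = (if s * q - \<alpha> - q * \<beta> / p < real DIM('a) then UNIV else UNIV - {0})"
  shows "RHS s p q \<alpha> \<beta> u < \<infinity>"
proof -
  define a where "a = s * q - \<alpha> - q * \<beta> / p"
  let ?S = "closure {x. u x \<noteq> 0}"
  have S: "compact ?S" "?S \<subseteq> U" using u by (auto simp: C1c_def)
  have supp: "x \<in> ?S" if "u x \<noteq> 0" for x
    using that closure_subset[of "{x. u x \<noteq> 0}"] by auto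
  obtain B where B: "B \<ge> 0" "\<And>x. \<bar>u x\<bar> \<le> B" using C1c_bounded[OF u] by blast
  have "\<exists>I. I \<in> sets borel \<and> (\<forall>x. u x \<noteq> 0 \<longrightarrow> norm x \<in> I) \<and>
      (\<integral>\<^sup>+ (x::'a). ennreal (norm x powr (- a)) * indicator I (norm x) \<partial>lborel) < \<infinity>"
  proof (cases "a < real DIM('a)")
    case True
    obtain R where R: "R > 0" "\<And>x. x \<in> ?S \<Longrightarrow> norm x \<le> R"
      using compact_imp_bounded[OF S(1)] by (auto simp: bounded_pos)
    have "(\<integral>\<^sup>+ (x::'a). ennreal (norm x powr (- a)) * indicator {..R} (norm x) \<partial>lborel) < \<infinity>"
      using True R by (intro nn_integral_norm_powr_le_finite) auto
    then show ?thesis using R supp by (intro exI[of _ "{..R}"]) auto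
  next
    case False
    then have "0 \<notin> ?S" using S U by (auto simp: a_def)
    moreover have "closed ?S" by simp
    ultimately obtain e where e: "e > 0" "\<And>x. x \<in> ?S \<Longrightarrow> e \<le> dist 0 x"
      using separate_point_closed[of ?S 0] by blast
    have "(\<integral>\<^sup>+ (x::'a). ennreal (norm x powr (- a)) * indicator {e..} (norm x) \<partial>lborel) < \<infinity>"
      using False a e by (intro nn_integral_norm_powr_ge_finite) (auto simp: a_def)
    then show ?thesis using e supp by (intro exI[of _ "{e..}"]) auto
  qed
  then obtain I where I [measurable]: "I \<in> sets borel" and supp_I: "\<And>x. u x \<noteq> 0 \<Longrightarrow> norm x \<in> I"
    and fin: "(\<integral>\<^sup>+ (x::'a). ennreal (norm x powr (- a)) * indicator I (norm x) \<partial>lborel) < \<infinity>" by blast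
  have "RHS s p q \<alpha> \<beta> u \<le> (\<integral>\<^sup>+ (x::'a). ennreal (B powr q) * (ennreal (norm x powr (- a)) * indicator I (norm x)) \<partial>lborel)"
    unfolding RHS_def a_def[symmetric]
  proof (rule nn_integral_mono)
    fix x :: 'a
    show "ennreal (\<bar>u x\<bar> powr q / norm x powr a) \<le> ennreal (B powr q) * (ennreal (norm x powr (- a)) * indicator I (norm x))"
    proof (cases "u x = 0")
      case False
      have "\<bar>u x\<bar> powr q \<le> B powr q" using B q by (intro powr_mono2) auto
      then have "\<bar>u x\<bar> powr q / norm x powr a \<le> B powr q * norm x powr (- a)"
        by (simp add: powr_minus divide_inverse mult_right_mono)
      then show ?thesis
        using supp_I[OF False] by (simp add: ennreal_mult'[symmetric] ennreal_leI)
    qed simp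
  qed
  also have "\<dots> = ennreal (B powr q) * (\<integral>\<^sup>+ (x::'a). ennreal (norm x powr (- a)) * indicator I (norm x) \<partial>lborel)"
    by (rule nn_integral_cmult) measurable
  also have "\<dots> < \<infinity>" using fin by (simp add: ennreal_mult_less_top)
  finally show ?thesis .
qed

text \<open>The squared truncated parabola: squaring removes the corner at
  \<open>|\<tau>| = 1\<close>, which is all the smoothness that \<open>C1c\<close> requires.\<close>

definition cutoff :: "real \<Rightarrow> real" where "cutoff \<tau> = (max 0 (1 - \<tau>\<^sup>2))\<^sup>2"
definition cutoff' :: "real \<Rightarrow> real" where "cutoff' \<tau> = - 4 * \<tau> * max 0 (1 - \<tau>\<^sup>2)"

lemma DERIV_max_0_square: "((\<lambda>y::real. (max 0 y)\<^sup>2) has_real_derivative 2 * max 0 y) (at y)"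
proof -
  consider "y > 0" | "y < 0" | "y = 0" by linarith
  then show ?thesis
  proof cases
    case 1
    have "((\<lambda>y::real. y\<^sup>2) has_real_derivative 2 * max 0 y) (at y)"
      using 1 by (auto intro!: derivative_eq_intros)
    then show ?thesis
      by (rule has_field_derivative_transform_within_open[where S = "{0<..}"]) (use 1 in auto)
  next
    case 2
    have "((\<lambda>y::real. 0) has_real_derivative 2 * max 0 y) (at y)"
      using 2 by (auto intro!: derivative_eq_intros)
    then show ?thesis
      by (rule has_field_derivative_transform_within_open[where S = "{..<0}"]) (use 2 in auto)
  next
    case 3
    have "((\<lambda>h::real. max 0 h) \<longlongrightarrow> max 0 0) (at 0)"
      by (intro tendsto_intros)
    moreover have "\<forall>\<^sub>F h::real in at 0. max 0 h = (max 0 h)\<^sup>2 / h"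
      by (auto simp: eventually_at_filter max_def power2_eq_square)
    ultimately have "((\<lambda>h::real. (max 0 h)\<^sup>2 / h) \<longlongrightarrow> 0) (at 0)"
      by (simp add: Lim_transform_eventually)
    then show ?thesis unfolding 3 has_field_derivative_iff by simp
  qed
qed

lemma DERIV_cutoff: "(cutoff has_real_derivative cutoff' \<tau>) (at \<tau>)"
proof -
  have "((\<lambda>\<tau>. (max 0 (1 - \<tau>\<^sup>2))\<^sup>2) has_real_derivative 2 * max 0 (1 - \<tau>\<^sup>2) * (- (2 * \<tau>))) (at \<tau>)"
    by (rule DERIV_chain2[where f = "\<lambda>y. (max 0 y)\<^sup>2", OF DERIV_max_0_square]) (auto intro!: derivative_eq_intros)
  then show ?thesis
    by (simp add: cutoff_def[abs_def] cutoff'_def mult_ac)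
qed

lemma continuous_on_cutoff [continuous_intros]:
  "continuous_on A f \<Longrightarrow> continuous_on A (\<lambda>x. cutoff (f x))"
  "continuous_on A f \<Longrightarrow> continuous_on A (\<lambda>x. cutoff' (f x))"
  unfolding cutoff_def cutoff'_def by (intro continuous_intros; assumption)+

lemma cutoff_measurable [measurable]: "cutoff \<in> borel_measurable borel"
  by (intro borel_measurable_continuous_onI continuous_intros)

lemma cutoff_nonneg: "cutoff \<tau> \<ge> 0"
  by (simp add: cutoff_def)

lemma cutoff_eq_0: "\<bar>\<tau>\<bar> \<ge> 1 \<Longrightarrow> cutoff \<tau> = 0" "\<bar>\<tau>\<bar> \<ge> 1 \<Longrightarrow> cutoff' \<tau> = 0"
proof -
  assume "\<bar>\<tau>\<bar> \<ge> 1"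
  then have "1 \<le> \<tau>\<^sup>2" by (simp add: abs_le_square_iff[of 1, simplified])
  then show "cutoff \<tau> = 0" "cutoff' \<tau> = 0" by (simp_all add: cutoff_def cutoff'_def)
qed

lemma cutoff_le_1: "cutoff \<tau> \<le> 1"
  by (simp add: cutoff_def power_le_one)

lemma cutoff_Lipschitz: "\<bar>cutoff a - cutoff b\<bar> \<le> 4 * \<bar>a - b\<bar>"
proof -
  have "norm (cutoff' z) \<le> 4" for z
  proof (cases "\<bar>z\<bar> \<ge> 1")
    case False
    have "\<bar>z\<bar> * \<bar>max 0 (1 - z\<^sup>2)\<bar> \<le> 1 * 1"
      using False by (intro mult_mono) auto
    then show ?thesis by (simp add: cutoff'_def abs_mult)
  qed (simp add: cutoff_eq_0)
  then have "norm (cutoff a - cutoff b) \<le> 4 * norm (a - b)"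
    by (intro field_differentiable_bound[of UNIV cutoff cutoff']) (auto intro: DERIV_cutoff)
  then show ?thesis by simp
qed

text \<open>The left-hand side vanishes unless \<open>|a / N| \<le> 1 + |l|\<close>, which the exponential factors encode.\<close>

lemma cutoff_log_difference:
  fixes a b N \<kappa> :: real
  assumes N: "N \<ge> 1" and \<kappa>: "\<kappa> \<ge> 0"
  shows "\<bar>cutoff (a / N) - cutoff ((a + l) / N)\<bar> \<le> 4 * \<bar>l\<bar> / N * exp (\<kappa> * \<bar>l\<bar>) * exp (\<kappa> * (1 - \<bar>a / N\<bar>))"
proof (cases "\<bar>a / N\<bar> \<le> 1 + \<bar>l\<bar>")
  case True
  have "\<bar>cutoff (a / N) - cutoff ((a + l) / N)\<bar> \<le> 4 * \<bar>a / N - (a + l) / N\<bar>"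
    by (rule cutoff_Lipschitz)
  also have "a / N - (a + l) / N = - (l / N)"
    by (simp add: add_divide_distrib)
  also have "4 * \<bar>- (l / N)\<bar> = 4 * \<bar>l\<bar> / N"
    using N by simp
  also have "\<dots> \<le> 4 * \<bar>l\<bar> / N * exp (\<kappa> * \<bar>l\<bar> + \<kappa> * (1 - \<bar>a / N\<bar>))"
  proof -
    have "0 \<le> \<kappa> * (1 + \<bar>l\<bar> - \<bar>a / N\<bar>)" using True \<kappa> by simp
    then have "1 \<le> exp (\<kappa> * \<bar>l\<bar> + \<kappa> * (1 - \<bar>a / N\<bar>))" by (simp add: algebra_simps)
    then show ?thesis using N mult_left_mono[of 1 _ "4 * \<bar>l\<bar> / N"] by simp
  qed
  finally show ?thesis by (simp add: exp_add mult.assoc)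
next
  case False
  \<comment> \<open>With \<open>|a / N| > 1 + |l|\<close>, a shift by \<open>l / N\<close> cannot
    bring the argument back into the support, so both cutoff values vanish.\<close>
  have "\<bar>l / N\<bar> \<le> \<bar>l\<bar>" using N mult_left_mono[of 1 N "\<bar>l\<bar>"] by (simp add: divide_le_eq)
  moreover have "\<bar>a / N\<bar> \<le> \<bar>(a + l) / N\<bar> + \<bar>l / N\<bar>"
    using abs_triangle_ineq4[of "(a + l) / N" "l / N"] by (simp add: add_divide_distrib)
  ultimately have "\<bar>a / N\<bar> \<ge> 1" "\<bar>(a + l) / N\<bar> \<ge> 1" using False by linarith+
  then show ?thesis using N by (simp add: cutoff_eq_0)
qed

text \<open>The scale-invariant measure \<open>|x| powr (- d) dx\<close> is, radially, Lebesgue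
  measure in \<open>ln |x|\<close>; the rescaling by \<open>N\<close> is the source of the linear
  growth of the Hardy integral.\<close>

lemma nn_integral_log_scaled:
  fixes f :: "real \<Rightarrow> ennreal" and N :: real
  assumes [measurable]: "f \<in> borel_measurable borel" and N: "N > 0"
  shows "(\<integral>\<^sup>+ (x::'a::euclidean_space). ennreal (norm x powr (- real DIM('a))) * f (ln (norm x) / N) \<partial>lborel)
    = ennreal (real DIM('a) * unit_ball_vol (DIM('a)) * N) * (\<integral>\<^sup>+ z. f z \<partial>lborel)"
proof -
  let ?c = "ennreal (real DIM('a) * unit_ball_vol (DIM('a)))"
  have "(\<integral>\<^sup>+ (x::'a). ennreal (norm x powr (- real DIM('a))) * f (ln (norm x) / N) \<partial>lborel)
      = (\<integral>\<^sup>+ t\<in>{0<..}. ennreal (t powr (- real DIM('a))) * f (ln t / N)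
          * ennreal (real DIM('a) * unit_ball_vol (DIM('a)) * t ^ (DIM('a) - 1)) \<partial>lborel)"
    by (rule nn_integral_radial[of "\<lambda>t. ennreal (t powr (- real DIM('a))) * f (ln t / N)"]) measurable
  also have "\<dots> = (\<integral>\<^sup>+ t\<in>{0<..}. ?c * (f (ln t / N) * ennreal (1 / t)) \<partial>lborel)"
  proof (rule nn_integral_cong)
    fix t :: real
    have "ennreal (t powr (- real DIM('a))) * ennreal (real DIM('a) * unit_ball_vol (DIM('a)) * t ^ (DIM('a) - 1)) = ?c * ennreal (1 / t)"
      if "t > 0"
      using radial_weight_eq[OF that, of "- real DIM('a)", where 'a = 'a] that by (simp add: powr_minus_divide)
    then show "ennreal (t powr (- real DIM('a))) * f (ln t / N)
          * ennreal (real DIM('a) * unit_ball_vol (DIM('a)) * t ^ (DIM('a) - 1)) * indicator {0<..} t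
        = ?c * (f (ln t / N) * ennreal (1 / t)) * indicator {0<..} t"
      by (cases "t > 0") (simp_all add: mult_ac)
  qed
  also have "\<dots> = (\<integral>\<^sup>+ y. ?c * (f (ln (exp y) / N) * ennreal (1 / exp y)) * ennreal (exp y) \<partial>lborel)"
    by (rule nn_integral_exp_substitution) measurable
  also have "\<dots> = (\<integral>\<^sup>+ y. ?c * f (y / N) \<partial>lborel)"
    by (intro nn_integral_cong) (simp add: mult.assoc ennreal_mult'[symmetric])
  also have "\<dots> = ennreal N * (\<integral>\<^sup>+ z. ?c * f z \<partial>lborel)"
    using N by (subst nn_integral_real_affine[where c = N and t = 0]) auto
  also have "\<dots> = ennreal N * (?c * (\<integral>\<^sup>+ z. f z \<partial>lborel))"
    by (subst nn_integral_cmult) auto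
  finally show ?thesis
    using N by (simp add: ennreal_mult' mult_ac)
qed

lemma nn_integral_exp_abs_finite:
  fixes a :: real
  assumes "a > 0"
  shows "(\<integral>\<^sup>+ z. ennreal (exp (a * (1 - \<bar>z\<bar>)))  \<partial>lborel) < \<infinity>"
proof -
  let ?f = "\<lambda>z::real. ennreal (exp a) * (ennreal (exp (- a * z)) * indicator {0..} z)"
  have fin: "(\<integral>\<^sup>+ z. ?f z \<partial>lborel) < \<infinity>"
    using set_nn_integral_finite_if_has_integral[OF _ has_integral_exp_minus_to_infinity[OF assms, of 0]]
    by (subst nn_integral_cmult) (auto simp: ennreal_mult_less_top)
  have "(\<integral>\<^sup>+ z. ennreal (exp (a * (1 - \<bar>z\<bar>))) \<partial>lborel) \<le> (\<integral>\<^sup>+ z. ?f z + ?f (- z) \<partial>lborel)"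
  proof (rule nn_integral_mono)
    fix z :: real
    have "ennreal (exp (a * (1 - \<bar>z\<bar>))) = ennreal (exp a) * ennreal (exp (- a * \<bar>z\<bar>))"
      by (simp add: ennreal_mult'[symmetric] exp_add[symmetric] algebra_simps)
    also have "\<dots> \<le> ?f z + ?f (- z)"
      by (cases "z \<ge> 0") (auto simp: add_increasing add_increasing2)
    finally show "ennreal (exp (a * (1 - \<bar>z\<bar>))) \<le> ?f z + ?f (- z)" .
  qed
  also have "\<dots> = (\<integral>\<^sup>+ z. ?f z \<partial>lborel) + (\<integral>\<^sup>+ z. ?f (- z) \<partial>lborel)"
    by (rule nn_integral_add) measurable
  also have "(\<integral>\<^sup>+ z. ?f (- z) \<partial>lborel) = (\<integral>\<^sup>+ z. ?f z \<partial>lborel)"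
    by (subst (2) nn_integral_real_affine[where c = "-1" and t = 0]) auto
  finally show ?thesis using fin by (auto intro: le_less_trans)
qed

section \<open>Sharpness\<close>

text \<open>After division by \<open>x + y\<close> both arguments lie in \<open>[0,1]\<close>, where
  \<open>z \<le> z powr r\<close>, and they add up to 1.\<close>

lemma powr_subadditive:
  fixes x y r :: real
  assumes "x \<ge> 0" "y \<ge> 0" "0 \<le> r" "r \<le> 1"
  shows "(x + y) powr r \<le> x powr r + y powr r"
proof (cases "x + y = 0")
  case False
  then have xy: "x + y > 0" using assms by simp
  have le: "z / (x + y) \<le> (z / (x + y)) powr r" if "0 \<le> z" "z \<le> x + y" for z
    using powr_mono'[of r 1 "z / (x + y)"] that xy assms by (cases "z = 0") auto
  have "1 = x / (x + y) + y / (x + y)" using xy by (simp add: add_divide_distrib[symmetric])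
  also have "\<dots> \<le> (x / (x + y)) powr r + (y / (x + y)) powr r"
    using assms by (intro add_mono le) auto
  also have "\<dots> = (x powr r + y powr r) / (x + y) powr r"
    using assms by (simp add: powr_divide add_divide_distrib)
  finally show ?thesis using xy by (simp add: pos_le_divide_eq)
qed (use assms in auto)

lemma epowr_le_ennreal:
  assumes "F \<le> ennreal c" "c \<ge> 0" "a \<ge> 0"
  shows "epowr F a \<le> ennreal (c powr a)"
proof -
  have "F \<noteq> \<infinity>" using assms(1) by (auto simp: top_unique)
  moreover have "enn2real F \<le> c" using assms by (simp add: enn2real_leI)
  ultimately show ?thesis
    using assms by (auto simp: epowr_def intro!: ennreal_leI powr_mono2)
qed

lemma nn_integral_cutoff_powr:
  assumes q: "q > 0"
  obtains I where "I > 0" "(\<integral>\<^sup>+ z. ennreal (cutoff z powr q) \<partial>lborel) = ennreal I"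
proof -
  let ?I = "\<integral>\<^sup>+ z. ennreal (cutoff z powr q) \<partial>lborel"
  have "?I \<le> (\<integral>\<^sup>+ (z::real). indicator {-1..1} z \<partial>lborel)"
  proof (rule nn_integral_mono)
    fix z :: real
    have "cutoff z powr q \<le> 1 powr q"
      using q by (intro powr_mono2 cutoff_le_1 cutoff_nonneg) auto
    then show "ennreal (cutoff z powr q) \<le> indicator {-1..1} z"
      using cutoff_eq_0(1)[of z] by (auto simp: indicator_def abs_le_iff)
  qed
  also have "\<dots> < \<infinity>" by simp
  finally have fin: "?I < \<infinity>" .
  \<comment> \<open>The value \<open>9/16\<close> is \<open>cutoff (1/2)\<close>, a lower bound on
    \<open>[0, 1/2]\<close>. Positivity of the integral is needed to divide by it later.\<close>
  have "0 < ennreal ((9/16) powr q) * ennreal (1/2)"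
    by (subst ennreal_mult'[symmetric]) simp_all
  also have "\<dots> = (\<integral>\<^sup>+ z. ennreal ((9/16) powr q) * indicator {0..1/2::real} z \<partial>lborel)"
    by (subst nn_integral_cmult_indicator) auto
  also have "\<dots> \<le> ?I"
  proof (rule nn_integral_mono)
    fix z :: real
    have "(9/16) powr q \<le> cutoff z powr q" if "0 \<le> z" "z \<le> 1/2"
    proof (intro powr_mono2)
      have "z\<^sup>2 \<le> (1/2)\<^sup>2" using that by (intro power_mono) auto
      then have "(3/4)\<^sup>2 \<le> (max 0 (1 - z\<^sup>2))\<^sup>2"
        by (intro power_mono) (auto simp: power2_eq_square)
      then show "9/16 \<le> cutoff z" by (simp add: cutoff_def power2_eq_square)
    qed (use q in auto)
    then show "ennreal ((9/16) powr q) * indicator {0..1/2} z \<le> ennreal (cutoff z powr q)"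
      by (auto simp: indicator_def intro: ennreal_leI)
  qed
  finally have "?I > 0" .
  with fin show thesis
    by (intro that[of "enn2real ?I"]) (auto simp: enn2real_positive_iff)
qed

context hardy_parameters
begin

definition test :: "real \<Rightarrow> 'a::euclidean_space \<Rightarrow> real" where
  "test N x = norm x powr (- \<gamma>) * cutoff (ln (norm x) / N)"

lemma test_measurable [measurable]: "test N \<in> borel_measurable borel"
  unfolding test_def by measurable

text \<open>The support lies in the annulus \<open>exp (- N) \<le> |x| \<le> exp N\<close>, so one
  family serves both choices of \<open>U\<close>.\<close>

lemma test_C1c:
  fixes U :: "'a::euclidean_space set"
  assumes N: "N > 0" and U: "UNIV - {0} \<subseteq> U"
  shows "C1c U (test N)"
proof -
  define \<phi> where "\<phi> r = r powr (- \<gamma>) * cutoff (ln r / N)" for r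
  define \<phi>' where "\<phi>' r = - \<gamma> * r powr (- \<gamma> - 1) * cutoff (ln r / N) + r powr (- \<gamma>) * (cutoff' (ln r / N) * (1 / r / N))" for r
  define u' where "u' x = (\<phi>' (norm x) / norm x) *\<^sub>R blinfun_inner_right x" for x :: 'a
  define r0 where "r0 = exp (- N)"
  have r0: "r0 > 0" by (simp add: r0_def)
  have small: "cutoff (ln r / N) = 0" "cutoff' (ln r / N) = 0" if "0 < r" "r \<le> r0" for r
  proof -
    have "ln r \<le> - N" using that by (simp add: r0_def ln_ge_iff flip: ln_le_cancel_iff)
    then have "\<bar>ln r / N\<bar> \<ge> 1" using N by (simp add: field_simps)
    then show "cutoff (ln r / N) = 0" "cutoff' (ln r / N) = 0" by (auto intro: cutoff_eq_0)
  qed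
  have zero: "test N x = 0" "u' x = 0" if "norm x \<le> r0" for x
    using small[of "norm x"] that by (cases "x = 0"; simp add: test_def u'_def \<phi>'_def)+
  have large: "test N x = 0" if "norm x \<ge> exp N" for x
  proof -
    have "norm x > 0" using that exp_gt_zero[of N] by linarith
    then have "ln (norm x) \<ge> N" using that by (simp add: ln_ge_iff)
    then have "\<bar>ln (norm x) / N\<bar> \<ge> 1" using N by (simp add: field_simps)
    then show ?thesis by (simp add: test_def cutoff_eq_0)
  qed
  have deriv: "(test N has_derivative blinfun_apply (u' x)) (at x)" for x :: 'a
  proof (cases "x = 0")
    case True
    have "((\<lambda>_. 0) has_derivative blinfun_apply (u' x)) (at x)"
      using r0 zero(2)[of x] True by (simp add: zero_blinfun.rep_eq)
    then show ?thesis
      by (rule has_derivative_transform_within_open[where s = "ball 0 r0"]) (use True r0 zero in auto)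
  next
    case False
    then have nx: "norm x > 0" by simp
    have D: "(\<phi> has_real_derivative \<phi>' (norm x)) (at (norm x))"
      unfolding \<phi>_def \<phi>'_def
      using nx N by (auto intro!: derivative_eq_intros DERIV_chain2[where f = cutoff, OF DERIV_cutoff])
    have "((\<lambda>x. \<phi> (norm x)) has_derivative (\<lambda>h. \<phi>' (norm x) * (sgn x \<bullet> h))) (at x)"
      using has_derivative_compose[OF has_derivative_norm[OF False] D[unfolded has_field_derivative_def]]
      by (simp add: inner_commute)
    moreover have "(\<lambda>h. \<phi>' (norm x) * (sgn x \<bullet> h)) = blinfun_apply (u' x)"
      by (auto simp: u'_def sgn_div_norm scaleR_blinfun.rep_eq divide_inverse)
    ultimately show ?thesis
      unfolding test_def[abs_def] \<phi>_def by simp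
  qed
  have "continuous_on UNIV u'"
  proof -
    have "continuous_on ((UNIV - {0}) \<union> ball 0 r0) u'"
    proof (rule continuous_on_open_Un)
      show "continuous_on (UNIV - {0}) u'"
        unfolding u'_def \<phi>'_def
        by (intro continuous_intros bounded_linear.continuous_on[OF bounded_linear_blinfun_inner_right]) (use N in auto)
      have "continuous_on (ball 0 r0) (\<lambda>_. 0 :: 'a \<Rightarrow>\<^sub>L real)" by simp
      then show "continuous_on (ball 0 r0) u'"
        by (rule continuous_on_eq) (simp add: zero(2))
    qed auto
    moreover have "(UNIV - {0}) \<union> ball 0 r0 = (UNIV :: 'a set)" using r0 by auto
    ultimately show ?thesis by simp
  qed
  moreover have sub: "{x. test N x \<noteq> 0} \<subseteq> cball 0 (exp N) - ball (0::'a) r0"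
  proof
    fix x :: 'a assume "x \<in> {x. test N x \<noteq> 0}"
    then have "\<not> norm x \<le> r0" "\<not> norm x \<ge> exp N" using zero(1)[of x] large[of x] by auto
    then show "x \<in> cball 0 (exp N) - ball 0 r0" by auto
  qed
  moreover have "closed (cball 0 (exp N) - ball (0::'a) r0)"
    by (intro closed_Diff) auto
  ultimately have "closure {x. test N x \<noteq> 0} \<subseteq> cball 0 (exp N) - ball (0::'a) r0"
    by (intro closure_minimal)
  moreover have "cball 0 (exp N) - ball (0::'a) r0 \<subseteq> U"
    using U r0 by auto
  moreover have "compact (closure {x::'a. test N x \<noteq> 0})"
    unfolding compact_closure using sub by (meson bounded_cball bounded_diff bounded_subset)
  ultimately show ?thesis
    unfolding C1c_def using deriv continuous_on_subset[OF \<open>continuous_on UNIV u'\<close>, of U]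
    by (intro conjI exI[of _ u']) auto
qed

text \<open>\<open>\<gamma>\<close> is the exponent for which \<open>w powr q\<close> times the
  Hardy weight is the scale-invariant density \<open>|x| powr (- d)\<close>.\<close>

lemma test_powr_q:
  fixes x :: "'a::euclidean_space"
  assumes dim: "d = DIM('a)" and x: "x \<noteq> 0"
  shows "\<bar>test N x\<bar> powr q / norm x powr (s * q - \<alpha> - q * \<beta> / p)
    = norm x powr (- real d) * cutoff (ln (norm x) / N) powr q"
proof -
  have "norm x powr (- \<gamma> * q) * norm x powr (real d - m + \<beta> + \<kappa>) = norm x powr (- real d)"
  proof -
    have "- \<gamma> * q + (real d - m + \<beta> + \<kappa>) = - real d" using \<gamma>_q \<kappa>_eq by (simp add: m_def)
    then show ?thesis by (simp only: powr_add[symmetric])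
  qed
  then show ?thesis
    unfolding RHS_integrand[OF x] test_def
    by (simp add: abs_mult cutoff_nonneg powr_mult powr_powr mult_ac)
qed

lemma RHS_test:
  assumes dim: "d = DIM('a::euclidean_space)"
  shows "RHS s p q \<alpha> \<beta> (test N :: 'a \<Rightarrow> real)
    = (\<integral>\<^sup>+ (x::'a). ennreal (norm x powr (- real DIM('a))) * ennreal (cutoff (ln (norm x) / N) powr q) \<partial>lborel)"
  unfolding RHS_def
  by (rule nn_integral_cong_AE, use AE_lborel_nonzero in eventually_elim)
     (simp add: test_powr_q[OF dim] ennreal_mult' flip: dim)

text \<open>In each term the dependence on \<open>x\<close> is separated from that on the ratio
  \<open>t\<close>, so that its \<open>y\<close>-integral is a function of \<open>x\<close> times a
  fixed one-dimensional integral. The error carries the factor \<open>1 / N\<close> and decays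
  exponentially in \<open>|X|\<close>.\<close>

lemma test_difference:
  fixes x y :: "'a::euclidean_space"
  assumes N: "N \<ge> 1" and \<kappa>': "\<kappa>' \<ge> 0" and xy: "x \<noteq> 0" "y \<noteq> 0"
  defines "t \<equiv> norm y / norm x" and "X \<equiv> ln (norm x) / N"
  shows "\<bar>test N x - test N y\<bar> \<le> norm x powr (- \<gamma>) * (cutoff X * \<bar>1 - \<theta> t\<bar>
    + 4 / N * exp (\<kappa>' * (1 - \<bar>X\<bar>)) * (\<theta> t * \<bar>ln t\<bar> * exp (\<kappa>' * \<bar>ln t\<bar>)))"
proof -
  have t: "t > 0" using xy by (simp add: t_def)
  have ln_y: "ln (norm y) = ln (norm x) + ln t"
    using xy by (simp add: t_def ln_div)
  have "norm y = norm x * t" using xy by (simp add: t_def)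
  then have y: "norm y powr (- \<gamma>) = norm x powr (- \<gamma>) * \<theta> t"
    by (simp add: \<theta>_def powr_mult)
  let ?Y = "(ln (norm x) + ln t) / N"
  have "test N x - test N y = norm x powr (- \<gamma>) * (cutoff X * (1 - \<theta> t) + \<theta> t * (cutoff X - cutoff ?Y))"
    unfolding test_def y ln_y by (simp add: X_def algebra_simps)
  then have "\<bar>test N x - test N y\<bar> = norm x powr (- \<gamma>) * \<bar>cutoff X * (1 - \<theta> t) + \<theta> t * (cutoff X - cutoff ?Y)\<bar>"
    by (simp add: abs_mult)
  also have "\<dots> \<le> norm x powr (- \<gamma>) * (cutoff X * \<bar>1 - \<theta> t\<bar> + \<theta> t * \<bar>cutoff X - cutoff ?Y\<bar>)"
    using \<theta>_pos[OF t] cutoff_nonneg[of X]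
    by (intro mult_left_mono order_trans[OF abs_triangle_ineq]) (auto simp: abs_mult)
  also have "\<dots> \<le> norm x powr (- \<gamma>) * (cutoff X * \<bar>1 - \<theta> t\<bar>
      + \<theta> t * (4 * \<bar>ln t\<bar> / N * exp (\<kappa>' * \<bar>ln t\<bar>) * exp (\<kappa>' * (1 - \<bar>X\<bar>))))"
    using \<theta>_pos[OF t] unfolding X_def
    by (intro mult_left_mono add_left_mono cutoff_log_difference N \<kappa>') auto
  finally show ?thesis by (simp add: mult_ac)
qed

text \<open>The sum inside the \<open>p\<close>-th power is split by convexity with a free parameter
  \<open>\<theta>'\<close>, which costs the main term only the factor
  \<open>(1 - \<theta>') powr (1 - p)\<close>; the large factor
  \<open>\<theta>' powr (1 - p)\<close> falls on the error term.\<close>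

lemma LHS_test_le:
  fixes \<theta>' \<kappa>' N J :: real
  assumes dim: "d = DIM('a::euclidean_space)" and N: "N \<ge> 1" and \<kappa>': "\<kappa>' \<ge> 0" and \<theta>': "0 < \<theta>'" "\<theta>' < 1"
    and J: "radN d m (\<lambda>t. ennreal ((\<theta> t * \<bar>ln t\<bar> * exp (\<kappa>' * \<bar>ln t\<bar>)) powr p) * ennreal (t powr \<beta>)) = ennreal J" "J \<ge> 0"
  shows "LHS s p q \<alpha> \<beta> (test N :: 'a \<Rightarrow> real)
    \<le> ennreal (((1 - \<theta>') powr (1 - p) * K) powr (q / p)) * RHS s p q \<alpha> \<beta> (test N :: 'a \<Rightarrow> real)
      + ennreal ((\<theta>' powr (1 - p) * (4 / N) powr p * J) powr (q / p))
        * (\<integral>\<^sup>+ (x::'a). ennreal (norm x powr (- real DIM('a))) * ennreal (exp (\<kappa>' * (1 - \<bar>ln (norm x) / N\<bar>)) powr q) \<partial>lborel)"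
proof -
  define a1 where "a1 = (1 - \<theta>') powr (1 - p) * K"
  define a2 where "a2 = \<theta>' powr (1 - p) * (4 / N) powr p * J"
  have a: "a1 \<ge> 0" "a2 \<ge> 0" using K_nonneg J(2) by (auto simp: a1_def a2_def)
  let ?X = "\<lambda>x::'a. ln (norm x) / N"
  let ?E = "\<lambda>x::'a. exp (\<kappa>' * (1 - \<bar>?X x\<bar>))"
  let ?u = "test N :: 'a \<Rightarrow> real"
  let ?F = "\<lambda>x. \<integral>\<^sup>+ y. ennreal (\<bar>?u x - ?u y\<bar> powr p / norm (x - y) powr (real DIM('a) + s * p) * norm y powr \<beta>) \<partial>lborel"
  let ?Z = "\<lambda>t. (\<theta> t * \<bar>ln t\<bar> * exp (\<kappa>' * \<bar>ln t\<bar>)) powr p"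
  have main: "epowr (?F x) (q / p) * ennreal (norm x powr \<alpha>)
      \<le> ennreal (a1 powr (q / p)) * ennreal (\<bar>?u x\<bar> powr q / norm x powr (s * q - \<alpha> - q * \<beta> / p))
        + ennreal (a2 powr (q / p)) * (ennreal (norm x powr (- real DIM('a))) * ennreal (?E x powr q))"
    if x: "x \<noteq> 0" for x :: 'a
  proof -
    let ?r = "norm x"
    define A1 where "A1 = ?r powr (- \<gamma> * p) * ((1 - \<theta>') powr (1 - p) * cutoff (?X x) powr p)"
    define A2 where "A2 = ?r powr (- \<gamma> * p) * (\<theta>' powr (1 - p) * (4 / N) powr p * ?E x powr p)"
    have A: "A1 \<ge> 0" "A2 \<ge> 0" by (simp_all add: A1_def A2_def)
    let ?w = "\<lambda>y. ennreal (norm (x - y) powr (- m)) * ennreal (norm y powr \<beta>)"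
    have diff: "\<bar>?u x - ?u y\<bar> powr p \<le> A1 * \<bar>1 - \<theta> (norm y / ?r)\<bar> powr p + A2 * ?Z (norm y / ?r)" if y: "y \<noteq> 0" for y
    proof -
      let ?t = "norm y / ?r"
      let ?z = "\<theta> ?t * \<bar>ln ?t\<bar> * exp (\<kappa>' * \<bar>ln ?t\<bar>)"
      have t: "?t > 0" using x y by simp
      have z: "?z \<ge> 0" using \<theta>_pos[OF t] by simp
      have "\<bar>?u x - ?u y\<bar> powr p \<le> (?r powr (- \<gamma>) * (cutoff (?X x) * \<bar>1 - \<theta> ?t\<bar> + 4 / N * ?E x * ?z)) powr p"
        using p test_difference[OF N \<kappa>' x y] by (intro powr_mono2) auto
      also have "\<dots> = ?r powr (- \<gamma> * p) * (cutoff (?X x) * \<bar>1 - \<theta> ?t\<bar> + 4 / N * ?E x * ?z) powr p"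
        using cutoff_nonneg[of "?X x"] z N by (subst powr_mult) (auto simp: powr_powr)
      also have "\<dots> \<le> ?r powr (- \<gamma> * p) * ((1 - \<theta>') powr (1 - p) * (cutoff (?X x) * \<bar>1 - \<theta> ?t\<bar>) powr p
          + \<theta>' powr (1 - p) * (4 / N * ?E x * ?z) powr p)"
        using cutoff_nonneg[of "?X x"] z N p \<theta>' by (intro mult_left_mono powr_add_le) auto
      also have "(4 / N * ?E x * ?z) powr p = (4 / N) powr p * ?E x powr p * ?Z ?t"
        using z N by (simp only: powr_mult)
      also have "(cutoff (?X x) * \<bar>1 - \<theta> ?t\<bar>) powr p = cutoff (?X x) powr p * \<bar>1 - \<theta> ?t\<bar> powr p"
        using cutoff_nonneg[of "?X x"] by (simp add: powr_mult)
      finally show ?thesis by (simp only: A1_def A2_def distrib_left mult_ac)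
    qed
    have "?F x \<le> (\<integral>\<^sup>+ y. ennreal A1 * (ennreal (\<bar>1 - \<theta> (norm y / ?r)\<bar> powr p) * ?w y)
        + ennreal A2 * (ennreal (?Z (norm y / ?r)) * ?w y) \<partial>lborel)"
    proof (rule nn_integral_mono_AE, use AE_lborel_nonzero in eventually_elim)
      fix y :: 'a assume y: "y \<noteq> 0"
      have "ennreal (\<bar>?u x - ?u y\<bar> powr p / norm (x - y) powr (real DIM('a) + s * p) * norm y powr \<beta>)
          = ennreal (\<bar>?u x - ?u y\<bar> powr p) * ?w y"
        unfolding dim[symmetric]
        by (simp add: m_def powr_minus divide_inverse ennreal_mult'[symmetric] mult.assoc del: minus_add_distrib)
      also have "\<dots> \<le> ennreal (A1 * \<bar>1 - \<theta> (norm y / ?r)\<bar> powr p + A2 * ?Z (norm y / ?r)) * ?w y"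
        by (intro mult_right_mono ennreal_leI diff y) simp
      also have "ennreal (A1 * \<bar>1 - \<theta> (norm y / ?r)\<bar> powr p + A2 * ?Z (norm y / ?r))
          = ennreal A1 * ennreal (\<bar>1 - \<theta> (norm y / ?r)\<bar> powr p) + ennreal A2 * ennreal (?Z (norm y / ?r))"
        using A by (simp only: ennreal_plus mult_nonneg_nonneg powr_ge_zero ennreal_mult)
      finally show "ennreal (\<bar>?u x - ?u y\<bar> powr p / norm (x - y) powr (real DIM('a) + s * p) * norm y powr \<beta>)
          \<le> ennreal A1 * (ennreal (\<bar>1 - \<theta> (norm y / ?r)\<bar> powr p) * ?w y) + ennreal A2 * (ennreal (?Z (norm y / ?r)) * ?w y)"
        by (simp only: distrib_right mult.assoc)
    qed
    also have "\<dots> = (\<integral>\<^sup>+ y. ennreal A1 * (ennreal (\<bar>1 - \<theta> (norm y / ?r)\<bar> powr p) * ?w y) \<partial>lborel)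
        + (\<integral>\<^sup>+ y. ennreal A2 * (ennreal (?Z (norm y / ?r)) * ?w y) \<partial>lborel)"
      by (rule nn_integral_add) measurable
    also have "(\<integral>\<^sup>+ y. ennreal A1 * (ennreal (\<bar>1 - \<theta> (norm y / ?r)\<bar> powr p) * ?w y) \<partial>lborel)
        = ennreal A1 * (\<integral>\<^sup>+ y. ennreal (\<bar>1 - \<theta> (norm y / ?r)\<bar> powr p) * ?w y \<partial>lborel)"
      by (rule nn_integral_cmult) measurable
    also have "(\<integral>\<^sup>+ y. ennreal (\<bar>1 - \<theta> (norm y / ?r)\<bar> powr p) * ?w y \<partial>lborel)
        = ennreal (?r powr (\<beta> - s * p)) * ennreal K"
      using nn_integral_kernel_ratio[OF dim x, of "\<lambda>t. ennreal (\<bar>1 - \<theta> t\<bar> powr p)"]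
      by (simp add: radN_eq_K[OF dim, symmetric] ennreal_mult')
    also have "(\<integral>\<^sup>+ y. ennreal A2 * (ennreal (?Z (norm y / ?r)) * ?w y) \<partial>lborel)
        = ennreal A2 * (\<integral>\<^sup>+ y. ennreal (?Z (norm y / ?r)) * ?w y \<partial>lborel)"
      by (rule nn_integral_cmult) measurable
    also have "(\<integral>\<^sup>+ y. ennreal (?Z (norm y / ?r)) * ?w y \<partial>lborel) = ennreal (?r powr (\<beta> - s * p)) * ennreal J"
      using nn_integral_kernel_ratio[OF dim x, of "\<lambda>t. ennreal (?Z t)"] by (simp add: J)
    also have "ennreal A1 * (ennreal (?r powr (\<beta> - s * p)) * ennreal K) + ennreal A2 * (ennreal (?r powr (\<beta> - s * p)) * ennreal J)
        = ennreal (?r powr (- \<gamma> * p) * ?r powr (\<beta> - s * p) * (a1 * cutoff (?X x) powr p + a2 * ?E x powr p))"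
    proof -
      have "ennreal A1 * (ennreal (?r powr (\<beta> - s * p)) * ennreal K) + ennreal A2 * (ennreal (?r powr (\<beta> - s * p)) * ennreal J)
          = ennreal (A1 * (?r powr (\<beta> - s * p) * K) + A2 * (?r powr (\<beta> - s * p) * J))"
        using A K_nonneg J(2) by (simp only: ennreal_plus mult_nonneg_nonneg powr_ge_zero ennreal_mult)
      also have "A1 * (?r powr (\<beta> - s * p) * K) + A2 * (?r powr (\<beta> - s * p) * J)
          = ?r powr (- \<gamma> * p) * ?r powr (\<beta> - s * p) * (a1 * cutoff (?X x) powr p + a2 * ?E x powr p)"
        by (simp only: A1_def A2_def a1_def a2_def distrib_left mult_ac)
      finally show ?thesis .
    qed
    finally have "epowr (?F x) (q / p)
        \<le> ennreal ((?r powr (- \<gamma> * p) * ?r powr (\<beta> - s * p) * (a1 * cutoff (?X x) powr p + a2 * ?E x powr p)) powr (q / p))"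
      using a p q0 by (intro epowr_le_ennreal) auto
    also have "\<dots> \<le> ennreal (?r powr (- \<gamma> * q + (\<beta> - s * p) * (q / p)) *
        (a1 powr (q / p) * cutoff (?X x) powr q + a2 powr (q / p) * ?E x powr q))"
    proof (rule ennreal_leI)
      have "(?r powr (- \<gamma> * p) * ?r powr (\<beta> - s * p) * (a1 * cutoff (?X x) powr p + a2 * ?E x powr p)) powr (q / p)
          = ?r powr (- \<gamma> * q + (\<beta> - s * p) * (q / p)) * (a1 * cutoff (?X x) powr p + a2 * ?E x powr p) powr (q / p)"
      proof -
        have e: "- \<gamma> * q + (\<beta> - s * p) * (q / p) = (- \<gamma> * p + (\<beta> - s * p)) * (q / p)"
          using p by (simp add: field_simps)
        have "a1 * cutoff (?X x) powr p + a2 * ?E x powr p \<ge> 0" using a by simp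
        then show ?thesis
          unfolding e powr_powr[symmetric] powr_add[of ?r "- \<gamma> * p"]
          by (intro powr_mult)
      qed
      \<comment> \<open>As \<open>q / p \<le> 1\<close>, the outer power is subadditive, so this
        splitting adds no factor to the main term.\<close>
      also have "\<dots> \<le> ?r powr (- \<gamma> * q + (\<beta> - s * p) * (q / p)) * ((a1 * cutoff (?X x) powr p) powr (q / p) + (a2 * ?E x powr p) powr (q / p))"
        using a p q by (intro mult_left_mono powr_subadditive) auto
      also have "(a1 * cutoff (?X x) powr p) powr (q / p) = a1 powr (q / p) * cutoff (?X x) powr q"
        using a p by (simp add: powr_mult powr_powr)
      also have "(a2 * ?E x powr p) powr (q / p) = a2 powr (q / p) * ?E x powr q"
        using a p by (simp add: powr_mult powr_powr)
      finally show "(?r powr (- \<gamma> * p) * ?r powr (\<beta> - s * p) * (a1 * cutoff (?X x) powr p + a2 * ?E x powr p)) powr (q / p)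
          \<le> ?r powr (- \<gamma> * q + (\<beta> - s * p) * (q / p)) * (a1 powr (q / p) * cutoff (?X x) powr q + a2 powr (q / p) * ?E x powr q)" .
    qed
    finally have "epowr (?F x) (q / p) * ennreal (?r powr \<alpha>) \<le> ennreal (?r powr (- \<gamma> * q + (\<beta> - s * p) * (q / p)) *
        (a1 powr (q / p) * cutoff (?X x) powr q + a2 powr (q / p) * ?E x powr q)) * ennreal (?r powr \<alpha>)"
      by (rule mult_right_mono) simp
    also have "\<dots> = ennreal (?r powr (- \<gamma> * q + (\<beta> - s * p) * (q / p)) *
        (a1 powr (q / p) * cutoff (?X x) powr q + a2 powr (q / p) * ?E x powr q) * ?r powr \<alpha>)"
      by (rule ennreal_mult''[symmetric]) simp
    also have "?r powr (- \<gamma> * q + (\<beta> - s * p) * (q / p)) * (a1 powr (q / p) * cutoff (?X x) powr q + a2 powr (q / p) * ?E x powr q) * ?r powr \<alpha>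
        = a1 powr (q / p) * (?r powr (- real d) * cutoff (?X x) powr q) + a2 powr (q / p) * (?r powr (- real d) * ?E x powr q)"
    proof -
      \<comment> \<open>By the choice of \<open>\<gamma>\<close> main and error term both carry the
        scale-invariant density \<open>|x| powr (- d)\<close>.\<close>
      have "- \<gamma> * q + (\<beta> - s * p) * (q / p) + \<alpha> = - real d"
        using \<gamma>_q p by (simp add: field_simps)
      then have "?r powr (- real d) = ?r powr (- \<gamma> * q + (\<beta> - s * p) * (q / p)) * ?r powr \<alpha>"
        by (simp only: powr_add[symmetric])
      then show ?thesis by (simp only: distrib_left distrib_right mult_ac)
    qed
    also have "?r powr (- real d) * cutoff (?X x) powr q = \<bar>?u x\<bar> powr q / ?r powr (s * q - \<alpha> - q * \<beta> / p)"
      by (rule test_powr_q[OF dim x, symmetric])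
    also have "ennreal (a1 powr (q / p) * (\<bar>?u x\<bar> powr q / ?r powr (s * q - \<alpha> - q * \<beta> / p))
          + a2 powr (q / p) * (?r powr (- real d) * ?E x powr q))
        = ennreal (a1 powr (q / p)) * ennreal (\<bar>?u x\<bar> powr q / ?r powr (s * q - \<alpha> - q * \<beta> / p))
          + ennreal (a2 powr (q / p)) * (ennreal (?r powr (- real d)) * ennreal (?E x powr q))"
      by (simp only: ennreal_plus ennreal_mult mult_nonneg_nonneg divide_nonneg_nonneg powr_ge_zero)
    finally show ?thesis
      unfolding dim[symmetric] .
  qed
  have "LHS s p q \<alpha> \<beta> ?u \<le> (\<integral>\<^sup>+ (x::'a). ennreal (a1 powr (q / p)) * ennreal (\<bar>?u x\<bar> powr q / norm x powr (s * q - \<alpha> - q * \<beta> / p))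
        + ennreal (a2 powr (q / p)) * (ennreal (norm x powr (- real DIM('a))) * ennreal (?E x powr q)) \<partial>lborel)"
    unfolding LHS_def by (rule nn_integral_mono_AE, use AE_lborel_nonzero in eventually_elim) (rule main)
  also have "\<dots> = (\<integral>\<^sup>+ (x::'a). ennreal (a1 powr (q / p)) * ennreal (\<bar>?u x\<bar> powr q / norm x powr (s * q - \<alpha> - q * \<beta> / p)) \<partial>lborel)
        + (\<integral>\<^sup>+ (x::'a). ennreal (a2 powr (q / p)) * (ennreal (norm x powr (- real DIM('a))) * ennreal (?E x powr q)) \<partial>lborel)"
    by (rule nn_integral_add) measurable
  also have "(\<integral>\<^sup>+ (x::'a). ennreal (a1 powr (q / p)) * ennreal (\<bar>?u x\<bar> powr q / norm x powr (s * q - \<alpha> - q * \<beta> / p)) \<partial>lborel)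
      = ennreal (a1 powr (q / p)) * RHS s p q \<alpha> \<beta> ?u"
    unfolding RHS_def by (rule nn_integral_cmult) measurable
  also have "(\<integral>\<^sup>+ (x::'a). ennreal (a2 powr (q / p)) * (ennreal (norm x powr (- real DIM('a))) * ennreal (?E x powr q)) \<partial>lborel)
      = ennreal (a2 powr (q / p)) * (\<integral>\<^sup>+ (x::'a). ennreal (norm x powr (- real DIM('a))) * ennreal (?E x powr q) \<partial>lborel)"
    by (rule nn_integral_cmult) measurable
  finally show ?thesis by (simp only: a1_def a2_def)
qed


text \<open>The admissible interval for the exponent is open, so changing
  \<open>\<beta> - \<gamma> p\<close> by a small \<open>\<epsilon>\<close> either way keeps the
  integral finite; \<open>exp (\<epsilon> * |ln t|)\<close> is at most
  \<open>t powr \<epsilon> + t powr (- \<epsilon>)\<close>. The exponential rate is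
  \<open>\<epsilon> / p\<close> because the expression is raised to the power
  \<open>p\<close>.\<close>

lemma radN_log_exp_finite:
  assumes dim: "d = DIM('a::euclidean_space)"
  obtains \<kappa>' J where "\<kappa>' > 0" "J \<ge> 0"
    "radN d m (\<lambda>t. ennreal ((\<theta> t * \<bar>ln t\<bar> * exp (\<kappa>' * \<bar>ln t\<bar>)) powr p) * ennreal (t powr \<beta>)) = ennreal J"
proof -
  define \<epsilon> where "\<epsilon> = min (\<beta> - \<gamma> * p + real d) (s * p - (\<beta> - \<gamma> * p)) / 2"
  have \<epsilon>: "\<epsilon> > 0" "\<beta> - \<gamma> * p - \<epsilon> > - real d" "\<beta> - \<gamma> * p + \<epsilon> < s * p"
    using \<beta>_\<gamma> by (auto simp: \<epsilon>_def min_def field_simps)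
  define \<kappa>' where "\<kappa>' = \<epsilon> / p"
  have \<kappa>': "\<kappa>' > 0" "\<kappa>' * p = \<epsilon>" using \<epsilon> p by (auto simp: \<kappa>'_def)
  let ?h = "\<lambda>\<sigma> t. ennreal (\<bar>ln t\<bar> powr p * t powr \<sigma>)"
  let ?N = "radN d m (\<lambda>t. ennreal ((\<theta> t * \<bar>ln t\<bar> * exp (\<kappa>' * \<bar>ln t\<bar>)) powr p) * ennreal (t powr \<beta>))"
  have mm: "m = real DIM('a) + s * p" unfolding dim[symmetric] by (rule m_def)
  have fin: "radN d m (?h \<sigma>) < \<infinity>" if "- real d < \<sigma>" "\<sigma> < s * p" for \<sigma>
    using radN_abs_ln_powr_finite[where 'a = 'a, OF s(2) p(2) _ _ mm, of \<sigma>] that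
    unfolding dim[symmetric] by simp
  have "?N \<le> radN d m (\<lambda>t. ?h (\<beta> - \<gamma> * p + \<epsilon>) t + ?h (\<beta> - \<gamma> * p - \<epsilon>) t)"
  proof (rule radN_mono)
    fix t :: real assume t: "t > 0"
    have "exp (\<kappa>' * \<bar>ln t\<bar>) powr p = exp (\<epsilon> * \<bar>ln t\<bar>)"
      using \<kappa>' by (simp add: exp_powr_real mult_ac)
    also have "\<dots> \<le> t powr \<epsilon> + t powr (- \<epsilon>)"
      using t by (cases "ln t \<ge> 0") (auto simp: powr_def)
    finally have "(\<theta> t powr p * \<bar>ln t\<bar> powr p) * exp (\<kappa>' * \<bar>ln t\<bar>) powr p * t powr \<beta>
        \<le> (\<theta> t powr p * \<bar>ln t\<bar> powr p) * (t powr \<epsilon> + t powr (- \<epsilon>)) * t powr \<beta>"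
      by (intro mult_right_mono mult_left_mono) auto
    also have "\<dots> = \<bar>ln t\<bar> powr p * t powr (\<beta> - \<gamma> * p + \<epsilon>) + \<bar>ln t\<bar> powr p * t powr (\<beta> - \<gamma> * p - \<epsilon>)"
    proof -
      have "\<theta> t powr p = t powr (- \<gamma> * p)" by (simp add: \<theta>_def powr_powr)
      moreover have "t powr (\<beta> - \<gamma> * p + \<epsilon>) = t powr (- \<gamma> * p) * t powr \<epsilon> * t powr \<beta>"
        by (simp add: powr_add[symmetric] algebra_simps)
      moreover have "t powr (\<beta> - \<gamma> * p - \<epsilon>) = t powr (- \<gamma> * p) * t powr (- \<epsilon>) * t powr \<beta>"
        by (simp add: powr_add[symmetric] algebra_simps)
      ultimately show ?thesis by (simp only: distrib_left distrib_right mult_ac)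
    qed
    finally have le: "(\<theta> t powr p * \<bar>ln t\<bar> powr p) * exp (\<kappa>' * \<bar>ln t\<bar>) powr p * t powr \<beta>
      \<le> \<bar>ln t\<bar> powr p * t powr (\<beta> - \<gamma> * p + \<epsilon>) + \<bar>ln t\<bar> powr p * t powr (\<beta> - \<gamma> * p - \<epsilon>)" .
    have "ennreal ((\<theta> t * \<bar>ln t\<bar> * exp (\<kappa>' * \<bar>ln t\<bar>)) powr p) * ennreal (t powr \<beta>)
        = ennreal ((\<theta> t powr p * \<bar>ln t\<bar> powr p) * exp (\<kappa>' * \<bar>ln t\<bar>) powr p * t powr \<beta>)"
      using \<theta>_pos[OF t] by (subst ennreal_mult[symmetric]) (simp_all add: powr_mult)
    also have "\<dots> \<le> ennreal (\<bar>ln t\<bar> powr p * t powr (\<beta> - \<gamma> * p + \<epsilon>) + \<bar>ln t\<bar> powr p * t powr (\<beta> - \<gamma> * p - \<epsilon>))"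
      by (rule ennreal_leI[OF le])
    also have "\<dots> = ?h (\<beta> - \<gamma> * p + \<epsilon>) t + ?h (\<beta> - \<gamma> * p - \<epsilon>) t"
      by (rule ennreal_plus) simp_all
    finally show "ennreal ((\<theta> t * \<bar>ln t\<bar> * exp (\<kappa>' * \<bar>ln t\<bar>)) powr p) * ennreal (t powr \<beta>)
        \<le> ?h (\<beta> - \<gamma> * p + \<epsilon>) t + ?h (\<beta> - \<gamma> * p - \<epsilon>) t" .
  qed
  also have "\<dots> = radN d m (?h (\<beta> - \<gamma> * p + \<epsilon>)) + radN d m (?h (\<beta> - \<gamma> * p - \<epsilon>))"
    by (rule radN_add) measurable
  also have "\<dots> < \<infinity>"
    using fin[of "\<beta> - \<gamma> * p + \<epsilon>"] fin[of "\<beta> - \<gamma> * p - \<epsilon>"] \<epsilon> by simp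
  finally show thesis
    using \<kappa>' by (intro that[of \<kappa>' "enn2real ?N"]) auto
qed

text \<open>After division by the factor \<open>N\<close> common to all integrals the error is of
  order \<open>N powr (- q)\<close>. The limit \<open>N \<rightarrow> \<infinity>\<close> is taken
  for fixed \<open>\<theta>'\<close>, whose error coefficient may blow up as
  \<open>\<theta>' \<rightarrow> 0\<close>; only then does \<open>\<theta>'\<close> tend to
  0.\<close>

lemma Hardy_sharp:
  fixes U :: "'a::euclidean_space set" and c :: real
  assumes dim: "d = DIM('a)" and U: "UNIV - {0} \<subseteq> U"
    and c: "\<And>u. C1c U u \<Longrightarrow> ennreal c * RHS s p q \<alpha> \<beta> u \<le> LHS s p q \<alpha> \<beta> u"
  shows "ennreal c \<le> Cconst d s p q \<alpha> \<beta>"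
proof (cases "c > 0")
  case False
  \<comment> \<open>A constant \<open>c \<le> 0\<close> is truncated to 0 by
    \<open>ennreal\<close>.\<close>
  then show ?thesis by (simp add: ennreal_neg)
next
  case True
  let ?\<omega> = "real DIM('a) * unit_ball_vol (DIM('a))"
  have \<omega>: "?\<omega> > 0" by simp
  obtain \<kappa>' J where J: "\<kappa>' > 0" "J \<ge> 0"
    "radN d m (\<lambda>t. ennreal ((\<theta> t * \<bar>ln t\<bar> * exp (\<kappa>' * \<bar>ln t\<bar>)) powr p) * ennreal (t powr \<beta>)) = ennreal J"
    using radN_log_exp_finite[OF dim] by blast
  obtain I where I: "I > 0" "(\<integral>\<^sup>+ z. ennreal (cutoff z powr q) \<partial>lborel) = ennreal I"
    using nn_integral_cutoff_powr[OF q0] by blast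
  define E where "E = enn2real (\<integral>\<^sup>+ z. ennreal (exp (\<kappa>' * (1 - \<bar>z\<bar>)) powr q) \<partial>lborel)"
  have E: "(\<integral>\<^sup>+ z. ennreal (exp (\<kappa>' * (1 - \<bar>z\<bar>)) powr q) \<partial>lborel) = ennreal E"
  proof -
    have "exp (\<kappa>' * (1 - \<bar>z\<bar>)) powr q = exp (\<kappa>' * q * (1 - \<bar>z\<bar>))" for z :: real
      by (simp add: exp_powr_real mult_ac)
    then show ?thesis
      using nn_integral_exp_abs_finite[of "\<kappa>' * q"] J(1) q0 unfolding E_def by simp
  qed
  have E0: "E \<ge> 0" by (simp add: E_def)
  \<comment> \<open>The error coefficient without its \<open>N\<close>-dependence:
    \<open>(4 / N) powr p\<close> to the power \<open>q / p\<close> is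
    \<open>4 powr q * N powr (- q)\<close>.\<close>
  define B where "B \<theta>' = (\<theta>' powr (1 - p) * J) powr (q / p) * 4 powr q" for \<theta>'
  have bound: "c * I \<le> ((1 - \<theta>') powr (1 - p) * K) powr (q / p) * I + B \<theta>' * N powr (- q) * E"
    if \<theta>': "0 < \<theta>'" "\<theta>' < 1" and N: "N \<ge> 1" for \<theta>' N
  proof -
    let ?u = "test N :: 'a \<Rightarrow> real"
    define A where "A = ((1 - \<theta>') powr (1 - p) * K) powr (q / p)"
    have R: "RHS s p q \<alpha> \<beta> ?u = ennreal (?\<omega> * N * I)"
      using nn_integral_log_scaled[of "\<lambda>z. ennreal (cutoff z powr q)" N, where 'a = 'a] N I
      unfolding RHS_test[OF dim] by (simp add: ennreal_mult')
    have T: "(\<integral>\<^sup>+ (x::'a). ennreal (norm x powr (- real DIM('a))) * ennreal (exp (\<kappa>' * (1 - \<bar>ln (norm x) / N\<bar>)) powr q) \<partial>lborel)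
        = ennreal (?\<omega> * N * E)"
      using nn_integral_log_scaled[of "\<lambda>z. ennreal (exp (\<kappa>' * (1 - \<bar>z\<bar>)) powr q)" N, where 'a = 'a] N E E0
      by (simp add: ennreal_mult')
    have "(\<theta>' powr (1 - p) * (4 / N) powr p * J) powr (q / p) = B \<theta>' * N powr (- q)"
      using N p J(2) by (simp add: B_def powr_mult powr_divide powr_powr powr_minus field_simps)
    then have "ennreal c * ennreal (?\<omega> * N * I) \<le> ennreal A * ennreal (?\<omega> * N * I) + ennreal (B \<theta>' * N powr (- q)) * ennreal (?\<omega> * N * E)"
      using order_trans[OF c[OF test_C1c[OF _ U]] LHS_test_le[OF dim N _ \<theta>' J(3,2)]] N J(1)
      unfolding R T by (simp add: A_def)
    also have "\<dots> = ennreal (A * (?\<omega> * N * I) + B \<theta>' * N powr (- q) * (?\<omega> * N * E))"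
      using N I(1) E0 \<omega> by (simp add: A_def B_def ennreal_mult' ennreal_plus)
    also have "ennreal c * ennreal (?\<omega> * N * I) = ennreal (c * (?\<omega> * N * I))"
      using True by (simp add: ennreal_mult')
    finally have "c * (?\<omega> * N * I) \<le> A * (?\<omega> * N * I) + B \<theta>' * N powr (- q) * (?\<omega> * N * E)"
      using N I(1) E0 \<omega> by (subst (asm) ennreal_le_iff) (auto simp: A_def B_def)
    then have "(?\<omega> * N) * (c * I) \<le> (?\<omega> * N) * (A * I + B \<theta>' * N powr (- q) * E)"
      by (simp add: algebra_simps)
    then show ?thesis
      using N \<omega> unfolding A_def by (subst (asm) mult_le_cancel_left_pos) auto
  qed
  have step: "c \<le> ((1 - \<theta>') powr (1 - p) * K) powr (q / p)" if \<theta>': "0 < \<theta>'" "\<theta>' < 1" for \<theta>'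
  proof -
    have "((\<lambda>N. N powr (- q)) \<longlongrightarrow> 0) at_top"
      using q0 by (intro tendsto_neg_powr filterlim_ident) auto
    then have "((\<lambda>N. ((1 - \<theta>') powr (1 - p) * K) powr (q / p) * I + B \<theta>' * N powr (- q) * E)
        \<longlongrightarrow> ((1 - \<theta>') powr (1 - p) * K) powr (q / p) * I + B \<theta>' * 0 * E) at_top"
      by (intro tendsto_intros)
    then have "c * I \<le> ((1 - \<theta>') powr (1 - p) * K) powr (q / p) * I + B \<theta>' * 0 * E"
      by (rule tendsto_lowerbound) (use bound[OF \<theta>'] in \<open>auto intro!: eventually_at_top_linorderI[of 1]\<close>)
    then show ?thesis using I(1) by simp
  qed
  have "((\<lambda>\<theta>'. ((1 - \<theta>') powr (1 - p) * K) powr (q / p)) \<longlongrightarrow> ((1 - 0) powr (1 - p) * K) powr (q / p)) (at_right 0)"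
    using p q0 K_nonneg by (intro tendsto_powr' tendsto_mult tendsto_diff tendsto_const tendsto_ident_at) auto
  then have "c \<le> ((1 - 0) powr (1 - p) * K) powr (q / p)"
  proof (rule tendsto_lowerbound)
    have "\<forall>\<^sub>F \<theta>' in at_right 0. \<theta>' \<in> {0<..<1::real}"
      by (rule eventually_at_right_real) simp
    then show "\<forall>\<^sub>F \<theta>' in at_right 0. c \<le> ((1 - \<theta>') powr (1 - p) * K) powr (q / p)"
      by eventually_elim (use step in auto)
  qed simp
  then show ?thesis
    by (simp add: Cconst_eq[OF dim] ennreal_leI)
qed

end

theorem theorem1:
  fixes s p q \<alpha> \<beta> :: real
    and U :: "(real ^ 'n) set"
  assumes "0 < s" "s < 1" "1 \<le> q" "q \<le> p"
    and "\<alpha> < s*q - (1 - q/p) * real CARD('n)"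
    and "\<beta> < s*p" "\<alpha> > - real CARD('n)" "\<beta> > - real CARD('n)"
    and "\<alpha> + q*\<beta>/p > - real CARD('n)"
    and "s*q - \<alpha> - q*\<beta>/p \<noteq> real CARD('n)"
    and "U = (if s*q - \<alpha> - q*\<beta>/p < real CARD('n) then UNIV else UNIV - {0})"
  shows "Cconst CARD('n) s p q \<alpha> \<beta> < \<infinity>
    \<and> (\<forall>u. C1c U u \<longrightarrow> Cconst CARD('n) s p q \<alpha> \<beta> * RHS s p q \<alpha> \<beta> u \<le> LHS s p q \<alpha> \<beta> u)
    \<and> (\<forall>c::real. (\<forall>u. C1c U u \<longrightarrow> ennreal c * RHS s p q \<alpha> \<beta> u \<le> LHS s p q \<alpha> \<beta> u)
                 \<longrightarrow> ennreal c \<le> Cconst CARD('n) s p q \<alpha> \<beta>)"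
proof -
  interpret hardy_parameters s p q \<alpha> \<beta> "CARD('n)"
    using assms by unfold_locales (auto simp: Suc_leI)
  have dim: "CARD('n) = DIM(real ^ 'n)" by simp
  have "Cconst CARD('n) s p q \<alpha> \<beta> < \<infinity>"
    by (simp add: Cconst_eq[OF dim])
  moreover have "Cconst CARD('n) s p q \<alpha> \<beta> * RHS s p q \<alpha> \<beta> u \<le> LHS s p q \<alpha> \<beta> u" if "C1c U u" for u
    using assms C1c_borel_measurable[OF that] C1c_RHS_finite[OF that q0]
    by (intro Hardy_inequality dim) auto
  moreover have "ennreal c \<le> Cconst CARD('n) s p q \<alpha> \<beta>"
    if "\<forall>u. C1c U u \<longrightarrow> ennreal c * RHS s p q \<alpha> \<beta> u \<le> LHS s p q \<alpha> \<beta> u" for c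
    using that assms by (intro Hardy_sharp[OF dim, of U]) auto
  ultimately show ?thesis by blast
qed

end
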